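(* For each $n$ (at least along some subsequence of $n\to\infty$) let $F_n$ be a given graph with vertex set $\{1,\dots,n\}$, and suppose that $\sup_n s_3(F_n)<\infty$. Let $Z_n$ be the size of the component of $F_n$ containing a uniformly random vertex of $F_n$, and write $s_k:=s_k(F_n)$. Fix $t>0$. Then, as $n\to\infty$: (i) If $t\le 1/s_2$, then $C_1(\tilde G(n,t;F_n))=o_p(n)$. (ii) If $t>1/s_2$, then there is a unique $\rho_n>0$ such that $\rho_n=1-\mathbb{E}\, e^{-\rho_n t Z_n}$, and $C_1(\tilde G(n,t;F_n))=\rho_n n+o_p(n)$. (iii) If $t>1/s_2$, let $\delta_n:=t-1/s_2>0$. Then $$\frac{C_1(\tilde G(n,t;F_n))}{n}\ge 2\delta_n\frac{s_2^3}{s_3}\bigl(1-2\delta_n s_2\bigr)+o_p(1).$$ If further $\delta_n s_2^2 s_4/s_3^2\le \tfrac38$, then also $$\frac{C_1(\tilde G(n,t;F_n))}{n}\le 2\delta_n\frac{s_2^3}{s_3}\Bigl(1+\tfrac83\delta_n\frac{s_2^2 s_4}{s_3^2}\Bigr)+o_p(1).$$ (iv) In (iii), if in addition $\liminf_{n\to\infty}\delta_n>0$, then with high probability $$\frac{C_1(\tilde G(n,t;F_n))}{n}\ge 2\delta_n\frac{s_2^3}{s_3}\bigl(1-2\delta_n s_2\bigr),$$ and, if $\delta_n s_2^2 s_4/s_3^2\le\tfrac38$, with high probability $$\frac{C_1(\tilde G(n,t;F_n))}{n}\le 2\delta_n\frac{s_2^3}{s_3}\Bigl(1+\tfrac83\delta_n\frac{s_2^2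 s_4}{s_3^2}\Bigr).$$ The same results (i)–(iv) hold with $\tilde G(n,t;F_n)$ replaced by $G(n,\lfloor nt/2\rfloor;F_n)$ and by $G^*(n,\lfloor nt/2\rfloor;F_n)$.
   Context: For a graph $G$ with components of sizes $C_1\ge C_2\ge\cdots\ge C_{\kappa}$ (and $C_i:=0$ for $i>\kappa$), define $S_k(G)=\sum_i C_i^k$ and $s_k(G)=S_k(G)/|G|$, where $|G|$ is the number of vertices. Random processes starting from a graph $F$ on vertex set $\{1,\dots,n\}$: $G(n,m;F)$ is obtained from $F$ by adding $m$ of the edges of $K_n$ not in $F$, drawn uniformly at random without replacement (one by one in random order); $G^*(n,m;F)$ is obtained from $F$ by drawing $m$ edges of $K_n$ uniformly at random with replacement and adding each one (doing nothing if it is already present); $\tilde G(n,t;F)$ is the continuous-time version: each of the $\binom n2$ pairs of vertices receives edges according to independent Poisson processes of rate $1/n$, and $\tilde G(n,t;F)$ is $F$ together with all edges that arrived during $[0,t]$. $X_n=o_p(n)$ means $X_n/n\to 0$ in probability; "with high probability" means with probability tending to $1$ as $n\to\infty$. *)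

theory Defs
  imports "HOL-Probability.Probability"
begin

definition Kpairs :: "nat \<Rightarrow> nat set set" where
  "Kpairs n = {e. \<exists>i j. e = {i, j} \<and> i \<noteq> j \<and> i \<in> {1..n} \<and> j \<in> {1..n}}"

definition is_graph :: "nat \<Rightarrow> nat set set \<Rightarrow> bool" where
  "is_graph n E \<longleftrightarrow> E \<subseteq> Kpairs n"

definition adj :: "nat set set \<Rightarrow> nat \<Rightarrow> nat \<Rightarrow> bool" where
  "adj E u v \<longleftrightarrow> {u, v} \<in> E"

definition comp :: "nat \<Rightarrow> nat set set \<Rightarrow> nat \<Rightarrow> nat set" where
  "comp n E v = {w \<in> {1..n}. (adj E)\<^sup>*\<^sup>* v w}"

definition comps :: "nat \<Rightarrow> nat set set \<Rightarrow> nat set set" where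
  "comps n E = comp n E ` {1..n}"

definition C1 :: "nat \<Rightarrow> nat set set \<Rightarrow> nat" where
  "C1 n E = Max (insert 0 (card ` comps n E))"

definition S_pow :: "nat \<Rightarrow> nat \<Rightarrow> nat set set \<Rightarrow> real" where
  "S_pow k n E = (\<Sum>C\<in>comps n E. real (card C) ^ k)"

definition s_pow :: "nat \<Rightarrow> nat \<Rightarrow> nat set set \<Rightarrow> real" where
  "s_pow k n E = S_pow k n E / real n"

text \<open>Continuous time: every pair of K_n gets an independent Poisson(t/n) number of edge
  arrivals during [0,t] (Poisson process of rate 1/n); the pair is an edge if it arrived
  at least once.\<close>
definition Gtilde :: "nat \<Rightarrow> real \<Rightarrow> nat set set \<Rightarrow> nat set set pmf" where
  "Gtilde n t F = map_pmf (\<lambda>N. F \<union> {e \<in> Kpairs n. N e > 0})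
      (Pi_pmf (Kpairs n) 0 (\<lambda>_. poisson_pmf (t / real n)))"

definition Gnm :: "nat \<Rightarrow> nat \<Rightarrow> nat set set \<Rightarrow> nat set set pmf" where
  "Gnm n m F = map_pmf (\<lambda>A. F \<union> A)
      (pmf_of_set {A. A \<subseteq> Kpairs n - F \<and> card A = m})"

definition Gstar :: "nat \<Rightarrow> nat \<Rightarrow> nat set set \<Rightarrow> nat set set pmf" where
  "Gstar n m F = map_pmf (\<lambda>f. F \<union> f ` {..<m})
      (Pi_pmf {..<m} {} (\<lambda>_. pmf_of_set (Kpairs n)))"

definition delta :: "(nat \<Rightarrow> nat) \<Rightarrow> (nat \<Rightarrow> nat set set) \<Rightarrow> real \<Rightarrow> nat \<Rightarrow> real" where
  "delta \<nu> F t k = t - 1 / s_pow 2 (\<nu> k) (F k)"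

definition lowerB :: "(nat \<Rightarrow> nat) \<Rightarrow> (nat \<Rightarrow> nat set set) \<Rightarrow> real \<Rightarrow> nat \<Rightarrow> real" where
  "lowerB \<nu> F t k = (let s2 = s_pow 2 (\<nu> k) (F k); s3 = s_pow 3 (\<nu> k) (F k);
      d = delta \<nu> F t k in 2 * d * s2 ^ 3 / s3 * (1 - 2 * d * s2))"

definition upperB :: "(nat \<Rightarrow> nat) \<Rightarrow> (nat \<Rightarrow> nat set set) \<Rightarrow> real \<Rightarrow> nat \<Rightarrow> real" where
  "upperB \<nu> F t k = (let s2 = s_pow 2 (\<nu> k) (F k); s3 = s_pow 3 (\<nu> k) (F k);
      s4 = s_pow 4 (\<nu> k) (F k); d = delta \<nu> F t k in
      2 * d * s2 ^ 3 / s3 * (1 + 8 / 3 * d * s2 ^ 2 * s4 / s3 ^ 2))"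

definition upper_cond :: "(nat \<Rightarrow> nat) \<Rightarrow> (nat \<Rightarrow> nat set set) \<Rightarrow> real \<Rightarrow> nat \<Rightarrow> bool" where
  "upper_cond \<nu> F t k \<longleftrightarrow> (let s2 = s_pow 2 (\<nu> k) (F k); s3 = s_pow 3 (\<nu> k) (F k);
      s4 = s_pow 4 (\<nu> k) (F k) in delta \<nu> F t k * s2 ^ 2 * s4 / s3 ^ 2 \<le> 3 / 8)"

definition X1 :: "(nat \<Rightarrow> nat) \<Rightarrow> nat \<Rightarrow> nat set set \<Rightarrow> real" where
  "X1 \<nu> k E = real (C1 (\<nu> k) E) / real (\<nu> k)"

definition Zexp :: "nat \<Rightarrow> nat set set \<Rightarrow> real \<Rightarrow> real \<Rightarrow> real" where
  "Zexp n F t \<rho> = measure_pmf.expectation (pmf_of_set {1..n})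
      (\<lambda>v. exp (- \<rho> * t * real (card (comp n F v))))"

text \<open>Conditional-on-n statements: a probability sequence p_k which is only required to be
  small for those k satisfying the (n-dependent) hypothesis.\<close>

definition part_i :: "(nat \<Rightarrow> nat) \<Rightarrow> (nat \<Rightarrow> nat set set) \<Rightarrow> real \<Rightarrow> (nat \<Rightarrow> nat set set pmf) \<Rightarrow> bool" where
  "part_i \<nu> F t G \<longleftrightarrow> (\<forall>\<epsilon>>0. (\<lambda>k. if t \<le> 1 / s_pow 2 (\<nu> k) (F k)
      then measure_pmf.prob (G k) {E. X1 \<nu> k E > \<epsilon>} else 0) \<longlonglongrightarrow> 0)"

definition part_ii :: "(nat \<Rightarrow> nat) \<Rightarrow> (nat \<Rightarrow> nat set set) \<Rightarrow> real \<Rightarrow> (nat \<Rightarrow> nat set set pmf) \<Rightarrow> bool" where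
  "part_ii \<nu> F t G \<longleftrightarrow>
     (\<forall>k. t > 1 / s_pow 2 (\<nu> k) (F k) \<longrightarrow>
        (\<exists>!\<rho>. \<rho> > 0 \<and> \<rho> = 1 - Zexp (\<nu> k) (F k) t \<rho>)) \<and>
     (\<forall>\<rho> :: nat \<Rightarrow> real.
        (\<forall>k. t > 1 / s_pow 2 (\<nu> k) (F k) \<longrightarrow>
             \<rho> k > 0 \<and> \<rho> k = 1 - Zexp (\<nu> k) (F k) t (\<rho> k)) \<longrightarrow>
        (\<forall>\<epsilon>>0. (\<lambda>k. if t > 1 / s_pow 2 (\<nu> k) (F k)
            then measure_pmf.prob (G k) {E. \<bar>X1 \<nu> k E - \<rho> k\<bar> > \<epsilon>} else 0) \<longlonglongrightarrow> 0))"

definition part_iii :: "(nat \<Rightarrow> nat) \<Rightarrow> (nat \<Rightarrow> nat set set) \<Rightarrow> real \<Rightarrow> (nat \<Rightarrow> nat set set pmf) \<Rightarrow> bool" where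
  "part_iii \<nu> F t G \<longleftrightarrow>
     (\<forall>\<epsilon>>0. (\<lambda>k. if delta \<nu> F t k > 0
         then measure_pmf.prob (G k) {E. X1 \<nu> k E < lowerB \<nu> F t k - \<epsilon>} else 0) \<longlonglongrightarrow> 0) \<and>
     (\<forall>\<epsilon>>0. (\<lambda>k. if delta \<nu> F t k > 0 \<and> upper_cond \<nu> F t k
         then measure_pmf.prob (G k) {E. X1 \<nu> k E > upperB \<nu> F t k + \<epsilon>} else 0) \<longlonglongrightarrow> 0)"

definition part_iv :: "(nat \<Rightarrow> nat) \<Rightarrow> (nat \<Rightarrow> nat set set) \<Rightarrow> real \<Rightarrow> (nat \<Rightarrow> nat set set pmf) \<Rightarrow> bool" where
  "part_iv \<nu> F t G \<longleftrightarrow>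
     (liminf (\<lambda>k. ereal (delta \<nu> F t k)) > 0 \<longrightarrow>
       ((\<lambda>k. measure_pmf.prob (G k) {E. X1 \<nu> k E \<ge> lowerB \<nu> F t k}) \<longlonglongrightarrow> 1) \<and>
       ((\<lambda>k. if upper_cond \<nu> F t k
          then measure_pmf.prob (G k) {E. X1 \<nu> k E \<le> upperB \<nu> F t k} else 1) \<longlonglongrightarrow> 1))"

definition giant_results :: "(nat \<Rightarrow> nat) \<Rightarrow> (nat \<Rightarrow> nat set set) \<Rightarrow> real \<Rightarrow> (nat \<Rightarrow> nat set set pmf) \<Rightarrow> bool" where
  "giant_results \<nu> F t G \<longleftrightarrow>
     part_i \<nu> F t G \<and> part_ii \<nu> F t G \<and> part_iii \<nu> F t G \<and> part_iv \<nu> F t G"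

end

theory Submission
  imports Defs "HOL-Real_Asymp.Real_Asymp"
begin

text \<open>
  Explore \<open>F \<union> H\<close>, where \<open>H\<close> contains each pair independently with probability \<open>1 - exp (- t / n)\<close>,
  one vertex per step: processing a vertex reveals its \<open>H\<close>-neighbours among the unseen vertices and
  makes their whole \<open>F\<close>-components seen; when every seen vertex is processed, restart at an unseen
  one. Components of the graph correspond to the gaps between consecutive idle times. The revealed
  bits may be taken from an i.i.d. array indexed by time and vertex, so that, restarts apart,
  the number \<open>D j\<close> of vertices seen after \<open>j\<close> steps is a sum of independent contributions of the
  \<open>F\<close>-components, with mean exactly \<open>n (1 - E exp (- (j / n) t Z))\<close>, and by Hoeffding's inequality
  it is uniformly close to its mean.

  The function \<open>g r = r - 1 + E exp (- r t Z)\<close> is uniformly strongly convex on \<open>[0, 1]\<close>, with roots \<open>0\<close> and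
  \<open>\<rho>\<close>. As \<open>D j > j\<close> for \<open>j / n\<close> inside \<open>(0, \<rho>)\<close>, there is no idle time there, which gives a component of size
  about \<open>\<rho> n\<close>. Conversely, a busy period \<open>(a, b)\<close> satisfies \<open>b - a \<le> D b - D a + o(n)\<close>, so by convexity
  \<open>g ((b - a) / n) \<le> g (b / n) - g (a / n) \<le> o(1)\<close>, whence \<open>b - a \<le> (\<rho> + o(1)) n\<close>.

  Conditioned on its number of elements, the random edge set of each model is uniform, so the
  models with a fixed number of draws follow by monotonicity. The bounds in (iii) and (iv) are
  deterministic bounds on \<open>\<rho>\<close> from the Taylor expansion of the exponential.
\<close>

section \<open>Components and the survival equation\<close>

text \<open>The graphs need not have a limit law for Z, so every estimate must be uniform over
  graphs, with constants depending only on t and a bound M for s_2. Jensen's inequality supplies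
  this: g'' is at least t^2 exp (- t M) on r \<le> 1 for all such graphs at once. Roots close to 0
  need no separate treatment: for \<rho> \<le> 2 \<epsilon> the lower bound is void, and the upper
  bound only needs g to be at least of order \<epsilon>^2 beyond \<rho> + \<epsilon>. The array
  removes the dependence of newly seen vertices on the past: which components are hit by time j is a
  function of the bits alone. Restarts break the equality with the seen set, but only in harmless
  ways. They enlarge the seen set, which suits the lower bound; and a busy period contains just one
  of them, adding one component of size at most sqrt (M n), which suits the upper bound.\<close>

lemma adj_sym: "adj E u v \<Longrightarrow> adj E v u"
  by (simp add: adj_def insert_commute)

lemma adj_rtranclp_sym: "(adj E)\<^sup>*\<^sup>* u v \<Longrightarrow> (adj E)\<^sup>*\<^sup>* v u"
  by (metis adj_sym sympD sympI symp_rtranclp)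

lemma comp_subset: "comp n E v \<subseteq> {1..n}"
  by (auto simp: comp_def)

lemma finite_comp [simp]: "finite (comp n E v)"
  by (rule finite_subset[OF comp_subset]) simp

lemma comp_self: "v \<in> {1..n} \<Longrightarrow> v \<in> comp n E v"
  by (simp add: comp_def)

lemma comp_eq: "w \<in> comp n E v \<Longrightarrow> comp n E w = comp n E v"
  unfolding comp_def using adj_rtranclp_sym[of E] by (auto intro: rtranclp_trans)

lemma comp_mono: "E \<subseteq> E' \<Longrightarrow> comp n E v \<subseteq> comp n E' v"
  unfolding comp_def adj_def by (auto elim: rtranclp_mono[THEN predicate2D, rotated])

lemma comp_step:
  assumes "w \<in> comp n E v" "{w, x} \<in> E" "x \<in> {1..n}"
  shows "x \<in> comp n E v"
  using assms unfolding comp_def adj_def by (auto intro: rtranclp.rtrancl_into_rtrancl)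

lemma finite_comps [simp]: "finite (comps n E)"
  by (simp add: comps_def)

lemma sum_comp_eq_sum_comps:
  fixes f :: "nat set \<Rightarrow> real"
  shows "(\<Sum>v\<in>{1..n}. f (comp n E v)) = (\<Sum>C\<in>comps n E. real (card C) * f C)"
proof -
  have "(\<Sum>v\<in>{1..n}. f (comp n E v))
      = (\<Sum>C\<in>comps n E. \<Sum>v\<in>{v\<in>{1..n}. comp n E v = C}. f (comp n E v))"
    unfolding comps_def by (rule sum.image_gen) simp
  also have "\<dots> = (\<Sum>C\<in>comps n E. real (card C) * f C)"
  proof (rule sum.cong[OF refl])
    fix C assume "C \<in> comps n E"
    then have "{v\<in>{1..n}. comp n E v = C} = C"
      using comp_self comp_eq comp_subset unfolding comps_def by blast
    moreover have "(\<Sum>v\<in>{v\<in>{1..n}. comp n E v = C}. f (comp n E v))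
        = (\<Sum>v\<in>{v\<in>{1..n}. comp n E v = C}. f C)"
      by (intro sum.cong) auto
    ultimately show "(\<Sum>v\<in>{v\<in>{1..n}. comp n E v = C}. f (comp n E v)) = real (card C) * f C"
      by simp
  qed
  finally show ?thesis .
qed

lemma card_comp_ge_1: "v \<in> {1..n} \<Longrightarrow> 1 \<le> real (card (comp n E v))"
  by (metis One_nat_def Suc_leI card_gt_0_iff comp_self empty_iff finite_comp of_nat_1 of_nat_le_iff)

text \<open>A uniform vertex falls into a given component of size c with probability c / n, so
  s_(k+1) is the k-th moment of Z.\<close>

lemma s_pow_Suc:
  "s_pow (Suc k) n E = (\<Sum>v\<in>{1..n}. real (card (comp n E v)) ^ k) / real n"
  unfolding s_pow_def S_pow_def using sum_comp_eq_sum_comps[of "\<lambda>C. real (card C) ^ k" n E] by simp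

lemma s_pow_2: "s_pow 2 n E = (\<Sum>v\<in>{1..n}. real (card (comp n E v))) / real n"
  using s_pow_Suc[of 1 n E] by (simp add: numeral_2_eq_2)

lemma s_pow_3: "s_pow 3 n E = (\<Sum>v\<in>{1..n}. real (card (comp n E v)) ^ 2) / real n"
  using s_pow_Suc[of 2 n E] by (simp add: numeral_3_eq_3)

lemma s_pow_4: "s_pow 4 n E = (\<Sum>v\<in>{1..n}. real (card (comp n E v)) ^ 3) / real n"
  using s_pow_Suc[of 3 n E] by (simp only: Suc_numeral semiring_norm)

lemma s_pow_mono:
  assumes "1 \<le> j" "j \<le> k"
  shows "s_pow j n E \<le> s_pow k n E"
proof -
  obtain i l where "j = Suc i" "k = Suc l"
    using assms by (metis One_nat_def Suc_le_D le_trans)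
  moreover have "s_pow (Suc i) n E \<le> s_pow (Suc l) n E" if "i \<le> l" for i l
    unfolding s_pow_Suc using that
    by (intro divide_right_mono sum_mono power_increasing card_comp_ge_1) auto
  ultimately show ?thesis using assms by simp
qed

lemma s_pow_ge_1:
  assumes "1 \<le> k" "n > 0"
  shows "1 \<le> s_pow k n E"
proof -
  have "s_pow 1 n E = 1"
    using assms s_pow_Suc[of 0 n E] by simp
  then show ?thesis using s_pow_mono[of 1 k n E] assms by simp
qed

text \<open>Bounds every component of F by sqrt (n s_2) = o(n), so that the component added by a
  restart of the exploration is negligible.\<close>

lemma card_comp_power2_le:
  assumes "v \<in> {1..n}"
  shows "real (card (comp n E v)) ^ 2 \<le> real n * s_pow 2 n E"
proof -
  have "real (card (comp n E v)) ^ 2 \<le> (\<Sum>C\<in>comps n E. real (card C) ^ 2)"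
    using assms by (intro member_le_sum) (auto simp: comps_def)
  then show ?thesis using assms by (simp add: s_pow_def S_pow_def)
qed

lemma Zexp_eq:
  assumes "n > 0"
  shows "Zexp n F t r = (\<Sum>v\<in>{1..n}. exp (- (r * t * real (card (comp n F v))))) / real n"
  unfolding Zexp_def using assms by (subst integral_pmf_of_set) auto

section \<open>Convexity of the survival equation, uniformly in the graph\<close>

definition surv_gap :: "nat \<Rightarrow> nat set set \<Rightarrow> real \<Rightarrow> real \<Rightarrow> real" where
  "surv_gap n F t r = r - 1 + Zexp n F t r"

lemma surv_gap_0: "n > 0 \<Longrightarrow> surv_gap n F t 0 = 0"
  by (simp add: surv_gap_def Zexp_eq)

text \<open>Lower bound for the second derivative of g = \<open>surv_gap\<close> on r \<le> 1,
  common to all graphs with s_2 \<le> M: since Z \<ge> 1, E (t Z)^2 exp (- r t Z) is at least t^2 E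
  exp (- t Z), and Jensen's inequality bounds the last mean below by exp (- t s_2).\<close>

definition surv_curv :: "real \<Rightarrow> real \<Rightarrow> real" where
  "surv_curv M t = t\<^sup>2 * exp (- (t * M))"

text \<open>Jensen's inequality for the exponential, by averaging its tangent at
  \<open>- m\<close>.\<close>

lemma mean_exp_ge:
  fixes z :: "nat \<Rightarrow> real"
  assumes "n > 0" and "(\<Sum>v\<in>{1..n}. z v) / real n \<le> m"
  shows "exp (- m) \<le> (\<Sum>v\<in>{1..n}. exp (- z v)) / real n"
proof -
  have "exp (- m) * (1 + (m - z v)) \<le> exp (- z v)" for v
  proof -
    have "exp (- m) * (1 + (m - z v)) \<le> exp (- m) * exp (m - z v)"
      by (intro mult_left_mono exp_ge_add_one_self) auto
    then show ?thesis by (simp flip: exp_add)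
  qed
  then have "(\<Sum>v\<in>{1..n}. exp (- m) * (1 + (m - z v))) \<le> (\<Sum>v\<in>{1..n}. exp (- z v))"
    by (intro sum_mono)
  moreover have "(\<Sum>v\<in>{1..n}. exp (- m) * (1 + (m - z v)))
      = exp (- m) * (real n + real n * m - (\<Sum>v\<in>{1..n}. z v))"
    by (simp add: sum_distrib_left[symmetric] sum.distrib sum_subtractf)
  moreover have "exp (- m) * real n \<le> exp (- m) * (real n + real n * m - (\<Sum>v\<in>{1..n}. z v))"
    using assms by (intro mult_left_mono) (auto simp: field_simps)
  ultimately have "exp (- m) * real n \<le> (\<Sum>v\<in>{1..n}. exp (- z v))" by linarith
  then show ?thesis using assms by (simp add: field_simps)
qed

lemma surv_gap_deriv:
  assumes "n > 0"
  shows "(surv_gap n F t has_real_derivative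
    1 - (\<Sum>v\<in>{1..n}. t * real (card (comp n F v)) * exp (- (r * t * real (card (comp n F v))))) / real n) (at r)"
  unfolding surv_gap_def[abs_def] Zexp_eq[OF assms]
  using assms by (auto intro!: derivative_eq_intros simp: sum_negf mult.commute)

text \<open>The half-line \<open>{..1}\<close> rather than \<open>{0..1}\<close> makes 0 an interior
  point, so that the tangent at 0 can be used in the case \<rho> = 0 of
  \<open>surv_gap_ge\<close>.\<close>

lemma surv_gap_strongly_convex:
  assumes n: "n > 0" and t: "t > 0" and M: "s_pow 2 n F \<le> M"
  shows "convex_on {..1} (\<lambda>r. surv_gap n F t r - surv_curv M t / 2 * r\<^sup>2)"
proof -
  define c where "c v = real (card (comp n F v))" for v
  have c1: "c v \<ge> 1" if "v \<in> {1..n}" for v using card_comp_ge_1[OF that] by (simp add: c_def)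
  have d1: "((\<lambda>r. surv_gap n F t r - surv_curv M t / 2 * r\<^sup>2) has_real_derivative
      (1 - (\<Sum>v\<in>{1..n}. t * c v * exp (- (r * t * c v))) / real n - surv_curv M t * r)) (at r)" for r
    using surv_gap_deriv[OF n, of F t r] unfolding c_def
    by (auto intro!: derivative_eq_intros)
  have d2: "((\<lambda>r. 1 - (\<Sum>v\<in>{1..n}. t * c v * exp (- (r * t * c v))) / real n - surv_curv M t * r)
      has_real_derivative ((\<Sum>v\<in>{1..n}. (t * c v)\<^sup>2 * exp (- (r * t * c v))) / real n - surv_curv M t)) (at r)" for r
    using n by (auto intro!: derivative_eq_intros simp: sum_negf power2_eq_square mult_ac)
  have nonneg: "0 \<le> (\<Sum>v\<in>{1..n}. (t * c v)\<^sup>2 * exp (- (r * t * c v))) / real n - surv_curv M t"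
    if r: "r \<le> 1" for r
  proof -
    have "exp (- (t * M)) \<le> (\<Sum>v\<in>{1..n}. exp (- (t * c v))) / real n"
    proof (rule mean_exp_ge[OF n])
      show "(\<Sum>v\<in>{1..n}. t * c v) / real n \<le> t * M"
        using M t mult_left_mono[of "s_pow 2 n F" M t]
        by (simp add: s_pow_2 c_def sum_distrib_left[symmetric])
    qed
    then have "surv_curv M t \<le> t\<^sup>2 * ((\<Sum>v\<in>{1..n}. exp (- (t * c v))) / real n)"
      unfolding surv_curv_def by (intro mult_left_mono) auto
    also have "\<dots> = (\<Sum>v\<in>{1..n}. t\<^sup>2 * exp (- (t * c v))) / real n"
      by (simp add: sum_distrib_left)
    also have "\<dots> \<le> (\<Sum>v\<in>{1..n}. (t * c v)\<^sup>2 * exp (- (r * t * c v))) / real n"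
    proof (intro divide_right_mono sum_mono mult_mono)
      fix v assume v: "v \<in> {1..n}"
      show "t\<^sup>2 \<le> (t * c v)\<^sup>2" using c1[OF v] t by (simp add: power_mono)
      have "r * (t * c v) \<le> 1 * (t * c v)" using r c1[OF v] t by (intro mult_right_mono) auto
      then show "exp (- (t * c v)) \<le> exp (- (r * t * c v))" by (simp add: mult_ac)
    qed auto
    finally show ?thesis by simp
  qed
  show ?thesis
    by (rule f''_ge0_imp_convex[OF _ d1 d2 nonneg]) auto
qed

lemma surv_curv_pos: "t > 0 \<Longrightarrow> surv_curv M t > 0"
  by (simp add: surv_curv_def)

lemma surv_gap_convex:
  assumes n: "n > 0" and t: "t > 0"
  shows "convex_on {..1} (surv_gap n F t)"
proof -
  define K where "K = surv_curv (s_pow 2 n F) t / 2"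
  have K: "K \<ge> 0" using surv_curv_pos[OF t] by (simp add: K_def less_imp_le)
  have "convex_on {..1::real} (\<lambda>r. K * r\<^sup>2)"
    using K by (intro convex_on_cmul convex_on_subset[OF convex_power2]) auto
  from convex_on_add[OF surv_gap_strongly_convex[OF n t order_refl, of F, folded K_def] this]
  show ?thesis by simp
qed

text \<open>One predicate for both regimes: 0 is always a root, and the last conjunct admits it only
  when t s_2 \<le> 1. Parts (i) and (ii) thereby become the same concentration statement.\<close>

definition surv_prob :: "nat \<Rightarrow> nat set set \<Rightarrow> real \<Rightarrow> real \<Rightarrow> bool" where
  "surv_prob n F t \<rho> \<longleftrightarrow> 0 \<le> \<rho> \<and> \<rho> \<le> 1 \<and> surv_gap n F t \<rho> = 0 \<and> (\<rho> = 0 \<longrightarrow> t * s_pow 2 n F \<le> 1)"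

text \<open>Subtracting K r^2 with 2 K = \<open>surv_curv M t\<close> leaves a convex h with h(0) =
  0. If \<rho> = 0, the tangent of h at 0 has slope 1 - t s_2 \<ge> 0; otherwise the chord from 0 to
  \<open>L\<close> lies above h(\<rho>) = - K \<rho>^2.\<close>

lemma surv_gap_ge:
  assumes n: "n > 0" and t: "t > 0" and M: "s_pow 2 n F \<le> M"
    and \<rho>: "surv_prob n F t \<rho>" and L: "\<rho> \<le> L" "L \<le> 1"
  shows "surv_curv M t / 2 * L * (L - \<rho>) \<le> surv_gap n F t L"
proof -
  define K where "K = surv_curv M t / 2"
  define h where "h r = surv_gap n F t r - K * r\<^sup>2" for r
  have cv: "convex_on {..1} h"
    using surv_gap_strongly_convex[OF n t M] by (simp add: h_def[abs_def] K_def)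
  have r0: "0 \<le> \<rho>" "surv_gap n F t \<rho> = 0" using \<rho> by (auto simp: surv_prob_def)
  show ?thesis
  proof (cases "\<rho> = 0")
    case True
    have "t * s_pow 2 n F \<le> 1" using \<rho> True by (simp add: surv_prob_def)
    then have d: "(\<Sum>v\<in>{1..n}. t * real (card (comp n F v))) / real n \<le> 1"
      by (simp add: s_pow_2 sum_distrib_left)
    have der: "(h has_real_derivative 1 - (\<Sum>v\<in>{1..n}. t * real (card (comp n F v))) / real n) (at 0 within {..1})"
    proof -
      have g: "(surv_gap n F t has_real_derivative
          1 - (\<Sum>v\<in>{1..n}. t * real (card (comp n F v))) / real n) (at 0)"
        using surv_gap_deriv[OF n, of F t 0] by simp
      have "((\<lambda>r. surv_gap n F t r - K * r\<^sup>2) has_real_derivative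
          1 - (\<Sum>v\<in>{1..n}. t * real (card (comp n F v))) / real n - K * (2 * 0)) (at 0)"
        by (rule DERIV_diff[OF g]) (auto intro!: derivative_eq_intros)
      then show ?thesis unfolding h_def[abs_def] by (simp add: has_field_derivative_at_within)
    qed
    have "h L - h 0 \<ge> (1 - (\<Sum>v\<in>{1..n}. t * real (card (comp n F v))) / real n) * (L - 0)"
      using L True by (intro convex_on_imp_above_tangent[OF cv _ _ _ der]) auto
    moreover have "(1 - (\<Sum>v\<in>{1..n}. t * real (card (comp n F v))) / real n) * (L - 0) \<ge> 0"
      using d L True by (intro mult_nonneg_nonneg) auto
    moreover have "h 0 = 0" using surv_gap_0[OF n] by (simp add: h_def)
    ultimately have "h L \<ge> 0" by linarith
    then show ?thesis using True by (simp add: h_def K_def power2_eq_square mult_ac)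
  next
    case False
    then have p: "\<rho> > 0" using r0 by simp
    then have Lp: "L > 0" using L by simp
    have "h ((1 - \<rho> / L) *\<^sub>R 0 + (\<rho> / L) *\<^sub>R L) \<le> (1 - \<rho> / L) * h 0 + (\<rho> / L) * h L"
      using L p Lp by (intro convex_onD[OF cv]) auto
    then have "h \<rho> \<le> \<rho> / L * h L" using Lp surv_gap_0[OF n] by (simp add: h_def)
    then have "h \<rho> * L \<le> \<rho> * h L" using Lp by (simp add: field_simps)
    then have "\<rho> * (K * L * (L - \<rho>)) \<le> \<rho> * surv_gap n F t L"
      using r0 by (simp add: h_def algebra_simps power2_eq_square)
    then show ?thesis using p by (simp add: K_def)
  qed
qed

text \<open>The convex function g - K r^2 lies below its chord over [0, \<rho>], which has slope - K
  \<rho>.\<close>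

lemma surv_gap_le:
  assumes n: "n > 0" and t: "t > 0" and M: "s_pow 2 n F \<le> M"
    and \<rho>: "surv_prob n F t \<rho>" and r: "0 \<le> r" "r \<le> \<rho>"
  shows "surv_gap n F t r \<le> - (surv_curv M t / 2 * r * (\<rho> - r))"
proof (cases "\<rho> = 0")
  case True
  then show ?thesis using r surv_gap_0[OF n] by simp
next
  case False
  define K where "K = surv_curv M t / 2"
  define h where "h r = surv_gap n F t r - K * r\<^sup>2" for r
  have cv: "convex_on {..1} h"
    using surv_gap_strongly_convex[OF n t M] by (simp add: h_def[abs_def] K_def)
  have r0: "0 < \<rho>" "\<rho> \<le> 1" "surv_gap n F t \<rho> = 0" using \<rho> False by (auto simp: surv_prob_def)
  have "h ((1 - r / \<rho>) *\<^sub>R 0 + (r / \<rho>) *\<^sub>R \<rho>) \<le> (1 - r / \<rho>) * h 0 + (r / \<rho>) * h \<rho>"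
    using r0 r by (intro convex_onD[OF cv]) auto
  then have "h r \<le> - (K * r * \<rho>)"
    using r0 surv_gap_0[OF n] by (simp add: h_def power2_eq_square mult_ac)
  then have "surv_gap n F t r \<le> - (K * r * (\<rho> - r))" by (simp add: h_def algebra_simps power2_eq_square)
  then show ?thesis by (simp add: K_def)
qed

text \<open>Superadditivity of a convex function vanishing at 0: g(x) \<le> (x / b) g(b), added for
  x = a and x = b - a.\<close>

lemma surv_gap_increment:
  assumes n: "n > 0" and t: "t > 0" and ab: "0 \<le> a" "a < b" "b \<le> 1"
  shows "surv_gap n F t (b - a) \<le> surv_gap n F t b - surv_gap n F t a"
proof -
  let ?g = "surv_gap n F t"
  have "?g ((1 - x / b) *\<^sub>R 0 + (x / b) *\<^sub>R b) \<le> (1 - x / b) * ?g 0 + (x / b) * ?g b" if "0 \<le> x" "x \<le> b" for x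
    using ab that by (intro convex_onD[OF surv_gap_convex[OF n t]]) auto
  then have *: "?g x \<le> (x / b) * ?g b" if "0 \<le> x" "x \<le> b" for x
    using that ab surv_gap_0[OF n] by simp
  have "?g a + ?g (b - a) \<le> (a / b) * ?g b + ((b - a) / b) * ?g b"
    using *[of a] *[of "b - a"] ab by auto
  also have "\<dots> = ?g b" using ab by (simp add: field_simps)
  finally show ?thesis by simp
qed

lemma surv_prob_subcritical:
  "n > 0 \<Longrightarrow> t * s_pow 2 n F \<le> 1 \<Longrightarrow> surv_prob n F t 0"
  by (simp add: surv_prob_def surv_gap_0)

lemma Zexp_pos: "n > 0 \<Longrightarrow> Zexp n F t r > 0"
  unfolding Zexp_eq by (intro divide_pos_pos sum_pos) auto

lemma surv_prob_pos_iff: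
  assumes "n > 0"
  shows "surv_prob n F t \<rho> \<and> \<rho> > 0 \<longleftrightarrow> \<rho> > 0 \<and> \<rho> = 1 - Zexp n F t \<rho>"
  using Zexp_pos[OF assms, of F t \<rho>] by (auto simp: surv_prob_def surv_gap_def)

text \<open>g leaves 0 with slope 1 - t s_2 < 0 and g(1) > 0, so a root exists. Of two positive
  roots the smaller one could serve as \<rho> in \<open>surv_gap_ge\<close>, which would make g
  positive at the larger one.\<close>

lemma surv_prob_ex1:
  assumes n: "n > 0" and t: "t > 0" and sup: "t * s_pow 2 n F > 1"
  shows "\<exists>!\<rho>. \<rho> > 0 \<and> \<rho> = 1 - Zexp n F t \<rho>"
proof -
  let ?g = "surv_gap n F t"
  have der: "(?g has_real_derivative 1 - t * s_pow 2 n F) (at 0)"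
    using surv_gap_deriv[OF n, of F t 0] by (simp add: s_pow_2 sum_distrib_left)
  obtain d where d: "d > 0" "\<And>h. 0 < h \<Longrightarrow> h < d \<Longrightarrow> ?g (0 + h) < ?g 0"
    using has_real_derivative_neg_dec_right[OF der] sup by auto
  define e where "e = min (d / 2) 1"
  have e: "0 < e" "e < d" "e \<le> 1" using d(1) by (auto simp: e_def)
  have "?g e < 0" using d(2)[OF e(1,2)] surv_gap_0[OF n] by simp
  moreover have "?g 1 > 0" using Zexp_pos[OF n] by (simp add: surv_gap_def)
  moreover have "continuous_on {e..1} ?g"
    using surv_gap_deriv[OF n] by (meson DERIV_isCont continuous_at_imp_continuous_on)
  ultimately obtain x where x: "e \<le> x" "x \<le> 1" "?g x = 0"
    using IVT'[of ?g e 0 1] e by auto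
  have "x = 1 - Zexp n F t x" using x(3) unfolding surv_gap_def by linarith
  moreover have "x > 0" using x e by simp
  ultimately have xroot: "x > 0 \<and> x = 1 - Zexp n F t x" by blast
  show ?thesis
  proof (rule ex1I[of _ x])
    show "x > 0 \<and> x = 1 - Zexp n F t x" by (fact xroot)
  next
    have less: False if "r1 > 0 \<and> r1 = 1 - Zexp n F t r1" "r2 > 0 \<and> r2 = 1 - Zexp n F t r2" "r1 < r2" for r1 r2
    proof -
      have s: "surv_prob n F t r1" "surv_prob n F t r2"
        using that surv_prob_pos_iff[OF n] by blast+
      have "surv_curv (s_pow 2 n F) t / 2 * r2 * (r2 - r1) \<le> ?g r2"
        using s(2) that by (intro surv_gap_ge[OF n t order_refl s(1)]) (auto simp: surv_prob_def)
      moreover have "surv_curv (s_pow 2 n F) t / 2 * r2 * (r2 - r1) > 0"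
        using surv_curv_pos[OF t] that by simp
      ultimately show False using s(2) by (simp add: surv_prob_def)
    qed
    fix y assume "y > 0 \<and> y = 1 - Zexp n F t y"
    then show "y = x"
      using less[of x y] less[of y x] xroot by (meson linorder_neqE)
  qed
qed

section \<open>Explicit bounds on the survival probability\<close>

lemma exp_minus_le_quadratic:
  fixes x :: real assumes "x \<ge> 0" shows "exp (- x) \<le> 1 - x + x\<^sup>2 / 2"
proof -
  have "(\<lambda>x. 1 - x + x\<^sup>2 / 2 - exp (- x)) 0 \<le> (\<lambda>x::real. 1 - x + x\<^sup>2 / 2 - exp (- x)) x"
  proof (rule DERIV_nonneg_imp_nondecreasing[OF assms])
    fix y :: real
    show "\<exists>z. ((\<lambda>x. 1 - x + x\<^sup>2 / 2 - exp (- x)) has_real_derivative z) (at y) \<and> 0 \<le> z"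
      using exp_ge_add_one_self[of "- y"]
      by (intro exI[of _ "- 1 + y + exp (- y)"]) (auto intro!: derivative_eq_intros)
  qed
  then show ?thesis by simp
qed

lemma exp_minus_ge_cubic:
  fixes x :: real assumes "x \<ge> 0" shows "1 - x + x\<^sup>2 / 2 - x ^ 3 / 6 \<le> exp (- x)"
proof -
  have "(\<lambda>x. exp (- x) - 1 + x - x\<^sup>2 / 2 + x ^ 3 / 6) 0 \<le> (\<lambda>x::real. exp (- x) - 1 + x - x\<^sup>2 / 2 + x ^ 3 / 6) x"
  proof (rule DERIV_nonneg_imp_nondecreasing[OF assms])
    fix y :: real assume "0 \<le> y"
    then show "\<exists>z. ((\<lambda>x. exp (- x) - 1 + x - x\<^sup>2 / 2 + x ^ 3 / 6) has_real_derivative z) (at y) \<and> 0 \<le> z"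
      using exp_minus_le_quadratic[of y]
      by (intro exI[of _ "- exp (- y) + 1 - y + y\<^sup>2 / 2"]) (auto intro!: derivative_eq_intros)
  qed
  then show ?thesis by simp
qed

lemma Zexp_le_quadratic:
  assumes n: "n > 0" and "t > 0" "r \<ge> 0"
  shows "Zexp n F t r \<le> 1 - r * t * s_pow 2 n F + (r * t)\<^sup>2 / 2 * s_pow 3 n F"
proof -
  define c where "c v = real (card (comp n F v))" for v
  have "(\<Sum>v\<in>{1..n}. exp (- (r * t * c v)))
      \<le> (\<Sum>v\<in>{1..n}. 1 - r * t * c v + (r * t * c v)\<^sup>2 / 2)"
    using assms by (intro sum_mono exp_minus_le_quadratic) (auto simp: c_def)
  also have "\<dots> = real n - r * t * (\<Sum>v\<in>{1..n}. c v) + (r * t)\<^sup>2 / 2 * (\<Sum>v\<in>{1..n}. (c v)\<^sup>2)"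
    by (simp add: sum.distrib sum_subtractf sum_distrib_left power_mult_distrib)
  finally have "Zexp n F t r
      \<le> (real n - r * t * (\<Sum>v\<in>{1..n}. c v) + (r * t)\<^sup>2 / 2 * (\<Sum>v\<in>{1..n}. (c v)\<^sup>2)) / real n"
    unfolding Zexp_eq[OF n] c_def by (intro divide_right_mono) auto
  also have "\<dots> = 1 - r * t * s_pow 2 n F + (r * t)\<^sup>2 / 2 * s_pow 3 n F"
    using n by (simp add: s_pow_2 s_pow_3 s_pow_4 c_def add_divide_distrib diff_divide_distrib)
  finally show ?thesis .
qed

lemma Zexp_ge_cubic:
  assumes n: "n > 0" and "t > 0" "r \<ge> 0"
  shows "1 - r * t * s_pow 2 n F + (r * t)\<^sup>2 / 2 * s_pow 3 n F - (r * t) ^ 3 / 6 * s_pow 4 n F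
    \<le> Zexp n F t r"
proof -
  define c where "c v = real (card (comp n F v))" for v
  have "1 - r * t * s_pow 2 n F + (r * t)\<^sup>2 / 2 * s_pow 3 n F - (r * t) ^ 3 / 6 * s_pow 4 n F
     = (real n - r * t * (\<Sum>v\<in>{1..n}. c v) + (r * t)\<^sup>2 / 2 * (\<Sum>v\<in>{1..n}. (c v)\<^sup>2)
        - (r * t) ^ 3 / 6 * (\<Sum>v\<in>{1..n}. (c v) ^ 3)) / real n"
    using n by (simp add: s_pow_2 s_pow_3 s_pow_4 c_def add_divide_distrib diff_divide_distrib)
  also have "\<dots> = (\<Sum>v\<in>{1..n}. 1 - r * t * c v + (r * t * c v)\<^sup>2 / 2 - (r * t * c v) ^ 3 / 6) / real n"
    by (simp add: sum.distrib sum_subtractf sum_distrib_left power_mult_distrib)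
  also have "\<dots> \<le> Zexp n F t r"
    unfolding Zexp_eq[OF n] c_def using assms
    by (intro divide_right_mono sum_mono exp_minus_ge_cubic) auto
  finally show ?thesis .
qed

text \<open>Dividing the quadratic Taylor bound by \<rho> leaves \<delta> s_2 \<le> \<rho> t^2 s_3 /
  2, and t = (1 + \<delta> s_2) / s_2. With x = \<delta> s_2, the factor 1 / (1 + x)^2 is kept
  because it exceeds the 1 - 2 x of the theorem; the difference is the margin behind (iv).\<close>

lemma surv_prob_lower_bound:
  assumes n: "n > 0" and t: "t > 0" and \<rho>: "surv_prob n F t \<rho>" "\<rho> > 0"
    and \<delta>: "\<delta> = t - 1 / s_pow 2 n F" "\<delta> > 0"
  shows "2 * \<delta> * s_pow 2 n F ^ 3 / (s_pow 3 n F * (1 + \<delta> * s_pow 2 n F)\<^sup>2) \<le> \<rho>"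
proof -
  let ?s2 = "s_pow 2 n F" and ?s3 = "s_pow 3 n F"
  have s: "?s2 \<ge> 1" "?s3 \<ge> 1" using s_pow_ge_1[OF _ n] by auto
  have ts: "t * ?s2 = 1 + \<delta> * ?s2" using s \<delta> by (simp add: field_simps)
  have "1 - \<rho> \<le> 1 - \<rho> * t * ?s2 + (\<rho> * t)\<^sup>2 / 2 * ?s3"
    using Zexp_le_quadratic[OF n t, of \<rho> F] \<rho> by (simp add: surv_prob_def surv_gap_def)
  then have "\<rho> * (t * ?s2 - 1) \<le> \<rho> * (\<rho> * t\<^sup>2 / 2 * ?s3)"
    by (simp add: algebra_simps power2_eq_square)
  then have "\<delta> * ?s2 \<le> \<rho> * t\<^sup>2 / 2 * ?s3" using \<rho>(2) ts by simp
  then have "2 * \<delta> * ?s2 ^ 3 \<le> \<rho> * ?s3 * (t * ?s2)\<^sup>2"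
    using mult_left_mono[of "\<delta> * ?s2" "\<rho> * t\<^sup>2 / 2 * ?s3" "2 * ?s2\<^sup>2"] s
    by (simp add: eval_nat_numeral mult_ac)
  then have "2 * \<delta> * ?s2 ^ 3 \<le> \<rho> * (?s3 * (1 + \<delta> * ?s2)\<^sup>2)"
    by (simp add: ts mult_ac)
  moreover have "?s3 * (1 + \<delta> * ?s2)\<^sup>2 > 0" using s \<delta> by (intro mult_pos_pos zero_less_power) (auto intro: add_pos_pos)
  ultimately show ?thesis by (simp only: pos_divide_le_eq)
qed

text \<open>The quadratic minorant of the survival equation is non-positive at
  \<open>y = 2 \<delta> s\<^sub>2\<^sup>2 / s\<^sub>3 (1 + a)\<close>, so the positive root \<open>\<rho> t\<close> lies below \<open>y\<close>.\<close>

lemma surv_prob_upper_bound: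
  assumes n: "n > 0" and t: "t > 0" and \<rho>: "surv_prob n F t \<rho>" "\<rho> > 0"
    and \<delta>: "\<delta> = t - 1 / s_pow 2 n F" "\<delta> > 0"
    and a: "a = 8 / 3 * \<delta> * s_pow 2 n F ^ 2 * s_pow 4 n F / s_pow 3 n F ^ 2" "a \<le> 1"
  shows "\<rho> \<le> 2 * \<delta> * s_pow 2 n F ^ 3 / s_pow 3 n F * (1 + a) / (1 + \<delta> * s_pow 2 n F)"
proof -
  let ?s2 = "s_pow 2 n F" and ?s3 = "s_pow 3 n F" and ?s4 = "s_pow 4 n F"
  have s: "?s2 \<ge> 1" "?s3 \<ge> 1" "?s4 \<ge> 1" using s_pow_ge_1[OF _ n] by auto
  have ts: "t * ?s2 = 1 + \<delta> * ?s2" using s \<delta> by (simp add: field_simps)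
  have a0: "a \<ge> 0" using s \<delta> unfolding a(1) by (intro divide_nonneg_nonneg mult_nonneg_nonneg) auto
  define y where "y = 2 * \<delta> * ?s2\<^sup>2 / ?s3 * (1 + a)"
  have y: "y > 0" unfolding y_def using s \<delta> a0 by (intro mult_pos_pos divide_pos_pos) auto
  have q: "?s4 * y\<^sup>2 / 6 - ?s3 * y / 2 + (?s2 - 1 / t) \<le> 0"
  proof -
    have "?s3 * y / 2 = \<delta> * ?s2\<^sup>2 * (1 + a)" using s by (simp add: y_def)
    moreover have "?s4 * y\<^sup>2 / 6 = \<delta> * ?s2\<^sup>2 * (a * (1 + a)\<^sup>2 / 4)"
      using s by (simp add: y_def a(1) power2_eq_square field_simps)
    \<comment> \<open>The constant 8/3 in \<open>a\<close> turns the term with s_4 into \<delta>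
      s_2^2 times a (1 + a)^2 / 4. The threshold 3/8 of the theorem says a \<le> 1, whence (1 + a)^2
      \<le> 4.\<close>
    moreover have "a * (1 + a)\<^sup>2 / 4 \<le> a"
    proof -
      have "(1 + a)\<^sup>2 \<le> 2\<^sup>2" using a0 a(2) by (intro power_mono) auto
      then show ?thesis using mult_left_mono[of "(1+a)\<^sup>2" 4 a] a0 by simp
    qed
    then have "\<delta> * ?s2\<^sup>2 * (a * (1 + a)\<^sup>2 / 4) \<le> \<delta> * ?s2\<^sup>2 * a"
      using \<delta> by (intro mult_left_mono) auto
    moreover have "?s2 - 1 / t \<le> \<delta> * ?s2\<^sup>2"
    proof -
      have "?s2 - 1 / t = \<delta> * ?s2 / t" using ts t by (simp add: field_simps)
      also have "\<dots> \<le> \<delta> * ?s2 * ?s2"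
      proof -
        have "1 \<le> t * ?s2" unfolding ts using \<delta> s by simp
        then have "1 / t \<le> ?s2" using t by (simp add: field_simps)
        then show ?thesis using mult_left_mono[of "1 / t" ?s2 "\<delta> * ?s2"] \<delta> s by simp
      qed
      finally show ?thesis by (simp add: power2_eq_square mult.assoc)
    qed
    moreover have "\<delta> * ?s2\<^sup>2 * a - \<delta> * ?s2\<^sup>2 * (1 + a) + \<delta> * ?s2\<^sup>2 = 0" by (simp add: algebra_simps)
    ultimately show ?thesis by linarith
  qed
  have g: "surv_gap n F t (y / t) \<ge> 0"
  proof -
    have "1 - y * ?s2 + y\<^sup>2 / 2 * ?s3 - y ^ 3 / 6 * ?s4 \<le> Zexp n F t (y / t)"
      using Zexp_ge_cubic[OF n t, of "y / t" F] y t by simp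
    moreover have "- (y * (?s4 * y\<^sup>2 / 6 - ?s3 * y / 2 + (?s2 - 1 / t))) \<ge> 0"
      using q y by (simp add: mult_le_0_iff)
    ultimately show ?thesis
      by (simp add: surv_gap_def algebra_simps power2_eq_square power3_eq_cube)
  qed
  have "\<rho> \<le> y / t"
  proof (rule ccontr)
    assume "\<not> \<rho> \<le> y / t"
    then have "surv_gap n F t (y / t) \<le> - (surv_curv ?s2 t / 2 * (y / t) * (\<rho> - y / t))"
      using y t by (intro surv_gap_le[OF n t order_refl \<rho>(1)]) auto
    moreover have "surv_curv ?s2 t / 2 * (y / t) * (\<rho> - y / t) > 0"
      using surv_curv_pos[OF t] y t \<open>\<not> \<rho> \<le> y / t\<close> by (intro mult_pos_pos) auto
    ultimately show False using g by simp
  qed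
  also have "y / t = 2 * \<delta> * ?s2 ^ 3 / ?s3 * (1 + a) / (t * ?s2)"
    using s t by (simp add: y_def eval_nat_numeral)
  finally show ?thesis by (simp add: ts)
qed

section \<open>Exploration of a graph\<close>

text \<open>A state is a pair \<open>(S, P)\<close> of the sets of seen and of processed vertices; \<open>nb j v\<close> is the set of
  vertices hit when \<open>v\<close> is processed at time \<open>j\<close>.\<close>

definition next_vertex :: "nat \<Rightarrow> nat set \<times> nat set \<Rightarrow> nat" where
  "next_vertex n st = (if fst st = snd st then Min ({1..n} - snd st) else Min (fst st - snd st))"

text \<open>Adding the component of the current vertex matters only at a restart: otherwise that
  vertex is already seen, and seen sets are unions of \<open>F\<close>-components.\<close>

definition explore_step ::
    "nat \<Rightarrow> nat set set \<Rightarrow> nat set \<times> nat set \<Rightarrow> nat set \<Rightarrow> nat set \<times> nat set" where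
  "explore_step n F st N =
     (let v = next_vertex n st; S = fst st \<union> comp n F v
      in (S \<union> (\<Union>w\<in>N \<inter> {1..n} - S. comp n F w), insert v (snd st)))"

lemma next_vertex_in:
  assumes "snd st \<subseteq> fst st" "fst st \<subseteq> {1..n}" "card (snd st) < n"
  shows "next_vertex n st \<in> {1..n} - snd st"
    and "fst st \<noteq> snd st \<Longrightarrow> next_vertex n st \<in> fst st"
proof -
  have Min: "fst st \<noteq> snd st \<Longrightarrow> next_vertex n st \<in> fst st - snd st"
  proof -
    assume ne: "fst st \<noteq> snd st"
    have "finite (fst st)" using assms finite_subset by blast
    then have "Min (fst st - snd st) \<in> fst st - snd st" using ne assms by (intro Min_in) auto
    then show ?thesis using ne by (simp add: next_vertex_def)
  qed
  then show "fst st \<noteq> snd st \<Longrightarrow> next_vertex n st \<in> fst st" by blast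
  have "{1..n} - snd st \<noteq> {}"
    using assms by (metis Diff_eq_empty_iff card_atLeastAtMost card_mono diff_Suc_1
        finite_atLeastAtMost finite_subset not_less subset_trans)
  then have "Min ({1..n} - snd st) \<in> {1..n} - snd st" by (intro Min_in) auto
  then show "next_vertex n st \<in> {1..n} - snd st"
    using Min assms by (cases "fst st = snd st") (auto simp: next_vertex_def)
qed

text \<open>The rule \<open>nb\<close> is left open to serve both the graph and the array. The
  recursion for \<sigma> is required only up to time \<open>n\<close>, so that a list of n + 1
  states, read by \<open>!\<close>, also qualifies.\<close>

locale exploration =
  fixes n :: nat and F :: "nat set set" and nb :: "nat \<Rightarrow> nat \<Rightarrow> nat set"
    and \<sigma> :: "nat \<Rightarrow> nat set \<times> nat set"
  assumes init: "\<sigma> 0 = ({}, {})"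
    and step: "\<And>j. j < n \<Longrightarrow> \<sigma> (Suc j) = explore_step n F (\<sigma> j) (nb j (next_vertex n (\<sigma> j)))"
begin

definition S where "S j = fst (\<sigma> j)"
definition P where "P j = snd (\<sigma> j)"
definition cur where "cur j = next_vertex n (\<sigma> j)"
definition found where "found j = nb j (cur j) \<inter> {1..n} - (S j \<union> comp n F (cur j))"
definition idle where "idle j \<longleftrightarrow> S j = P j"

lemma S_0: "S 0 = {}" and P_0: "P 0 = {}"
  by (simp_all add: S_def P_def init)

lemma S_Suc: "j < n \<Longrightarrow> S (Suc j) = S j \<union> comp n F (cur j) \<union> (\<Union>w\<in>found j. comp n F w)"
  and P_Suc: "j < n \<Longrightarrow> P (Suc j) = insert (cur j) (P j)"
  by (simp_all add: S_def P_def step explore_step_def Let_def found_def cur_def)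

text \<open>Every step processes exactly one new vertex, so the graph is exhausted at time
  \<open>n\<close> and lengths of time intervals count vertices. The claims on \<open>cur j\<close>
  belong to the induction because they carry the step from j to j + 1.\<close>

lemma invariant:
  assumes "j \<le> n"
  shows "P j \<subseteq> S j \<and> S j \<subseteq> {1..n} \<and> card (P j) = j \<and> (\<forall>w\<in>S j. comp n F w \<subseteq> S j)
    \<and> (j < n \<longrightarrow> cur j \<in> {1..n} - P j \<and> (S j \<noteq> P j \<longrightarrow> cur j \<in> S j))"
  using assms
proof (induction j)
  have cur: "cur j \<in> {1..n} - P j \<and> (S j \<noteq> P j \<longrightarrow> cur j \<in> S j)"
    if "P j \<subseteq> S j" "S j \<subseteq> {1..n}" "card (P j) = j" "j < n" for j
    using next_vertex_in[of "\<sigma> j" n] that by (auto simp: cur_def S_def P_def)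
  {
    case 0
    show ?case using cur[of 0] by (simp add: S_0 P_0)
  next
    case (Suc j)
    then have jn: "j < n" and IH: "P j \<subseteq> S j" "S j \<subseteq> {1..n}" "card (P j) = j"
      "\<forall>w\<in>S j. comp n F w \<subseteq> S j" "cur j \<in> {1..n}" "cur j \<notin> P j" by auto
    have fin: "finite (P j)" using IH finite_subset by (meson finite_atLeastAtMost)
    have 1: "P (Suc j) \<subseteq> S (Suc j)"
      using IH comp_self[OF IH(5), of F] by (auto simp: S_Suc[OF jn] P_Suc[OF jn])
    have 2: "S (Suc j) \<subseteq> {1..n}" using IH comp_subset by (fastforce simp: S_Suc[OF jn])
    have 3: "card (P (Suc j)) = Suc j" using IH fin by (simp add: P_Suc[OF jn])
    have 4: "\<forall>w\<in>S (Suc j). comp n F w \<subseteq> S (Suc j)"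
    proof
      fix w assume "w \<in> S (Suc j)"
      then consider "w \<in> S j" | "w \<in> comp n F (cur j)" | u where "u \<in> found j" "w \<in> comp n F u"
        by (auto simp: S_Suc[OF jn])
      then show "comp n F w \<subseteq> S (Suc j)"
        using IH(4) comp_eq[of w n F] by cases (fastforce simp: S_Suc[OF jn])+
    qed
    show ?case using 1 2 3 4 cur[of "Suc j"] by blast
  }
qed

lemma P_subset_S: "j \<le> n \<Longrightarrow> P j \<subseteq> S j"
  and S_subset: "j \<le> n \<Longrightarrow> S j \<subseteq> {1..n}"
  and card_P: "j \<le> n \<Longrightarrow> card (P j) = j"
  and S_closed: "j \<le> n \<Longrightarrow> w \<in> S j \<Longrightarrow> comp n F w \<subseteq> S j"
  and cur_in: "j < n \<Longrightarrow> cur j \<in> {1..n}"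
  and cur_notin_P: "j < n \<Longrightarrow> cur j \<notin> P j"
  and cur_in_S: "j < n \<Longrightarrow> \<not> idle j \<Longrightarrow> cur j \<in> S j"
  using invariant[of j] by (auto simp: idle_def)

lemma finite_S: "j \<le> n \<Longrightarrow> finite (S j)"
  using S_subset finite_subset by blast

lemma P_mono: "i \<le> j \<Longrightarrow> j \<le> n \<Longrightarrow> P i \<subseteq> P j"
  by (induction j rule: nat_induct_at_least) (auto simp: P_Suc)

lemma P_n: "P n = {1..n}"
  using card_subset_eq[of "{1..n}" "P n"] P_subset_S[of n] S_subset[of n] card_P[of n] by simp

lemma idle_0: "idle 0" by (simp add: idle_def S_0 P_0)

lemma idle_n: "idle n"
  using P_subset_S[of n] S_subset[of n] by (auto simp: idle_def P_n)

definition busy where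
  "busy a b \<longleftrightarrow> a < b \<and> b \<le> n \<and> idle a \<and> idle b \<and> (\<forall>l. a < l \<and> l < b \<longrightarrow> \<not> idle l)"

lemma busy_period_after:
  assumes "a < n" "idle a"
  shows "\<exists>b. busy a b"
proof -
  define b where "b = (LEAST b. a < b \<and> idle b)"
  have "a < b \<and> idle b" unfolding b_def by (rule LeastI[of _ n]) (use assms idle_n in auto)
  moreover have "b \<le> n" unfolding b_def by (rule Least_le) (use assms idle_n in auto)
  moreover have "\<not> idle l" if "a < l" "l < b" for l
    using not_less_Least[of l "\<lambda>b. a < b \<and> idle b"] that unfolding b_def by auto
  ultimately show ?thesis using assms by (auto simp: busy_def)
qed

text \<open>\<open>a\<close> is the last idle time up to \<open>a'\<close>. The next idle time is
  not in (a, a'] by maximality of \<open>a\<close>, and not strictly between \<open>a'\<close> and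
  \<open>b'\<close> by assumption.\<close>

lemma busy_period_around:
  assumes "a' < b'" "b' \<le> n" "\<And>l. a' < l \<Longrightarrow> l < b' \<Longrightarrow> \<not> idle l"
  shows "\<exists>a b. busy a b \<and> a \<le> a' \<and> b' \<le> b"
proof -
  define a where "a = (GREATEST a. a \<le> a' \<and> idle a)"
  have a: "a \<le> a' \<and> idle a" unfolding a_def
    by (rule GreatestI_nat[of _ 0 a']) (auto simp: idle_0)
  have amax: "l \<le> a" if "l \<le> a'" "idle l" for l
    unfolding a_def by (rule Greatest_le_nat[of _ _ a']) (use that in auto)
  have "a < n" using a assms by simp
  then obtain b where b: "busy a b" using busy_period_after a by blast
  have "b' \<le> b"
  proof (rule ccontr)
    assume c: "\<not> b' \<le> b"
    have "idle b" "a < b" using b by (auto simp: busy_def)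
    then show False using amax[of b] assms(3)[of b] c by (cases "b \<le> a'") auto
  qed
  then show ?thesis using a b by blast
qed

text \<open>The period ends at the first idle time by which \<open>u\<close> is processed; the
  minimality of that time keeps \<open>u\<close> out of \<open>P a\<close>.\<close>

lemma in_busy_period:
  assumes "u \<in> {1..n}"
  shows "\<exists>a b. busy a b \<and> u \<in> P b - P a"
proof -
  define b where "b = (LEAST b. idle b \<and> u \<in> P b)"
  have b: "idle b \<and> u \<in> P b" unfolding b_def
    by (rule LeastI[of _ n]) (use assms idle_n P_n in auto)
  have bn: "b \<le> n" unfolding b_def
    by (rule Least_le) (use assms idle_n P_n in auto)
  have bmin: "b \<le> l" if "idle l" "u \<in> P l" for l
    unfolding b_def by (rule Least_le) (use that in auto)
  have b0: "b > 0" using b P_0 by (cases b) auto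
  define a where "a = (GREATEST a. a \<le> b - 1 \<and> idle a)"
  have a: "a \<le> b - 1 \<and> idle a" unfolding a_def
    by (rule GreatestI_nat[of _ 0 "b - 1"]) (auto simp: idle_0)
  have amax: "l \<le> a" if "l \<le> b - 1" "idle l" for l
    unfolding a_def by (rule Greatest_le_nat[of _ _ "b - 1"]) (use that in auto)
  have "\<not> idle l" if "a < l" "l < b" for l
    using amax[of l] that by (metis One_nat_def Suc_pred b0 less_Suc_eq_le not_less)
  then have "busy a b" using a b b0 bn by (auto simp: busy_def)
  moreover have "u \<notin> P a" using bmin[of a] a b0 by auto
  ultimately show ?thesis using b by blast
qed

end

section \<open>Busy periods and components of the random graph\<close>

locale graph_exploration = exploration n F "\<lambda>_ v. {w. h {v, w}}" \<sigma>
  for n F and h :: "nat set \<Rightarrow> bool" and \<sigma> +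
  assumes F: "is_graph n F"
begin

abbreviation G where "G \<equiv> F \<union> {e \<in> Kpairs n. h e}"

text \<open>Processing \<open>u\<close> makes all its neighbours under \<open>h\<close> seen, and
  seen sets only grow.\<close>

lemma no_edge_P_compl_S:
  "j \<le> n \<Longrightarrow> u \<in> P j \<Longrightarrow> w \<in> {1..n} - S j \<Longrightarrow> \<not> h {u, w}"
proof (induction j)
  case 0
  then show ?case by (simp add: P_0)
next
  case (Suc j)
  then have jn: "j < n" by simp
  have w: "w \<in> {1..n} - S j" "w \<notin> comp n F (cur j)" "w \<notin> found j"
    using Suc.prems comp_self[of w n F] by (auto simp: S_Suc[OF jn])
  show ?case
  proof (cases "u \<in> P j")
    case True then show ?thesis using Suc.IH jn w by auto
  next
    case False
    then have "u = cur j" using Suc.prems by (simp add: P_Suc[OF jn])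
    then show ?thesis using w by (auto simp: found_def)
  qed
qed

text \<open>At an idle time \<open>P j\<close> equals \<open>S j\<close>. No edge of
  \<open>F\<close> leaves this set because it is a union of components, and no new edge leaves it
  because all its vertices are processed.\<close>

lemma idle_closed:
  assumes j: "j \<le> n" "idle j" and u: "u \<in> P j"
  shows "comp n G u \<subseteq> P j"
proof
  fix x assume "x \<in> comp n G u"
  then have "(adj G)\<^sup>*\<^sup>* u x" by (simp add: comp_def)
  then show "x \<in> P j"
  proof (induction rule: rtranclp_induct)
    case base then show ?case by (fact u)
  next
    case (step y z)
    have yS: "y \<in> S j" using step j by (simp add: idle_def)
    have yz: "{y, z} \<in> Kpairs n" using step(2) F by (auto simp: adj_def is_graph_def)
    then have z: "z \<in> {1..n}" by (auto simp: Kpairs_def doubleton_eq_iff)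
    show ?case
    proof (cases "{y, z} \<in> F")
      case True
      then have "z \<in> comp n F y" using z by (auto simp: comp_def adj_def)
      then show ?thesis using S_closed[OF j(1) yS] j by (auto simp: idle_def)
    next
      case False
      then have "h {y, z}" using step(2) by (simp add: adj_def)
      then have "z \<in> S j" using no_edge_P_compl_S[OF j(1) step(3), of z] z by auto
      then show ?thesis using j by (simp add: idle_def)
    qed
  qed
qed

text \<open>Between idle times the current vertex is seen but unprocessed, so by induction it is
  connected to \<open>cur a\<close>; whatever it adds hangs on it by an edge of the graph followed
  by a component of \<open>F\<close>.\<close>

lemma busy_connected:
  assumes "busy a b"
  shows "a < l \<Longrightarrow> l \<le> b \<Longrightarrow> S l - P a \<subseteq> comp n G (cur a)"
proof (induction l)
  case (Suc l)
  have ab: "a < b" "b \<le> n" "idle a" using assms by (auto simp: busy_def)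
  then have an: "a < n" and ln: "l < n" using Suc.prems by auto
  have c: "cur l \<in> comp n G (cur a) \<and> S l - P a \<subseteq> comp n G (cur a)"
  proof (cases "l = a")
    case True
    then show ?thesis using ab comp_self[OF cur_in[OF an]] by (auto simp: idle_def)
  next
    case False
    then have "\<not> idle l" "a < l" using assms Suc.prems by (auto simp: busy_def)
    then show ?thesis
      using Suc cur_in_S[OF ln] cur_notin_P[OF ln] P_mono[of a l] ln by auto
  qed
  have cF: "comp n F x \<subseteq> comp n G (cur a)" if "x \<in> comp n G (cur a)" for x
    using comp_mono[of F G n x] comp_eq[OF that] by auto
  have "comp n F w \<subseteq> comp n G (cur a)" if w: "w \<in> found l" for w
  proof -
    have "w \<noteq> cur l" using w comp_self[OF cur_in[OF ln]] by (auto simp: found_def)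
    then have "{cur l, w} \<in> G"
      using w cur_in[OF ln] by (auto simp: found_def Kpairs_def)
    moreover have "w \<in> {1..n}" using w by (simp add: found_def)
    ultimately have "w \<in> comp n G (cur a)" by (rule comp_step[OF conjunct1[OF c]])
    then show ?thesis by (rule cF)
  qed
  then show ?case using c cF[of "cur l"] unfolding S_Suc[OF ln] by blast
qed simp

lemma busy_component:
  assumes "busy a b"
  shows "P b - P a = comp n G (cur a)" and "card (comp n G (cur a)) = b - a" and "cur a \<in> {1..n}"
proof -
  have ab: "a < b" "b \<le> n" "idle a" "idle b" using assms by (auto simp: busy_def)
  then have an: "a < n" by simp
  show "cur a \<in> {1..n}" by (rule cur_in[OF an])
  have "cur a \<in> P (Suc a)" by (simp add: P_Suc[OF an])
  then have cb: "cur a \<in> P b" using P_mono[of "Suc a" b] ab by auto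
  show eq: "P b - P a = comp n G (cur a)"
  proof
    show "P b - P a \<subseteq> comp n G (cur a)"
      using busy_connected[OF assms, of b] ab by (auto simp: idle_def)
    have "x \<notin> P a" if "x \<in> comp n G (cur a)" for x
    proof
      assume "x \<in> P a"
      then have "comp n G x \<subseteq> P a" using ab by (intro idle_closed) auto
      then show False
        using comp_eq[OF that] comp_self[OF cur_in[OF an]] cur_notin_P[OF an] by auto
    qed
    then show "comp n G (cur a) \<subseteq> P b - P a" using idle_closed[OF ab(2,4) cb] by auto
  qed
  have "finite (P a)" using finite_S[of a] P_subset_S[of a] ab finite_subset by auto
  then have "card (P b - P a) = b - a"
    using P_mono[of a b] card_P[of a] card_P[of b] ab by (simp add: card_Diff_subset)
  then show "card (comp n G (cur a)) = b - a" by (simp add: eq)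
qed

lemma C1_ge_busy:
  assumes "busy a b"
  shows "b - a \<le> C1 n G"
proof -
  have "card (comp n G (cur a)) \<in> insert 0 (card ` comps n G)"
    using busy_component(3)[OF assms] by (auto simp: comps_def)
  then have "card (comp n G (cur a)) \<le> C1 n G" unfolding C1_def by (intro Max_ge) auto
  then show ?thesis by (simp add: busy_component(2)[OF assms])
qed

lemma C1_le_busy:
  assumes "\<And>a b. busy a b \<Longrightarrow> b - a \<le> L"
  shows "C1 n G \<le> L"
proof -
  have "card (comp n G u) \<le> L" if u: "u \<in> {1..n}" for u
  proof -
    obtain a b where ab: "busy a b" "u \<in> P b - P a" using in_busy_period[OF u] by blast
    then have "comp n G u = comp n G (cur a)" using comp_eq busy_component(1) by blast
    then show ?thesis using busy_component(2)[OF ab(1)] assms[OF ab(1)] by simp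
  qed
  then show ?thesis unfolding C1_def by (intro Max.boundedI) (auto simp: comps_def)
qed

end

section \<open>Number of vertices reached in the array-driven exploration\<close>

definition rung_set :: "nat \<Rightarrow> nat set set \<Rightarrow> (nat \<times> nat \<Rightarrow> bool) \<Rightarrow> nat \<Rightarrow> nat set" where
  "rung_set n F \<omega> j = (\<Union>w\<in>{w\<in>{1..n}. \<exists>l<j. \<omega> (l, w)}. comp n F w)"

text \<open>Row \<open>j\<close> of the array is used at step \<open>j\<close> whichever vertex is
  being processed, so \<open>rung j\<close> does not depend on the course of the exploration. Its
  size is the \<open>D j\<close> of the overview.\<close>

locale array_exploration = exploration n F "\<lambda>j _. {w. \<omega> (j, w)}" \<sigma>
  for n F and \<omega> :: "nat \<times> nat \<Rightarrow> bool" and \<sigma>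
begin

abbreviation rung where "rung \<equiv> rung_set n F \<omega>"

lemma rung_mono: "i \<le> j \<Longrightarrow> rung i \<subseteq> rung j"
  unfolding rung_set_def by (intro UN_mono) (auto intro: less_le_trans)

text \<open>A vertex marked in row \<open>l\<close> is already seen at step \<open>l\<close>, or
  lies in the current component, or is found then. Hence more than \<open>j\<close> vertices in
  \<open>rung j\<close> exclude an idle time at \<open>j\<close>.\<close>

lemma rung_subset_S: "j \<le> n \<Longrightarrow> rung j \<subseteq> S j"
proof (induction j)
  case 0
  then show ?case by (simp add: rung_set_def)
next
  case (Suc j)
  then have jn: "j < n" by simp
  have "comp n F w \<subseteq> S (Suc j)" if "w \<in> {1..n}" "l < Suc j" "\<omega> (l, w)" for l w
  proof (cases "l = j")
    case True
    show ?thesis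
    proof (cases "w \<in> S j \<union> comp n F (cur j)")
      case True
      then have "comp n F w \<subseteq> S j \<union> comp n F (cur j)"
        using S_closed[of j w] comp_eq[of w n F "cur j"] jn by (metis Un_iff le_supI1 le_supI2 less_imp_le order_refl)
      then show ?thesis by (auto simp: S_Suc[OF jn])
    next
      case False
      then have "w \<in> found j" using that \<open>l = j\<close> by (auto simp: found_def)
      then show ?thesis by (auto simp: S_Suc[OF jn])
    qed
  next
    case False
    then have "\<exists>l<j. \<omega> (l, w)" using that less_Suc_eq by blast
    then have "comp n F w \<subseteq> rung j" unfolding rung_set_def using that(1) by (intro UN_upper) simp
    also have "\<dots> \<subseteq> S j" using Suc.IH jn by simp
    also have "\<dots> \<subseteq> S (Suc j)" by (auto simp: S_Suc[OF jn])
    finally show ?thesis .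
  qed
  then show ?case unfolding rung_set_def by blast
qed

text \<open>A newly found component avoids \<open>rung j\<close>, which lies in the
  \<open>F\<close>-closed set \<open>S j\<close>. So, apart from the current component, all growth
  of the seen set is growth of \<open>rung\<close>.\<close>

lemma S_Suc_subset:
  assumes jn: "j < n"
  shows "S (Suc j) \<subseteq> S j \<union> comp n F (cur j) \<union> (rung (Suc j) - rung j)"
proof -
  have "comp n F w \<subseteq> rung (Suc j) - rung j" if w: "w \<in> found j" for w
  proof -
    have "comp n F w \<subseteq> rung (Suc j)" using w by (auto simp: found_def rung_set_def)
    moreover have "y \<notin> rung j" if "y \<in> comp n F w" for y
    proof
      assume "y \<in> rung j"
      then have "y \<in> S j" using rung_subset_S[of j] jn by auto
      then have "comp n F w \<subseteq> S j" using S_closed[of j y] comp_eq[OF that] jn by auto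
      then show False using w comp_self[of w n F] by (auto simp: found_def)
    qed
    ultimately show ?thesis by blast
  qed
  then show ?thesis unfolding S_Suc[OF jn] by blast
qed

text \<open>Only the first step of a busy period is a restart; in the later ones the current
  component is already seen.\<close>

lemma busy_S_subset:
  assumes "busy a b"
  shows "a < l \<Longrightarrow> l \<le> b \<Longrightarrow> S l \<subseteq> S a \<union> comp n F (cur a) \<union> (rung l - rung a)"
proof (induction l)
  case (Suc l)
  have ab: "a < b" "b \<le> n" "idle a" using assms by (auto simp: busy_def)
  then have ln: "l < n" using Suc.prems by auto
  show ?case
  proof (cases "l = a")
    case True
    then show ?thesis using S_Suc_subset[OF ln] by auto
  next
    case False
    then have nz: "\<not> idle l" "a < l" using assms Suc.prems by (auto simp: busy_def)
    have "comp n F (cur l) \<subseteq> S l" using S_closed cur_in_S[OF ln nz(1)] ln by auto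
    moreover have "S l \<subseteq> S a \<union> comp n F (cur a) \<union> (rung l - rung a)" using Suc nz by auto
    moreover have "rung l \<subseteq> rung (Suc l)" "rung a \<subseteq> rung l" using nz by (simp_all add: rung_mono)
    ultimately show ?thesis using S_Suc_subset[OF ln] by blast
  qed
qed simp

text \<open>At idle times the seen set has as many elements as steps were made, so the length of the
  period is the growth of the seen set: at most one restart component plus the growth of
  \<open>rung\<close>.\<close>

lemma busy_length_le:
  assumes "busy a b" and x: "\<And>v. v \<in> {1..n} \<Longrightarrow> real (card (comp n F v)) \<le> x"
  shows "real b - real a \<le> x + real (card (rung b)) - real (card (rung a))"
proof -
  have ab: "a < b" "b \<le> n" "idle a" "idle b" using assms by (auto simp: busy_def)
  have fin: "finite (rung j)" for j unfolding rung_set_def by simp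
  have "b = card (S b)" using ab card_P[of b] by (simp add: idle_def)
  also have "\<dots> \<le> card (S a \<union> comp n F (cur a) \<union> (rung b - rung a))"
    using busy_S_subset[OF assms(1), of b] ab fin finite_S[of a] by (intro card_mono) auto
  also have "\<dots> \<le> card (S a) + card (comp n F (cur a)) + card (rung b - rung a)"
    by (meson add_le_mono1 card_Un_le order_trans)
  also have "card (S a) = a" using ab card_P[of a] by (simp add: idle_def)
  finally have "real b \<le> real a + real (card (comp n F (cur a))) + real (card (rung b - rung a))"
    by linarith
  moreover have "real (card (rung b - rung a)) = real (card (rung b)) - real (card (rung a))"
    using rung_mono[of a b] fin ab by (simp add: card_Diff_subset card_mono)
  ultimately show ?thesis using x[OF cur_in[of a]] ab by linarith
qed

lemma not_idle_if_rung:
  assumes "j \<le> n" "j < card (rung j)"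
  shows "\<not> idle j"
  using card_mono[OF finite_S rung_subset_S, of j] card_P[of j] assms by (auto simp: idle_def)

end

section \<open>Equality in law of the graph-driven and the array-driven exploration\<close>

text \<open>The recursion runs from the front, with time offset \<open>s\<close>, so that an
  induction can condition on the first step; \<open>walk_Suc_last\<close> recovers the recursion of
  the locale.\<close>

primrec walk :: "nat \<Rightarrow> nat set set \<Rightarrow> (nat \<Rightarrow> nat \<Rightarrow> nat set) \<Rightarrow> nat \<Rightarrow> nat set \<times> nat set
    \<Rightarrow> nat \<Rightarrow> nat set \<times> nat set" where
  "walk n F nb s st 0 = st"
| "walk n F nb s st (Suc k) = walk n F nb (Suc s) (explore_step n F st (nb s (next_vertex n st))) k"

lemma walk_Suc_last:
  "walk n F nb s st (Suc k)
   = explore_step n F (walk n F nb s st k) (nb (s + k) (next_vertex n (walk n F nb s st k)))"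
proof (induction k arbitrary: s st)
  case (Suc k)
  show ?case by (subst walk.simps(2), subst Suc.IH) simp
qed simp

text \<open>Busy periods involve all times, so the equality in law is needed for the whole
  trajectory and not just for single states.\<close>

definition path :: "nat \<Rightarrow> nat set set \<Rightarrow> (nat \<Rightarrow> nat \<Rightarrow> nat set) \<Rightarrow> nat \<Rightarrow> nat set \<times> nat set
    \<Rightarrow> nat \<Rightarrow> (nat set \<times> nat set) list" where
  "path n F nb s st k = map (walk n F nb s st) [0..<Suc k]"

lemma path_0: "path n F nb s st 0 = [st]"
  by (simp add: path_def)

lemma path_Suc:
  "path n F nb s st (Suc k)
   = st # path n F nb (Suc s) (explore_step n F st (nb s (next_vertex n st))) k"
proof -
  have "[0..<Suc (Suc k)] = 0 # map Suc [0..<Suc k]"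
    by (metis map_Suc_upt upt_conv_Cons zero_less_Suc)
  then show ?thesis by (simp add: path_def del: upt_Suc)
qed

lemma path_nth: "j \<le> k \<Longrightarrow> path n F nb s st k ! j = walk n F nb s st j"
  by (simp add: path_def del: upt_Suc)

lemma exploration_walk: "exploration n F nb (walk n F nb 0 ({}, {}))"
  by unfold_locales (simp_all add: walk_Suc_last del: walk.simps(2))

lemma explore_step_cong:
  assumes "\<And>w. w \<in> {1..n} \<Longrightarrow> w \<notin> fst st \<Longrightarrow> w \<notin> comp n F (next_vertex n st) \<Longrightarrow> w \<in> N \<longleftrightarrow> w \<in> N'"
  shows "explore_step n F st N = explore_step n F st N'"
proof -
  have "N \<inter> {1..n} - (fst st \<union> comp n F (next_vertex n st))
      = N' \<inter> {1..n} - (fst st \<union> comp n F (next_vertex n st))"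
    using assms by blast
  then show ?thesis by (simp add: explore_step_def Let_def)
qed

text \<open>The common law of both explorations: a Markov chain that draws a fresh row of
  \<open>n\<close> bits at each step, including bits for vertices already seen, which the step
  ignores.\<close>

primrec explore_pmf :: "nat \<Rightarrow> nat set set \<Rightarrow> real \<Rightarrow> nat \<Rightarrow> nat set \<times> nat set
    \<Rightarrow> (nat set \<times> nat set) list pmf" where
  "explore_pmf n F p 0 st = return_pmf [st]"
| "explore_pmf n F p (Suc k) st =
     bind_pmf (Pi_pmf {1..n} False (\<lambda>_. bernoulli_pmf p))
       (\<lambda>a. map_pmf ((#) st) (explore_pmf n F p k (explore_step n F st {w. a w})))"

lemma path_array_cong:
  assumes "\<And>j w. j \<in> {s..<s + k} \<Longrightarrow> w \<in> {1..n} \<Longrightarrow> \<omega> (j, w) = \<omega>' (j, w)"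
  shows "path n F (\<lambda>j _. {w. \<omega> (j, w)}) s st k = path n F (\<lambda>j _. {w. \<omega>' (j, w)}) s st k"
  using assms
proof (induction k arbitrary: s st)
  case (Suc k)
  have "explore_step n F st {w. \<omega> (s, w)} = explore_step n F st {w. \<omega>' (s, w)}"
    using Suc.prems by (intro explore_step_cong) auto
  then show ?case using Suc by (simp add: path_Suc)
qed (simp add: path_0)

text \<open>The first row determines the first step, and the remaining rows are independent of
  it.\<close>

lemma path_array_law:
  "map_pmf (\<lambda>\<omega>. path n F (\<lambda>j _. {w. \<omega> (j, w)}) s st k)
     (Pi_pmf ({s..<s + k} \<times> {1..n}) False (\<lambda>_. bernoulli_pmf p)) = explore_pmf n F p k st"
proof (induction k arbitrary: s st)
  case 0
  then show ?case by (simp add: path_0)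
next
  case (Suc k)
  let ?b = "\<lambda>_. bernoulli_pmf p"
  let ?A = "{s} \<times> {1..n}" and ?B = "{Suc s..<Suc s + k} \<times> {1..n}"
  have "{s..<s + Suc k} \<times> {1..n} = ?A \<union> ?B" by auto
  then have "Pi_pmf ({s..<s + Suc k} \<times> {1..n}) False ?b
     = map_pmf (\<lambda>(f,g) x. if x \<in> ?A then f x else g x) (pair_pmf (Pi_pmf ?A False ?b) (Pi_pmf ?B False ?b))"
    by (simp only:) (rule Pi_pmf_union; auto)
  then have "map_pmf (\<lambda>\<omega>. path n F (\<lambda>j _. {w. \<omega> (j, w)}) s st (Suc k))
        (Pi_pmf ({s..<s + Suc k} \<times> {1..n}) False ?b)
     = map_pmf (\<lambda>(f, g). st # path n F (\<lambda>j _. {w. g (j, w)}) (Suc s) (explore_step n F st {w. f (s, w)}) k)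
        (pair_pmf (Pi_pmf ?A False ?b) (Pi_pmf ?B False ?b))"
  proof (simp only: pmf.map_comp, intro map_pmf_cong refl)
    fix fg :: "(nat \<times> nat \<Rightarrow> bool) \<times> (nat \<times> nat \<Rightarrow> bool)"
    obtain f g where fg: "fg = (f, g)" by (cases fg)
    define h where "h x = (if x \<in> ?A then f x else g x)" for x
    have "explore_step n F st {w. h (s, w)} = explore_step n F st {w. f (s, w)}"
      by (rule explore_step_cong) (auto simp: h_def)
    moreover have "path n F (\<lambda>j _. {w. h (j, w)}) (Suc s) st' k = path n F (\<lambda>j _. {w. g (j, w)}) (Suc s) st' k" for st'
      by (rule path_array_cong) (auto simp: h_def)
    ultimately have "path n F (\<lambda>j _. {w. h (j, w)}) s st (Suc k)
        = st # path n F (\<lambda>j _. {w. g (j, w)}) (Suc s) (explore_step n F st {w. f (s, w)}) k"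
      by (simp add: path_Suc)
    then show "((\<lambda>\<omega>. path n F (\<lambda>j _. {w. \<omega> (j, w)}) s st (Suc k)) \<circ> (\<lambda>(f,g) x. if x \<in> ?A then f x else g x)) fg
      = (case fg of (f, g) \<Rightarrow> st # path n F (\<lambda>j _. {w. g (j, w)}) (Suc s) (explore_step n F st {w. f (s, w)}) k)"
      by (simp add: fg h_def)
  qed
  also have "\<dots> = bind_pmf (Pi_pmf ?A False ?b) (\<lambda>f. map_pmf ((#) st)
      (map_pmf (\<lambda>g. path n F (\<lambda>j _. {w. g (j, w)}) (Suc s) (explore_step n F st {w. f (s, w)}) k) (Pi_pmf ?B False ?b)))"
    by (simp add: pair_pmf_def map_bind_pmf bind_map_pmf map_pmf_def bind_assoc_pmf bind_return_pmf)
  also have "\<dots> = bind_pmf (Pi_pmf ?A False ?b) (\<lambda>f. map_pmf ((#) st) (explore_pmf n F p k (explore_step n F st {w. f (s, w)})))"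
    by (simp only: Suc.IH)
  also have "\<dots> = bind_pmf (map_pmf (\<lambda>g. g \<circ> Pair s) (Pi_pmf ?A False ?b)) (\<lambda>a. map_pmf ((#) st) (explore_pmf n F p k (explore_step n F st {w. a w})))"
    by (simp add: bind_map_pmf o_def)
  also have "map_pmf (\<lambda>g. g \<circ> Pair s) (Pi_pmf ?A False ?b) = Pi_pmf {1..n} False ?b"
    by (rule Pi_pmf_bij_betw[symmetric]) (auto simp: bij_betw_def inj_on_def)
  finally show ?case by simp
qed

section \<open>Deferred decisions for the pairs of vertices\<close>

lemma finite_Kpairs [simp]: "finite (Kpairs n)"
  by (rule finite_subset[of _ "Pow {1..n}"]) (auto simp: Kpairs_def)

lemma Kpairs_pair: "i \<noteq> j \<Longrightarrow> i \<in> {1..n} \<Longrightarrow> j \<in> {1..n} \<Longrightarrow> {i, j} \<in> Kpairs n"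
  unfolding Kpairs_def by blast

lemma explore_step_snd: "snd (explore_step n F st N) = insert (next_vertex n st) (snd st)"
  by (simp add: explore_step_def Let_def)

lemma explore_step_bounds:
  assumes "snd st \<subseteq> fst st" "fst st \<subseteq> {1..n}" "card (snd st) < n"
  shows "snd (explore_step n F st N) \<subseteq> fst (explore_step n F st N)"
    "fst (explore_step n F st N) \<subseteq> {1..n}" "card (snd (explore_step n F st N)) = Suc (card (snd st))"
proof -
  note v = next_vertex_in(1)[OF assms]
  show "snd (explore_step n F st N) \<subseteq> fst (explore_step n F st N)"
    using assms v comp_self[of "next_vertex n st" n F] by (auto simp: explore_step_def Let_def)
  show "fst (explore_step n F st N) \<subseteq> {1..n}"
    using assms comp_subset by (fastforce simp: explore_step_def Let_def)
  have "finite (snd st)" using assms finite_subset by (metis finite_atLeastAtMost)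
  then show "card (snd (explore_step n F st N)) = Suc (card (snd st))"
    using v by (simp add: explore_step_snd)
qed

text \<open>Pairs that may still be queried: a query joins the vertex being processed to an unseen
  one, and afterwards all pairs at the processed vertex are discarded.\<close>

definition fresh_edges :: "nat \<Rightarrow> nat set \<Rightarrow> nat set set" where
  "fresh_edges n P = {e \<in> Kpairs n. e \<inter> P = {}}"

lemma finite_fresh_edges [simp]: "finite (fresh_edges n P)"
  by (simp add: fresh_edges_def)

lemma path_graph_cong:
  assumes "snd st \<subseteq> fst st" "fst st \<subseteq> {1..n}" "card (snd st) + k \<le> n"
    and "\<And>e. e \<in> fresh_edges n (snd st) \<Longrightarrow> h e = h' e"
  shows "path n F (\<lambda>_ v. {w. h {v, w}}) s st k = path n F (\<lambda>_ v. {w. h' {v, w}}) s st k"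
  using assms
proof (induction k arbitrary: s st)
  case (Suc k)
  let ?v = "next_vertex n st"
  have c: "card (snd st) < n" using Suc.prems by simp
  note v = next_vertex_in(1)[OF Suc.prems(1,2) c]
  have eq: "explore_step n F st {w. h {?v, w}} = explore_step n F st {w. h' {?v, w}}"
  proof (rule explore_step_cong)
    fix w assume w: "w \<in> {1..n}" "w \<notin> fst st" "w \<notin> comp n F ?v"
    then have "?v \<noteq> w" using comp_self[of ?v n F] v by auto
    then have "{?v, w} \<in> fresh_edges n (snd st)"
      using w v Suc.prems(1) by (auto simp: fresh_edges_def Kpairs_def)
    then show "w \<in> {w. h {?v, w}} \<longleftrightarrow> w \<in> {w. h' {?v, w}}" using Suc.prems(4) by simp
  qed
  let ?st = "explore_step n F st {w. h' {?v, w}}"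
  have "path n F (\<lambda>_ v. {w. h {v, w}}) (Suc s) ?st k = path n F (\<lambda>_ v. {w. h' {v, w}}) (Suc s) ?st k"
  proof (rule Suc.IH)
    show "h e = h' e" if "e \<in> fresh_edges n (snd ?st)" for e
      using that by (intro Suc.prems(4)) (auto simp: fresh_edges_def explore_step_snd)
  qed (use explore_step_bounds[OF Suc.prems(1,2) c] Suc.prems(3) in simp_all)
  then show ?case by (simp add: path_Suc eq)
qed (simp add: path_0)

text \<open>The first step uses only the pairs at \<open>v\<close> (the set \<open>A\<close>), all
  later ones only pairs avoiding \<open>v\<close> (the set \<open>B\<close>), and the two families
  of bits are independent. The bound on \<open>k\<close> ensures that each step finds an unprocessed
  vertex.\<close>

lemma path_graph_law:
  assumes "snd st \<subseteq> fst st" "fst st \<subseteq> {1..n}" "card (snd st) + k \<le> n"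
  shows "map_pmf (\<lambda>h. path n F (\<lambda>_ v. {w. h {v, w}}) s st k)
     (Pi_pmf (fresh_edges n (snd st)) False (\<lambda>_. bernoulli_pmf p)) = explore_pmf n F p k st"
  using assms
proof (induction k arbitrary: s st)
  case 0
  then show ?case by (simp add: path_0)
next
  case (Suc k)
  let ?b = "\<lambda>_. bernoulli_pmf p"
  define v where "v = next_vertex n st"
  define W where "W = {1..n} - insert v (snd st)"
  define A where "A = (\<lambda>w. {v, w}) ` W"
  define B where "B = fresh_edges n (insert v (snd st))"
  have c: "card (snd st) < n" using Suc.prems by simp
  have v: "v \<in> {1..n}" "v \<notin> snd st" using next_vertex_in(1)[OF Suc.prems(1,2) c] by (auto simp: v_def)
  have fin: "finite A" "finite B" by (auto simp: A_def W_def B_def)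
  have disj: "A \<inter> B = {}" by (auto simp: A_def B_def fresh_edges_def)
  have "fresh_edges n (snd st) = A \<union> B"
  proof
    show "A \<union> B \<subseteq> fresh_edges n (snd st)"
      using v by (auto simp: A_def B_def W_def fresh_edges_def intro!: Kpairs_pair)
    show "fresh_edges n (snd st) \<subseteq> A \<union> B"
    proof
      fix e assume e: "e \<in> fresh_edges n (snd st)"
      then obtain i j where ij: "e = {i, j}" "i \<noteq> j" "i \<in> {1..n}" "j \<in> {1..n}"
        by (auto simp: fresh_edges_def Kpairs_def)
      show "e \<in> A \<union> B"
      proof (cases "v \<in> e")
        case True
        then obtain w where w: "e = {v, w}" "w \<noteq> v" "w \<in> {1..n}"
          using ij by (auto simp: insert_commute)
        then have "w \<in> W" using e by (auto simp: W_def fresh_edges_def)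
        then show ?thesis using w by (auto simp: A_def)
      qed (use e in \<open>auto simp: B_def fresh_edges_def\<close>)
    qed
  qed
  then have "Pi_pmf (fresh_edges n (snd st)) False ?b
     = map_pmf (\<lambda>(f,g) x. if x \<in> A then f x else g x) (pair_pmf (Pi_pmf A False ?b) (Pi_pmf B False ?b))"
    by (simp only:) (rule Pi_pmf_union[OF fin disj])
  then have "map_pmf (\<lambda>h. path n F (\<lambda>_ v. {w. h {v, w}}) s st (Suc k))
        (Pi_pmf (fresh_edges n (snd st)) False ?b)
     = map_pmf (\<lambda>(f, g). st # path n F (\<lambda>_ v. {w. g {v, w}}) (Suc s) (explore_step n F st {w. w \<in> W \<and> f {v, w}}) k)
        (pair_pmf (Pi_pmf A False ?b) (Pi_pmf B False ?b))"
  proof (simp only: pmf.map_comp, intro map_pmf_cong refl)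
    fix fg :: "(nat set \<Rightarrow> bool) \<times> (nat set \<Rightarrow> bool)"
    obtain f g where fg: "fg = (f, g)" by (cases fg)
    define h where "h x = (if x \<in> A then f x else g x)" for x
    have *: "explore_step n F st {w. h {v, w}} = explore_step n F st {w. w \<in> W \<and> f {v, w}}"
    proof (rule explore_step_cong)
      fix w assume w: "w \<in> {1..n}" "w \<notin> fst st" "w \<notin> comp n F (next_vertex n st)"
      then have "w \<in> W"
        using comp_self[OF v(1), of F] Suc.prems(1) by (auto simp: W_def v_def)
      then show "w \<in> {w. h {v, w}} \<longleftrightarrow> w \<in> {w. w \<in> W \<and> f {v, w}}" by (auto simp: h_def A_def)
    qed
    let ?st = "explore_step n F st {w. w \<in> W \<and> f {v, w}}"
    have "path n F (\<lambda>_ v. {w. h {v, w}}) (Suc s) ?st k = path n F (\<lambda>_ v. {w. g {v, w}}) (Suc s) ?st k"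
    proof (rule path_graph_cong)
      show "h e = g e" if "e \<in> fresh_edges n (snd ?st)" for e
        using that disj by (auto simp: h_def B_def explore_step_snd v_def)
    qed (use explore_step_bounds[OF Suc.prems(1,2) c] Suc.prems(3) in simp_all)
    then have "path n F (\<lambda>_ v. {w. h {v, w}}) s st (Suc k)
        = st # path n F (\<lambda>_ v. {w. g {v, w}}) (Suc s) ?st k"
      using * by (simp add: path_Suc v_def)
    then show "((\<lambda>h. path n F (\<lambda>_ v. {w. h {v, w}}) s st (Suc k)) \<circ> (\<lambda>(f,g) x. if x \<in> A then f x else g x)) fg
      = (case fg of (f, g) \<Rightarrow> st # path n F (\<lambda>_ v. {w. g {v, w}}) (Suc s) (explore_step n F st {w. w \<in> W \<and> f {v, w}}) k)"
      by (simp add: fg h_def)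
  qed
  also have "\<dots> = bind_pmf (Pi_pmf A False ?b) (\<lambda>f. map_pmf ((#) st)
      (map_pmf (\<lambda>g. path n F (\<lambda>_ v. {w. g {v, w}}) (Suc s) (explore_step n F st {w. w \<in> W \<and> f {v, w}}) k) (Pi_pmf B False ?b)))"
    by (simp add: pair_pmf_def map_bind_pmf bind_map_pmf map_pmf_def bind_assoc_pmf bind_return_pmf)
  also have "\<dots> = bind_pmf (Pi_pmf A False ?b) (\<lambda>f. map_pmf ((#) st) (explore_pmf n F p k (explore_step n F st {w. w \<in> W \<and> f {v, w}})))"
  proof (intro bind_pmf_cong refl arg_cong[where f = "map_pmf _"])
    fix f
    let ?st = "explore_step n F st {w. w \<in> W \<and> f {v, w}}"
    have "B = fresh_edges n (snd ?st)" by (simp add: B_def explore_step_snd v_def)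
    then show "map_pmf (\<lambda>g. path n F (\<lambda>_ v. {w. g {v, w}}) (Suc s) ?st k) (Pi_pmf B False ?b) = explore_pmf n F p k ?st"
      using explore_step_bounds[OF Suc.prems(1,2) c] Suc.prems(3) by (simp only:) (rule Suc.IH; simp)
  qed
  also have "\<dots> = bind_pmf (map_pmf (\<lambda>g. g \<circ> (\<lambda>w. {v, w})) (Pi_pmf A False ?b))
      (\<lambda>a. map_pmf ((#) st) (explore_pmf n F p k (explore_step n F st {w. w \<in> W \<and> a w})))"
    by (simp add: bind_map_pmf)
  also have "map_pmf (\<lambda>g. g \<circ> (\<lambda>w. {v, w})) (Pi_pmf A False ?b) = Pi_pmf W False ?b"
    by (rule Pi_pmf_bij_betw[symmetric])
       (auto simp: bij_betw_def inj_on_def doubleton_eq_iff A_def W_def)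
  \<comment> \<open>Pads \<open>W\<close> to all vertices to match \<open>explore_pmf\<close>; the
    extra bits belong to processed vertices or to \<open>v\<close> itself, and the step ignores
    them.\<close>
  also have "Pi_pmf W False ?b = map_pmf (\<lambda>f x. if x \<in> W then f x else False) (Pi_pmf {1..n} False ?b)"
    by (rule Pi_pmf_subset) (auto simp: W_def)
  also have "bind_pmf \<dots> (\<lambda>a. map_pmf ((#) st) (explore_pmf n F p k (explore_step n F st {w. w \<in> W \<and> a w})))
      = bind_pmf (Pi_pmf {1..n} False ?b) (\<lambda>a. map_pmf ((#) st) (explore_pmf n F p k (explore_step n F st {w. a w})))"
  proof -
    have "explore_step n F st {w. w \<in> W \<and> (if w \<in> W then a w else False)} = explore_step n F st {w. a w}" for a
      using Suc.prems(1) comp_self[OF v(1), of F]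
      by (intro explore_step_cong) (auto simp: W_def v_def)
    then show ?thesis by (simp add: bind_map_pmf)
  qed
  finally show ?case by simp
qed

lemma path_graph_array_law:
  "map_pmf (\<lambda>h. path n F (\<lambda>_ v. {w. h {v, w}}) 0 ({}, {}) n)
     (Pi_pmf (Kpairs n) False (\<lambda>_. bernoulli_pmf p))
   = map_pmf (\<lambda>\<omega>. path n F (\<lambda>j _. {w. \<omega> (j, w)}) 0 ({}, {}) n)
     (Pi_pmf ({0..<n} \<times> {1..n}) False (\<lambda>_. bernoulli_pmf p))"
  using path_graph_law[of "({}, {})" n n F 0 p] path_array_law[of n F 0 "({}, {})" n p]
  by (simp add: fresh_edges_def)

section \<open>Concentration of the largest component in the Bernoulli model\<close>

lemma prob_Pi_bernoulli_none:
  assumes "finite I" "B \<subseteq> I" "p \<in> {0..1}"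
  shows "measure_pmf.prob (Pi_pmf I False (\<lambda>_. bernoulli_pmf p)) {f. \<forall>x\<in>B. \<not> f x} = (1 - p) ^ card B"
proof -
  have fin: "finite B" using assms finite_subset by blast
  have "(1 - p) ^ card B = pmf (Pi_pmf B False (\<lambda>_. bernoulli_pmf p)) (\<lambda>_. False)"
    using assms fin by (subst pmf_Pi') auto
  also have "Pi_pmf B False (\<lambda>_. bernoulli_pmf p)
     = map_pmf (\<lambda>f x. if x \<in> B then f x else False) (Pi_pmf I False (\<lambda>_. bernoulli_pmf p))"
    using assms by (intro Pi_pmf_subset) auto
  also have "pmf \<dots> (\<lambda>_. False) = measure_pmf.prob (Pi_pmf I False (\<lambda>_. bernoulli_pmf p)) {f. \<forall>x\<in>B. \<not> f x}"
    unfolding pmf_map by (intro arg_cong[where f = "measure_pmf.prob _"]) (auto simp: fun_eq_iff)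
  finally show ?thesis by simp
qed

text \<open>Probability that a Poisson variable of mean t / n is positive.\<close>

definition edge_prob :: "nat \<Rightarrow> real \<Rightarrow> real" where
  "edge_prob n t = 1 - exp (- (t / real n))"

lemma edge_prob_bounds: "t \<ge> 0 \<Longrightarrow> edge_prob n t \<in> {0..1}"
  by (simp add: edge_prob_def)

lemma comps_disjoint: "C \<in> comps n F \<Longrightarrow> D \<in> comps n F \<Longrightarrow> x \<in> C \<Longrightarrow> x \<in> D \<Longrightarrow> C = D"
  unfolding comps_def using comp_eq by blast

lemma comps_subset: "C \<in> comps n F \<Longrightarrow> C \<subseteq> {1..n}"
  unfolding comps_def using comp_subset by blast

lemma finite_in_comps: "C \<in> comps n F \<Longrightarrow> finite C"
  by (auto simp: comps_def)

text \<open>Components occupy disjoint sets of columns of the array, so the summands are independent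
  and bounded, as Hoeffding's inequality wants them.\<close>

lemma card_rung_set:
  "real (card (rung_set n F \<omega> j))
   = (\<Sum>C\<in>comps n F. if \<exists>x\<in>{..<j} \<times> C. \<omega> x then real (card C) else 0)"
proof -
  let ?Q = "{C\<in>comps n F. \<exists>x\<in>{..<j} \<times> C. \<omega> x}"
  have "rung_set n F \<omega> j = \<Union>?Q"
  proof
    show "rung_set n F \<omega> j \<subseteq> \<Union>?Q"
    proof
      fix y assume "y \<in> rung_set n F \<omega> j"
      then obtain w l where w: "w \<in> {1..n}" "l < j" "\<omega> (l, w)" "y \<in> comp n F w"
        by (auto simp: rung_set_def)
      then have "comp n F w \<in> ?Q" using comp_self[of w n F] by (auto simp: comps_def)
      then show "y \<in> \<Union>?Q" using w by blast
    qed
    show "\<Union>?Q \<subseteq> rung_set n F \<omega> j"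
    proof
      fix y assume "y \<in> \<Union>?Q"
      then obtain C l w where C: "C \<in> comps n F" "y \<in> C" "l < j" "w \<in> C" "\<omega> (l, w)" by auto
      then have "C = comp n F w" using comp_eq[of w n F] by (auto simp: comps_def)
      moreover have "w \<in> {1..n}" using C comps_subset by blast
      ultimately show "y \<in> rung_set n F \<omega> j" using C unfolding rung_set_def by blast
    qed
  qed
  moreover have "card (\<Union>?Q) = (\<Sum>C\<in>?Q. card C)"
  proof (rule card_Union_disjoint)
    show "pairwise disjnt ?Q"
      using comps_disjoint by (fastforce simp: pairwise_def disjnt_def)
    show "\<And>A. A \<in> ?Q \<Longrightarrow> finite A" using finite_in_comps by blast
  qed
  ultimately have "real (card (rung_set n F \<omega> j)) = (\<Sum>C\<in>?Q. real (card C))" by simp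
  also have "\<dots> = (\<Sum>C\<in>comps n F. if \<exists>x\<in>{..<j} \<times> C. \<omega> x then real (card C) else 0)"
    by (intro sum.inter_filter) simp
  finally show ?thesis .
qed

text \<open>With edge probability \<open>1 - exp (- t / n)\<close> the expected number of vertices reached after
  \<open>j\<close> steps is \<open>n (1 - Zexp n F t (j / n))\<close> exactly.\<close>

lemma rung_set_concentration:
  assumes n: "n > 0" and t: "t \<ge> 0" and j: "j \<le> n" and M: "s_pow 2 n F \<le> M" and a: "\<alpha> > 0"
  shows "measure_pmf.prob (Pi_pmf ({0..<n} \<times> {1..n}) False (\<lambda>_. bernoulli_pmf (edge_prob n t)))
     {\<omega>. \<bar>real (card (rung_set n F \<omega> j)) - real n * (1 - Zexp n F t (real j / real n))\<bar> \<ge> \<alpha> * real n}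
     \<le> 2 * exp (- 2 * \<alpha>\<^sup>2 * real n / M)"
proof -
  define I where "I = {0..<n} \<times> {1..n}"
  define p where "p = edge_prob n t"
  define \<Omega> where "\<Omega> = Pi_pmf I False (\<lambda>_. bernoulli_pmf p)"
  define K where "K C = {..<j} \<times> C" for C :: "nat set"
  define X :: "nat set \<Rightarrow> (nat \<times> nat \<Rightarrow> bool) \<Rightarrow> real" where
    "X C \<omega> = (if \<exists>x\<in>K C. \<omega> x then real (card C) else 0)" for C \<omega>
  define \<mu> where "\<mu> = (\<Sum>C\<in>comps n F. measure_pmf.expectation \<Omega> (X C))"
  have p: "p \<in> {0..1}" using edge_prob_bounds[OF t] by (simp add: p_def)
  have finI: "finite I" by (simp add: I_def)
  have KI: "K C \<subseteq> I" if "C \<in> comps n F" for C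
    using comps_subset[OF that] j by (auto simp: K_def I_def)
  have finK: "finite (K C)" if "C \<in> comps n F" for C using finite_in_comps[OF that] by (simp add: K_def)
  have "prob_space.indep_vars (measure_pmf \<Omega>) (\<lambda>C. PiM (K C) (\<lambda>_. count_space UNIV))
      (\<lambda>C \<omega>. restrict (\<lambda>i. \<omega> i) (K C)) (comps n F)"
    unfolding \<Omega>_def
    by (rule prob_space.indep_vars_restrict[OF measure_pmf.prob_space_axioms indep_vars_Pi_pmf[OF finI]])
       (use KI comps_disjoint in \<open>fastforce simp: disjoint_family_on_def K_def\<close>)+
  then have "prob_space.indep_vars (measure_pmf \<Omega>) (\<lambda>_. borel)
      (\<lambda>C \<omega>. (if \<exists>x\<in>K C. restrict (\<lambda>i. \<omega> i) (K C) x then real (card C) else 0)) (comps n F)"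
  proof (rule prob_space.indep_vars_compose2[OF measure_pmf.prob_space_axioms])
    fix C assume C: "C \<in> comps n F"
    have [measurable]: "(\<lambda>f. f x) \<in> measurable (PiM (K C) (\<lambda>_. count_space (UNIV :: bool set))) (count_space UNIV)"
      if "x \<in> K C" for x using that by (rule measurable_component_singleton)
    have "Measurable.pred (PiM (K C) (\<lambda>_. count_space (UNIV :: bool set))) (\<lambda>f. \<exists>x\<in>K C. f x)"
      using finK[OF C] by (intro pred_intros_finite) auto
    then show "(\<lambda>f. if \<exists>x\<in>K C. f x then real (card C) else 0)
        \<in> borel_measurable (PiM (K C) (\<lambda>_. count_space (UNIV :: bool set)))"
      by (intro measurable_If) auto
  qed
  then have ind: "prob_space.indep_vars (measure_pmf \<Omega>) (\<lambda>_. borel) X (comps n F)"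
    by (simp add: X_def[abs_def] cong: bex_cong)
  interpret Hoeffding_ineq "measure_pmf \<Omega>" "comps n F" X "\<lambda>_. 0" "\<lambda>C. real (card C)" \<mu>
    by unfold_locales (use ind in \<open>auto simp: X_def \<mu>_def\<close>)
  \<comment> \<open>Hoeffding's denominator is the sum of the squared component sizes, n s_2 \<le> n
    M; a deviation of \<alpha> n therefore has an exponent linear in n.\<close>
  have sq: "(\<Sum>C\<in>comps n F. (real (card C) - 0)\<^sup>2) = real n * s_pow 2 n F"
    using n by (simp add: s_pow_def S_pow_def)
  have s1: "s_pow 2 n F \<ge> 1" using s_pow_ge_1[of 2 n F] n by simp
  have pos: "(\<Sum>C\<in>comps n F. (real (card C) - 0)\<^sup>2) > 0" unfolding sq using n s1 by simp
  have "measure_pmf.expectation \<Omega> (X C)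
      = real (card C) * (1 - exp (- (real j / real n * t * real (card C))))" if C: "C \<in> comps n F" for C
  proof -
    have "X C = (\<lambda>\<omega>. real (card C) * (1 - indicator {f. \<forall>x\<in>K C. \<not> f x} \<omega>))"
      by (auto simp: X_def fun_eq_iff indicator_def)
    moreover have "integrable (measure_pmf \<Omega>) (indicat_real {f. \<forall>x\<in>K C. \<not> f x})"
      by (intro measure_pmf.integrable_const_bound[where B = 1]) auto
    ultimately have "measure_pmf.expectation \<Omega> (X C)
        = real (card C) * (1 - measure_pmf.prob \<Omega> {f. \<forall>x\<in>K C. \<not> f x})"
      by (simp add: measure_pmf.prob_space)
    also have "measure_pmf.prob \<Omega> {f. \<forall>x\<in>K C. \<not> f x} = (1 - p) ^ card (K C)"
      unfolding \<Omega>_def by (rule prob_Pi_bernoulli_none[OF finI KI[OF C] p])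
    also have "\<dots> = exp (- (t / real n)) ^ (j * card C)"
      by (simp add: p_def edge_prob_def K_def card_cartesian_product)
    also have "\<dots> = exp (- (real j / real n * t * real (card C)))"
      by (simp add: exp_of_nat_mult[symmetric] mult_ac)
    finally show ?thesis .
  qed
  then have "\<mu> = (\<Sum>C\<in>comps n F. real (card C) * (1 - exp (- (real j / real n * t * real (card C)))))"
    by (simp add: \<mu>_def)
  also have "\<dots> = (\<Sum>v\<in>{1..n}. 1 - exp (- (real j / real n * t * real (card (comp n F v)))))"
    by (rule sum_comp_eq_sum_comps[symmetric])
  also have "\<dots> = real n * (1 - Zexp n F t (real j / real n))"
    using n by (simp add: Zexp_eq sum_subtractf field_simps)
  finally have mu: "\<mu> = real n * (1 - Zexp n F t (real j / real n))" .
  have "measure_pmf.prob \<Omega> {x \<in> space \<Omega>. \<bar>(\<Sum>C\<in>comps n F. X C x) - \<mu>\<bar> \<ge> \<alpha> * real n}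
      \<le> 2 * exp (-2 * (\<alpha> * real n)\<^sup>2 / (\<Sum>C\<in>comps n F. (real (card C) - 0)\<^sup>2))"
    using a pos by (intro Hoeffding_ineq_abs_ge) auto
  also have "-2 * (\<alpha> * real n)\<^sup>2 / (\<Sum>C\<in>comps n F. (real (card C) - 0)\<^sup>2) = - 2 * \<alpha>\<^sup>2 * real n / s_pow 2 n F"
    unfolding sq using n by (simp add: power2_eq_square)
  also have "2 * exp (- 2 * \<alpha>\<^sup>2 * real n / s_pow 2 n F) \<le> 2 * exp (- 2 * \<alpha>\<^sup>2 * real n / M)"
    using M s1 by (simp add: frac_le)
  finally show ?thesis
    by (simp add: mu card_rung_set X_def K_def \<Omega>_def I_def p_def)
qed

text \<open>Lets the graph at a nearby time \<open>t'\<close> be measured against the root for time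
  \<open>t\<close>, as the models with a fixed number of draws require. The constant is the mean s_2
  of Z.\<close>

lemma Zexp_Lipschitz:
  assumes n: "n > 0" and t: "t \<ge> 0" "t' \<ge> 0" and r: "0 \<le> r" "r \<le> 1" and M: "s_pow 2 n F \<le> M"
  shows "\<bar>Zexp n F t' r - Zexp n F t r\<bar> \<le> M * \<bar>t' - t\<bar>"
proof -
  have lip: "\<bar>exp (- x) - exp (- y)\<bar> \<le> \<bar>x - y\<bar>" if "0 \<le> x" "0 \<le> y" for x y :: real
  proof -
    have le: "exp (- x) - exp (- y) \<le> y - x" if xy: "0 \<le> x" "x \<le> y" for x y :: real
    proof -
      have "exp (- x) - exp (- y) = exp (- x) * (1 - exp (- (y - x)))"
        by (simp add: algebra_simps flip: exp_add)
      also have "\<dots> \<le> 1 * (1 - exp (- (y - x)))" using xy by (intro mult_right_mono) auto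
      also have "\<dots> = 1 - exp (x - y)" by simp
      also have "\<dots> \<le> y - x" using exp_ge_add_one_self[of "x - y"] by linarith
      finally show ?thesis .
    qed
    show ?thesis using le[of x y] le[of y x] that by (cases "x \<le> y") (auto simp: abs_if)
  qed
  define c where "c v = real (card (comp n F v))" for v
  have "\<bar>Zexp n F t' r - Zexp n F t r\<bar>
      = \<bar>(\<Sum>v\<in>{1..n}. exp (- (r * t' * c v)) - exp (- (r * t * c v)))\<bar> / real n"
    unfolding Zexp_eq[OF n] c_def using n by (simp add: sum_subtractf diff_divide_distrib[symmetric])
  also have "\<dots> \<le> (\<Sum>v\<in>{1..n}. \<bar>t' - t\<bar> * c v) / real n"
  proof (intro divide_right_mono order_trans[OF sum_abs] sum_mono)
    fix v
    have "\<bar>exp (- (r * t' * c v)) - exp (- (r * t * c v))\<bar> \<le> \<bar>r * t' * c v - r * t * c v\<bar>"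
      using t r by (intro lip) (auto simp: c_def)
    also have "r * t' * c v - r * t * c v = r * ((t' - t) * c v)" by (simp add: algebra_simps)
    also have "\<bar>\<dots>\<bar> = r * (\<bar>t' - t\<bar> * c v)" using r by (simp add: abs_mult c_def)
    also have "\<dots> \<le> 1 * (\<bar>t' - t\<bar> * c v)" using r by (intro mult_right_mono) (auto simp: c_def)
    finally show "\<bar>exp (- (r * t' * c v)) - exp (- (r * t * c v))\<bar> \<le> \<bar>t' - t\<bar> * c v" by simp
  qed simp
  also have "\<dots> = \<bar>t' - t\<bar> * s_pow 2 n F" by (simp add: s_pow_2 c_def sum_distrib_left)
  also have "\<dots> \<le> \<bar>t' - t\<bar> * M" using M by (intro mult_left_mono) auto
  finally show ?thesis by (simp add: mult.commute)
qed

text \<open>Strong convexity turns a uniform error \<beta> in the counts into an error \<epsilon> in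
  the lengths: the assumption on \<beta> makes |g| exceed 3 \<beta> on
  [\<epsilon>, \<rho> - \<epsilon>] and on [\<rho> + \<epsilon>, 1].\<close>

lemma (in array_exploration) busy_periods_concentrated:
  assumes n: "n > 0" and t: "t > 0" and M: "s_pow 2 n F \<le> M"
    and \<rho>: "surv_prob n F t \<rho>" and \<epsilon>: "\<epsilon> > 0" and \<beta>: "3 * \<beta> < surv_curv M t / 2 * \<epsilon>\<^sup>2"
    and x: "\<And>v. v \<in> {1..n} \<Longrightarrow> real (card (comp n F v)) \<le> \<beta> * real n"
    and conc: "\<And>j. j \<le> n \<Longrightarrow>
      \<bar>real (card (rung j)) - real n * (1 - Zexp n F t (real j / real n))\<bar> < \<beta> * real n"
  shows "busy a b \<Longrightarrow> real (b - a) \<le> (\<rho> + \<epsilon>) * real n"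
    and "2 * \<epsilon> < \<rho> \<Longrightarrow> \<exists>a b. busy a b \<and> (\<rho> - 2 * \<epsilon>) * real n \<le> real (b - a)"
proof -
  let ?g = "surv_gap n F t"
  have \<rho>01: "0 \<le> \<rho>" "\<rho> \<le> 1" using \<rho> by (auto simp: surv_prob_def)
  have curv: "surv_curv M t > 0" by (rule surv_curv_pos[OF t])
  have rung_g: "\<bar>real (card (rung j)) - real j + real n * ?g (real j / real n)\<bar> < \<beta> * real n" if "j \<le> n" for j
    using conc[OF that] n by (simp add: surv_gap_def algebra_simps)
  {
    assume ab: "busy a b"
    then have lt: "a < b" "b \<le> n" by (auto simp: busy_def)
    define L where "L = real b / real n - real a / real n"
    show "real (b - a) \<le> (\<rho> + \<epsilon>) * real n"
    proof (rule ccontr)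
      assume c: "\<not> real (b - a) \<le> (\<rho> + \<epsilon>) * real n"
      have Ln: "real (b - a) = L * real n" using lt n by (simp add: L_def field_simps)
      then have L: "L > \<rho> + \<epsilon>" using c n by simp
      have L1: "L \<le> 1" using lt n by (simp add: L_def diff_divide_distrib[symmetric])
      \<comment> \<open>Three errors of \<beta> n: the restart component and the fluctuations of
        \<open>rung\<close> at \<open>a\<close> and at \<open>b\<close>.\<close>
      have "real n * ?g (real b / real n) - real n * ?g (real a / real n) \<le> 3 * (\<beta> * real n)"
        using busy_length_le[OF ab x] rung_g[of a] rung_g[of b] lt by linarith
      then have "real n * (?g (real b / real n) - ?g (real a / real n)) \<le> real n * (3 * \<beta>)"
        by (simp add: algebra_simps)
      then have "?g (real b / real n) - ?g (real a / real n) \<le> 3 * \<beta>" using n by simp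
      moreover have "?g L \<le> ?g (real b / real n) - ?g (real a / real n)"
        unfolding L_def using lt n by (intro surv_gap_increment[OF n t]) (auto simp: divide_strict_right_mono)
      moreover have "surv_curv M t / 2 * L * (L - \<rho>) \<le> ?g L"
        using L L1 \<epsilon> by (intro surv_gap_ge[OF n t M \<rho>]) auto
      moreover have "surv_curv M t / 2 * \<epsilon>\<^sup>2 \<le> surv_curv M t / 2 * (L * (L - \<rho>))"
        unfolding power2_eq_square using curv L \<epsilon> \<rho>01 by (intro mult_left_mono mult_mono) auto
      ultimately show False using \<beta> by (simp add: mult.assoc)
    qed
  }
  assume big: "2 * \<epsilon> < \<rho>"
  \<comment> \<open>With this rounding every \<open>l\<close> strictly between \<open>a'\<close> and
    \<open>b'\<close> lies in [\<epsilon> n, (\<rho> - \<epsilon>) n], while b' - a' still exceeds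
    (\<rho> - 2 \<epsilon>) n.\<close>
  define a' where "a' = nat \<lfloor>\<epsilon> * real n\<rfloor>"
  define b' where "b' = nat \<lfloor>(\<rho> - \<epsilon>) * real n\<rfloor> + 1"
  have a': "real a' \<le> \<epsilon> * real n" "\<epsilon> * real n < real a' + 1"
    using \<epsilon> by (auto simp: a'_def)
  have b': "real b' - 1 \<le> (\<rho> - \<epsilon>) * real n" "(\<rho> - \<epsilon>) * real n < real b'"
    using \<epsilon> big by (auto simp: b'_def) linarith
  have "(\<rho> - \<epsilon>) * real n < 1 * real n" using n \<rho>01 \<epsilon> by (intro mult_strict_right_mono) auto
  then have b'n: "b' \<le> n" using b' by linarith
  have "\<epsilon> * real n < (\<rho> - \<epsilon>) * real n" using n big by (intro mult_strict_right_mono) auto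
  then have a'b': "a' < b'" using a' b' by linarith
  have "\<not> idle l" if l: "a' < l" "l < b'" for l
  proof -
    define r where "r = real l / real n"
    have ln: "l \<le> n" using l b'n by simp
    have rn: "real l = r * real n" using n by (simp add: r_def)
    have "\<epsilon> * real n \<le> r * real n" "r * real n \<le> (\<rho> - \<epsilon>) * real n"
      using l a' b' unfolding rn[symmetric] by linarith+
    then have r: "\<epsilon> \<le> r" "r \<le> \<rho> - \<epsilon>" using n by auto
    have "?g r \<le> - (surv_curv M t / 2 * r * (\<rho> - r))"
      using r \<epsilon> by (intro surv_gap_le[OF n t M \<rho>]) auto
    moreover have "surv_curv M t / 2 * \<epsilon>\<^sup>2 \<le> surv_curv M t / 2 * (r * (\<rho> - r))"
      unfolding power2_eq_square using curv r \<epsilon> by (intro mult_left_mono mult_mono) auto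
    moreover have "\<beta> \<ge> 0"
      using x[of 1] card_comp_ge_1[of 1 n F] n by (smt (verit) One_nat_def Suc_leI atLeastAtMost_iff mult_neg_pos of_nat_0_less_iff order_refl)
    ultimately have "\<beta> < - ?g r" using \<beta> by (simp add: mult.assoc)
    then have "\<beta> * real n < (- ?g r) * real n" using n by (intro mult_strict_right_mono) auto
    then have "real l < real (card (rung l))"
      using rung_g[OF ln] unfolding r_def[symmetric] by (simp add: mult.commute abs_less_iff)
    then show ?thesis using not_idle_if_rung[OF ln] by simp
  qed
  then obtain a b where ab: "busy a b" "a \<le> a'" "b' \<le> b"
    using busy_period_around[OF a'b' b'n] by blast
  moreover have "(\<rho> - 2 * \<epsilon>) * real n \<le> real (b - a)"
  proof -
    have "(\<rho> - 2 * \<epsilon>) * real n = (\<rho> - \<epsilon>) * real n - \<epsilon> * real n" by (simp add: algebra_simps)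
    also have "\<dots> \<le> real b' - real a' + (real a' - \<epsilon> * real n) + ((\<rho> - \<epsilon>) * real n - real b') "
      by simp
    also have "real a' - \<epsilon> * real n \<le> 0" using a' by simp
    finally show ?thesis using a' b' ab a'b' by linarith
  qed
  ultimately show "\<exists>a b. busy a b \<and> (\<rho> - 2 * \<epsilon>) * real n \<le> real (b - a)" by blast
qed

lemma Gtilde_bernoulli:
  assumes "t > 0" "n > 0"
  shows "Gtilde n t F = map_pmf (\<lambda>h. F \<union> {e \<in> Kpairs n. h e})
     (Pi_pmf (Kpairs n) False (\<lambda>_. bernoulli_pmf (edge_prob n t)))"
proof -
  have "bernoulli_pmf (edge_prob n t) = map_pmf (\<lambda>k. k > 0) (poisson_pmf (t / real n))"
  proof (rule pmf_eqI)
    fix b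
    have p: "edge_prob n t \<in> {0..1}" using assms by (intro edge_prob_bounds) simp
    have "measure_pmf.prob (poisson_pmf (t / real n)) {0} = exp (- (t / real n))"
      using assms by (simp add: measure_pmf_single)
    moreover have "(\<lambda>k::nat. k > 0) -` {False} = {0}" by auto
    ultimately have F: "pmf (map_pmf (\<lambda>k. k > 0) (poisson_pmf (t / real n))) False = exp (- (t / real n))"
      by (simp add: pmf_map)
    have "pmf (map_pmf (\<lambda>k. k > 0) (poisson_pmf (t / real n))) True
        = 1 - pmf (map_pmf (\<lambda>k. k > 0) (poisson_pmf (t / real n))) False"
      by (rule pmf_True_conv_False)
    then show "pmf (bernoulli_pmf (edge_prob n t)) b = pmf (map_pmf (\<lambda>k. k > 0) (poisson_pmf (t / real n))) b"
      using F p by (cases b) (simp_all add: edge_prob_def)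
  qed
  then have "Pi_pmf (Kpairs n) False (\<lambda>_. bernoulli_pmf (edge_prob n t))
     = map_pmf (\<lambda>h. (\<lambda>k. k > 0) \<circ> h) (Pi_pmf (Kpairs n) 0 (\<lambda>_. poisson_pmf (t / real n)))"
    by (simp only:) (rule Pi_pmf_map; simp)
  then show ?thesis by (simp add: Gtilde_def pmf.map_comp o_def)
qed

text \<open>\<open>busy_periods_concentrated\<close> is applied with \<beta> = 2 \<alpha>: one
  \<alpha> for the fluctuation at time \<open>t'\<close>, one for replacing \<open>t'\<close> by
  \<open>t\<close>. The factor n + 1 is the union bound over the steps, and \<open>big\<close> keeps
  the components of \<open>F\<close> below \<alpha> n.\<close>

lemma Gtilde_C1_concentration:
  assumes n: "n > 0" and t: "t > 0" and t': "t' > 0" and F: "is_graph n F" and M: "s_pow 2 n F \<le> M"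
    and \<rho>: "surv_prob n F t \<rho>" and \<epsilon>: "\<epsilon> > 0" and \<alpha>: "\<alpha> > 0" "6 * \<alpha> < surv_curv M t / 2 * \<epsilon>\<^sup>2"
    and tt: "M * \<bar>t' - t\<bar> \<le> \<alpha>" and big: "M \<le> \<alpha>\<^sup>2 * real n"
  shows "measure_pmf.prob (Gtilde n t' F) {E. \<bar>real (C1 n E) / real n - \<rho>\<bar> > 2 * \<epsilon>}
     \<le> 2 * (real n + 1) * exp (- 2 * \<alpha>\<^sup>2 * real n / M)"
proof -
  define p where "p = edge_prob n t'"
  define \<Omega> where "\<Omega> = Pi_pmf ({0..<n} \<times> {1..n}) False (\<lambda>_. bernoulli_pmf p)"
  define H where "H = Pi_pmf (Kpairs n) False (\<lambda>_. bernoulli_pmf p)"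
  \<comment> \<open>\<open>good\<close> depends on the trajectory only through busy periods within
    [0, n]. It is thus an event of the list \<open>path\<close> and has the same probability under
    both explorations.\<close>
  define good where "good \<sigma> \<longleftrightarrow>
      (\<forall>a b. exploration.busy n \<sigma> a b \<longrightarrow> real (b - a) \<le> (\<rho> + \<epsilon>) * real n) \<and>
      (2 * \<epsilon> < \<rho> \<longrightarrow> (\<exists>a b. exploration.busy n \<sigma> a b \<and> (\<rho> - 2 * \<epsilon>) * real n \<le> real (b - a)))" for \<sigma>
  define bad where "bad j = {\<omega>. \<bar>real (card (rung_set n F \<omega> j)) - real n * (1 - Zexp n F t' (real j / real n))\<bar> \<ge> \<alpha> * real n}" for j
  let ?nbH = "\<lambda>h _ v. {w. h {v, w}}"
  let ?nbA = "\<lambda>\<omega> j _. {w. \<omega> (j, w)}"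
  have good_path: "good (\<lambda>j. path n F nb 0 ({}, {}) n ! j) \<longleftrightarrow> good (walk n F nb 0 ({}, {}))" for nb
  proof -
    have e: "exploration n F nb (\<lambda>j. path n F nb 0 ({}, {}) n ! j)"
      using exploration_walk[of n F nb] by (simp add: exploration_def path_nth)
    have idle: "exploration.idle (\<lambda>j. path n F nb 0 ({}, {}) n ! j) l
        \<longleftrightarrow> exploration.idle (walk n F nb 0 ({}, {})) l" if "l \<le> n" for l
      unfolding exploration.idle_def[OF e] exploration.idle_def[OF exploration_walk]
        exploration.S_def[OF e] exploration.S_def[OF exploration_walk]
        exploration.P_def[OF e] exploration.P_def[OF exploration_walk]
      by (simp add: path_nth that)
    have "exploration.busy n (\<lambda>j. path n F nb 0 ({}, {}) n ! j) a b
        \<longleftrightarrow> exploration.busy n (walk n F nb 0 ({}, {})) a b" for a b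
      unfolding exploration.busy_def[OF exploration_walk] exploration.busy_def[OF e]
      using idle by (intro conj_cong all_cong imp_cong) auto
    then show ?thesis by (simp add: good_def)
  qed
  have H_good: "\<bar>real (C1 n (F \<union> {e \<in> Kpairs n. h e})) / real n - \<rho>\<bar> \<le> 2 * \<epsilon>"
    if g: "good (walk n F (?nbH h) 0 ({}, {}))" for h
  proof -
    interpret graph_exploration n F h "walk n F (?nbH h) 0 ({}, {})"
      by (intro graph_exploration.intro exploration_walk graph_exploration_axioms.intro F)
    have "\<rho> \<ge> 0" using \<rho> by (simp add: surv_prob_def)
    have "C1 n G \<le> nat \<lfloor>(\<rho> + \<epsilon>) * real n\<rfloor>"
    proof (rule C1_le_busy)
      fix a b assume "busy a b"
      then have "real (b - a) \<le> (\<rho> + \<epsilon>) * real n" using g by (auto simp: good_def)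
      then show "b - a \<le> nat \<lfloor>(\<rho> + \<epsilon>) * real n\<rfloor>" by linarith
    qed
    then have "real (C1 n G) \<le> (\<rho> + \<epsilon>) * real n" using \<open>\<rho> \<ge> 0\<close> \<epsilon> by (simp add: le_nat_iff le_floor_iff)
    then have up: "real (C1 n G) / real n \<le> \<rho> + \<epsilon>" using n by (simp add: field_simps)
    have lo: "\<rho> - 2 * \<epsilon> \<le> real (C1 n G) / real n"
    proof (cases "2 * \<epsilon> < \<rho>")
      case True
      then obtain a b where ab: "busy a b" "(\<rho> - 2 * \<epsilon>) * real n \<le> real (b - a)"
        using g by (auto simp: good_def)
      then have "(\<rho> - 2 * \<epsilon>) * real n \<le> real (C1 n G)" using C1_ge_busy[OF ab(1)] by linarith
      then show ?thesis using n by (simp add: field_simps)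
    next
      case False
      then have "\<rho> - 2 * \<epsilon> \<le> 0" by simp
      also have "0 \<le> real (C1 n G) / real n" by simp
      finally show ?thesis .
    qed
    show ?thesis using up lo \<epsilon> by (simp add: abs_le_iff)
  qed
  have A_good: "good (walk n F (?nbA \<omega>) 0 ({}, {}))" if \<omega>: "\<And>j. j \<le> n \<Longrightarrow> \<omega> \<notin> bad j" for \<omega>
  proof -
    interpret array_exploration n F \<omega> "walk n F (?nbA \<omega>) 0 ({}, {})"
      by (intro array_exploration.intro exploration_walk)
    have x: "real (card (comp n F v)) \<le> 2 * \<alpha> * real n" if "v \<in> {1..n}" for v
    proof -
      have "(real (card (comp n F v)))\<^sup>2 \<le> real n * s_pow 2 n F" by (rule card_comp_power2_le[OF that])
      also have "\<dots> \<le> real n * (\<alpha>\<^sup>2 * real n)" using M big by (intro mult_left_mono) auto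
      also have "\<dots> = (\<alpha> * real n)\<^sup>2" by (simp add: power2_eq_square)
      finally have "real (card (comp n F v)) \<le> \<alpha> * real n" by (rule power2_le_imp_le) (use \<alpha> in simp)
      also have "\<dots> \<le> 2 * \<alpha> * real n" using \<alpha> by simp
      finally show ?thesis .
    qed
    have conc: "\<bar>real (card (rung j)) - real n * (1 - Zexp n F t (real j / real n))\<bar> < 2 * \<alpha> * real n"
      if j: "j \<le> n" for j
    proof -
      have "\<bar>real (card (rung j)) - real n * (1 - Zexp n F t' (real j / real n))\<bar> < \<alpha> * real n"
        using \<omega>[OF j] by (simp add: bad_def)
      moreover have "\<bar>Zexp n F t' (real j / real n) - Zexp n F t (real j / real n)\<bar> \<le> \<alpha>"
        using Zexp_Lipschitz[OF n _ less_imp_le[OF t'] _ _ M, of t "real j / real n"] t j n tt by simp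
      then have "real n * \<bar>Zexp n F t' (real j / real n) - Zexp n F t (real j / real n)\<bar> \<le> real n * \<alpha>"
        by (intro mult_left_mono) auto
      then have "\<bar>real n * Zexp n F t' (real j / real n) - real n * Zexp n F t (real j / real n)\<bar> \<le> \<alpha> * real n"
        by (simp add: abs_mult mult.commute flip: right_diff_distrib)
      ultimately show ?thesis by (simp add: algebra_simps)
    qed
    show ?thesis
      unfolding good_def
      using busy_periods_concentrated[OF n t M \<rho> \<epsilon> _ x conc] \<alpha> by auto
  qed
  have "measure_pmf.prob (Gtilde n t' F) {E. \<bar>real (C1 n E) / real n - \<rho>\<bar> > 2 * \<epsilon>}
      = measure_pmf.prob H {h. \<bar>real (C1 n (F \<union> {e \<in> Kpairs n. h e})) / real n - \<rho>\<bar> > 2 * \<epsilon>}"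
    by (simp add: Gtilde_bernoulli[OF t' n] H_def p_def vimage_def)
  also have "\<dots> \<le> measure_pmf.prob H {h. \<not> good (\<lambda>j. path n F (?nbH h) 0 ({}, {}) n ! j)}"
    using H_good by (intro measure_pmf.finite_measure_mono) (force simp: good_path)+
  also have "\<dots> = measure_pmf.prob (map_pmf (\<lambda>h. path n F (?nbH h) 0 ({}, {}) n) H) {xs. \<not> good ((!) xs)}"
    by (simp add: vimage_def)
  also have "\<dots> = measure_pmf.prob (map_pmf (\<lambda>\<omega>. path n F (?nbA \<omega>) 0 ({}, {}) n) \<Omega>) {xs. \<not> good ((!) xs)}"
    unfolding H_def \<Omega>_def by (subst path_graph_array_law) simp
  also have "\<dots> = measure_pmf.prob \<Omega> {\<omega>. \<not> good (walk n F (?nbA \<omega>) 0 ({}, {}))}"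
    by (simp add: vimage_def good_path)
  also have "\<dots> \<le> measure_pmf.prob \<Omega> (\<Union>j\<in>{..n}. bad j)"
    using A_good by (intro measure_pmf.finite_measure_mono) auto
  also have "\<dots> \<le> (\<Sum>j\<in>{..n}. measure_pmf.prob \<Omega> (bad j))"
    by (intro measure_pmf.finite_measure_subadditive_finite) auto
  also have "\<dots> \<le> (\<Sum>j\<in>{..n}. 2 * exp (- 2 * \<alpha>\<^sup>2 * real n / M))"
    using rung_set_concentration[OF n less_imp_le[OF t'] _ M \<alpha>(1)]
    by (intro sum_mono) (auto simp: bad_def \<Omega>_def p_def)
  also have "\<dots> = 2 * (real n + 1) * exp (- 2 * \<alpha>\<^sup>2 * real n / M)"
    by (simp add: algebra_simps)
  finally show ?thesis .
qed

section \<open>Random subsets that are uniform given their cardinality\<close>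

definition C1_deviates :: "nat \<Rightarrow> real \<Rightarrow> real \<Rightarrow> nat set set set" where
  "C1_deviates n \<rho> \<epsilon> = {E. \<bar>real (C1 n E) / real n - \<rho>\<bar> > \<epsilon>}"

text \<open>\<tau> is chosen before \<eta>, because \<open>Gnm_uniform\<close> applies the bound
  with \<eta> multiplied by a probability that depends on \<tau>.\<close>

lemma Gtilde_uniform:
  assumes t: "t > 0" and M: "M > 0" and \<epsilon>: "\<epsilon> > 0"
  shows "\<exists>\<tau>>0. \<tau> < t \<and> (\<forall>\<eta>>0. \<exists>N>0. \<forall>n\<ge>N. \<forall>F t' \<rho>. is_graph n F \<longrightarrow> s_pow 2 n F \<le> M \<longrightarrow>
    surv_prob n F t \<rho> \<longrightarrow> \<bar>t' - t\<bar> \<le> \<tau> \<longrightarrow>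
    measure_pmf.prob (Gtilde n t' F) (C1_deviates n \<rho> \<epsilon>) \<le> \<eta>)"
proof -
  \<comment> \<open>The concentration lemma loses a factor 2 in \<epsilon>, and 7 is a number above
    its 6.\<close>
  define \<alpha> where "\<alpha> = surv_curv M t / 2 * (\<epsilon> / 2)\<^sup>2 / 7"
  have c: "surv_curv M t / 2 * (\<epsilon> / 2)\<^sup>2 > 0" using surv_curv_pos[OF t] \<epsilon> by simp
  then have \<alpha>: "\<alpha> > 0" "6 * \<alpha> < surv_curv M t / 2 * (\<epsilon> / 2)\<^sup>2"
    unfolding \<alpha>_def by linarith+
  define \<tau> where "\<tau> = min (\<alpha> / M) (t / 2)"
  have \<tau>: "\<tau> > 0" "\<tau> < t" "\<tau> \<le> \<alpha> / M" using \<alpha> M t by (auto simp: \<tau>_def)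
  have "\<exists>N>0. \<forall>n\<ge>N. \<forall>F t' \<rho>. is_graph n F \<longrightarrow> s_pow 2 n F \<le> M \<longrightarrow>
      surv_prob n F t \<rho> \<longrightarrow> \<bar>t' - t\<bar> \<le> \<tau> \<longrightarrow>
      measure_pmf.prob (Gtilde n t' F) (C1_deviates n \<rho> \<epsilon>) \<le> \<eta>" if \<eta>: "\<eta> > 0" for \<eta>
  proof -
    define b where "b = 2 * \<alpha>\<^sup>2 / M"
    have b: "b > 0" using \<alpha> M by (simp add: b_def)
    have "(\<lambda>n. 2 * (real n + 1) * exp (- b * real n)) \<longlonglongrightarrow> 0" using b by real_asymp
    then have "eventually (\<lambda>n. 2 * (real n + 1) * exp (- b * real n) < \<eta>) sequentially"
      using \<eta> by (rule order_tendstoD)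
    then obtain N1 where N1: "\<And>n. n \<ge> N1 \<Longrightarrow> 2 * (real n + 1) * exp (- b * real n) < \<eta>"
      by (auto simp: eventually_sequentially)
    obtain N2 :: nat where N2: "M / \<alpha>\<^sup>2 \<le> real N2" using real_arch_simple by blast
    show ?thesis
    proof (intro exI[of _ "max 1 (max N1 N2)"] conjI allI impI)
      fix n F t' \<rho>
      assume n: "max 1 (max N1 N2) \<le> n" and F: "is_graph n F" "s_pow 2 n F \<le> M" "surv_prob n F t \<rho>"
        and t': "\<bar>t' - t\<bar> \<le> \<tau>"
      have "M / \<alpha>\<^sup>2 \<le> real n" using N2 n by linarith
      then have big: "M \<le> \<alpha>\<^sup>2 * real n" using \<alpha> by (simp add: field_simps)
      have "M * \<bar>t' - t\<bar> \<le> M * (\<alpha> / M)" using t' \<tau> M by (intro mult_left_mono) auto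
      then have tt: "M * \<bar>t' - t\<bar> \<le> \<alpha>" using M by simp
      have n0: "n > 0" and t'0: "t' > 0" and e2: "\<epsilon> / 2 > 0" using n t' \<tau> \<epsilon> by auto
      have "measure_pmf.prob (Gtilde n t' F) (C1_deviates n \<rho> \<epsilon>) \<le> 2 * (real n + 1) * exp (- 2 * \<alpha>\<^sup>2 * real n / M)"
        using Gtilde_C1_concentration[OF n0 t t'0 F e2 \<alpha> tt big] by (simp add: C1_deviates_def)
      also have "- 2 * \<alpha>\<^sup>2 * real n / M = - b * real n" by (simp add: b_def)
      also have "2 * (real n + 1) * exp (- b * real n) \<le> \<eta>" using N1[of n] n by simp
      finally show "measure_pmf.prob (Gtilde n t' F) (C1_deviates n \<rho> \<epsilon>) \<le> \<eta>" .
    qed auto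
  qed
  then show ?thesis using \<tau> by blast
qed

section \<open>Uniform subsets of fixed size and exchangeable laws\<close>

definition k_subsets :: "'a set \<Rightarrow> nat \<Rightarrow> 'a set set" where
  "k_subsets U j = {A. A \<subseteq> U \<and> card A = j}"

definition k_subset_prob :: "'a set \<Rightarrow> nat \<Rightarrow> ('a set \<Rightarrow> bool) \<Rightarrow> real" where
  "k_subset_prob U j Q = measure_pmf.prob (pmf_of_set (k_subsets U j)) {A. Q A}"

lemma finite_k_subsets: "finite U \<Longrightarrow> finite (k_subsets U j)"
  by (simp add: k_subsets_def)

lemma k_subsets_nonempty: "finite U \<Longrightarrow> j \<le> card U \<Longrightarrow> k_subsets U j \<noteq> {}"
  using obtain_subset_with_card_n[of j U] by (auto simp: k_subsets_def)

lemma card_k_subsets: "finite U \<Longrightarrow> card (k_subsets U j) = card U choose j"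
  by (simp add: k_subsets_def n_subsets)

lemma k_subset_prob_eq:
  assumes "finite U" "j \<le> card U"
  shows "k_subset_prob U j Q = real (card {A \<in> k_subsets U j. Q A}) / real (card U choose j)"
proof -
  have "k_subsets U j \<inter> {A. Q A} = {A \<in> k_subsets U j. Q A}" by auto
  then show ?thesis
    unfolding k_subset_prob_def
      measure_pmf_of_set[OF k_subsets_nonempty[OF assms] finite_k_subsets[OF assms(1)]]
    by (simp only: card_k_subsets[OF assms(1)])
qed

text \<open>Double counting of the pairs \<open>(A, x)\<close> with \<open>Q A\<close> and \<open>x \<notin> A\<close>.\<close>

lemma k_subset_prob_Suc:
  assumes U: "finite U" and j: "Suc j \<le> card U"
    and mono: "\<And>A B. A \<subseteq> B \<Longrightarrow> B \<subseteq> U \<Longrightarrow> Q A \<Longrightarrow> Q B"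
  shows "k_subset_prob U j Q \<le> k_subset_prob U (Suc j) Q"
proof -
  let ?X = "\<lambda>j. {A \<in> k_subsets U j. Q A}"
  let ?N = "card U"
  have finX: "finite (?X j)" for j using finite_k_subsets[OF U] by simp
  have "card (?X j) * (?N - j) = card (SIGMA A:?X j. U - A)"
  proof -
    have "card (U - A) = ?N - j" if "A \<in> ?X j" for A
      using that U by (auto simp: k_subsets_def card_Diff_subset finite_subset)
    then have "(\<Sum>A\<in>?X j. card (U - A)) = (\<Sum>A\<in>?X j. ?N - j)" by (intro sum.cong refl)
    then show ?thesis using U finX[of j] by (subst card_SigmaI) auto
  qed
  also have "\<dots> \<le> card (SIGMA B:?X (Suc j). B)"
  proof (rule card_inj_on_le[where f = "\<lambda>(A, x). (insert x A, x)"])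
    show "inj_on (\<lambda>(A, x). (insert x A, x)) (SIGMA A:?X j. U - A)"
      by (auto simp: inj_on_def dest: insert_ident)
    show "(\<lambda>(A, x). (insert x A, x)) ` (SIGMA A:?X j. U - A) \<subseteq> (SIGMA B:?X (Suc j). B)"
    proof safe
      fix A x assume A: "A \<in> k_subsets U j" "Q A" and x: "x \<in> U" "x \<notin> A"
      have "finite A" using A U finite_subset by (auto simp: k_subsets_def)
      then show "insert x A \<in> k_subsets U (Suc j)" using A x by (auto simp: k_subsets_def)
      show "Q (insert x A)" using mono[of A "insert x A"] A x by (auto simp: k_subsets_def)
    qed
    show "finite (SIGMA B:?X (Suc j). B)"
      using finX[of "Suc j"] by (rule finite_SigmaI) (use U in \<open>auto simp: k_subsets_def finite_subset\<close>)
  qed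
  also have "\<dots> = card (?X (Suc j)) * Suc j"
  proof -
    have "finite A" if "A \<in> ?X (Suc j)" for A using that U finite_subset by (auto simp: k_subsets_def)
    then have "card (SIGMA B:?X (Suc j). B) = (\<Sum>A\<in>?X (Suc j). card A)"
      using finX by (intro card_SigmaI) auto
    also have "\<dots> = (\<Sum>A\<in>?X (Suc j). Suc j)" by (intro sum.cong) (auto simp: k_subsets_def)
    finally show ?thesis by simp
  qed
  finally have 1: "card (?X j) * (?N - j) \<le> card (?X (Suc j)) * Suc j" .
  have 2: "(?N choose Suc j) * Suc j = (?N choose j) * (?N - j)"
    using binomial_absorb_comp[of ?N j] binomial_absorption[of j ?N] by (simp add: mult.commute)
  have "card (?X j) * (?N choose Suc j) * Suc j = card (?X j) * (?N - j) * (?N choose j)"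
    by (simp only: 2 mult.assoc) (simp only: mult_ac)
  also have "\<dots> \<le> card (?X (Suc j)) * Suc j * (?N choose j)"
    by (rule mult_right_mono[OF 1]) simp
  finally have "(card (?X j) * (?N choose Suc j)) * Suc j \<le> (card (?X (Suc j)) * (?N choose j)) * Suc j"
    by (simp only: mult_ac)
  then have "card (?X j) * (?N choose Suc j) \<le> card (?X (Suc j)) * (?N choose j)"
    by (simp only: mult_le_cancel2)
  then have "real (card (?X j)) * real (?N choose Suc j) \<le> real (card (?X (Suc j))) * real (?N choose j)"
    by (simp only: of_nat_mult[symmetric] of_nat_le_iff)
  moreover have "?N choose j > 0" "?N choose Suc j > 0" using j by (auto simp: zero_less_binomial_iff)
  ultimately show ?thesis
    using j U by (simp add: k_subset_prob_eq field_simps)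
qed

lemma k_subset_prob_mono:
  assumes U: "finite U" and ij: "i \<le> j" "j \<le> card U"
    and mono: "\<And>A B. A \<subseteq> B \<Longrightarrow> B \<subseteq> U \<Longrightarrow> Q A \<Longrightarrow> Q B"
  shows "k_subset_prob U i Q \<le> k_subset_prob U j Q"
  using ij
proof (induction j rule: dec_induct)
  case (step j)
  have "k_subset_prob U j Q \<le> k_subset_prob U (Suc j) Q"
    by (rule k_subset_prob_Suc[OF U]) (use step in simp, fact mono)
  then show ?case using step by simp
qed simp

text \<open>Uniformity given the cardinality, expressed by point masses so that no conditioning on
  null events occurs.\<close>

definition exchangeable :: "'a set \<Rightarrow> 'a set pmf \<Rightarrow> bool" where
  "exchangeable U q \<longleftrightarrow> set_pmf q \<subseteq> Pow U \<and>
     (\<forall>A B. A \<subseteq> U \<longrightarrow> B \<subseteq> U \<longrightarrow> card A = card B \<longrightarrow> pmf q A = pmf q B)"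

text \<open>Law of total probability over the cardinality: subsets of equal size have equal mass, so
  the conditional probability of \<open>Q\<close> is the proportion
  \<open>k_subset_prob\<close>.\<close>

lemma exchangeable_mixture:
  assumes U: "finite U" and q: "exchangeable U q"
  shows "measure_pmf.prob q {A. Q A}
    = (\<Sum>j\<le>card U. measure_pmf.prob q {A. card A = j} * k_subset_prob U j Q)"
proof -
  have supp: "set_pmf q \<subseteq> Pow U" using q by (simp add: exchangeable_def)
  have sum: "measure_pmf.prob q {A. R A} = (\<Sum>A\<in>{A \<in> Pow U. R A}. pmf q A)" for R
  proof -
    have "measure_pmf.prob q {A. R A} = measure_pmf.prob q {A \<in> Pow U. R A}"
      using supp by (intro measure_prob_cong_0) (auto simp: set_pmf_iff)
    then show ?thesis using U by (simp add: measure_measure_pmf_finite)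
  qed
  have "measure_pmf.prob q {A. card A = j \<and> Q A} = measure_pmf.prob q {A. card A = j} * k_subset_prob U j Q"
    if j: "j \<le> card U" for j
  proof -
    obtain A0 where A0: "A0 \<in> k_subsets U j" using k_subsets_nonempty[OF U j] by blast
    have c: "pmf q A = pmf q A0" if "A \<in> k_subsets U j" for A
      using that A0 q by (auto simp: exchangeable_def k_subsets_def)
    have "measure_pmf.prob q {A. card A = j \<and> Q A} = (\<Sum>A\<in>{A \<in> k_subsets U j. Q A}. pmf q A)"
      unfolding sum by (intro sum.cong) (auto simp: k_subsets_def)
    also have "\<dots> = real (card {A \<in> k_subsets U j. Q A}) * pmf q A0"
      using c by simp
    finally have 1: "measure_pmf.prob q {A. card A = j \<and> Q A} = real (card {A \<in> k_subsets U j. Q A}) * pmf q A0" .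
    have "measure_pmf.prob q {A. card A = j} = (\<Sum>A\<in>k_subsets U j. pmf q A)"
      unfolding sum by (intro sum.cong) (auto simp: k_subsets_def)
    also have "\<dots> = real (card (k_subsets U j)) * pmf q A0" using c by simp
    also have "card (k_subsets U j) = card U choose j" by (rule card_k_subsets[OF U])
    finally show ?thesis using 1 j by (simp add: k_subset_prob_eq[OF U j])
  qed
  moreover have "measure_pmf.prob q {A. Q A} = (\<Sum>j\<le>card U. measure_pmf.prob q {A. card A = j \<and> Q A})"
  proof -
    have "measure_pmf.prob q {A. Q A} = (\<Sum>A\<in>{A \<in> Pow U. Q A}. pmf q A)" by (rule sum)
    also have "\<dots> = (\<Sum>j\<le>card U. \<Sum>A\<in>{A \<in> {A \<in> Pow U. Q A}. card A = j}. pmf q A)"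
      using U by (intro sum.group[symmetric]) (auto intro: card_mono)
    also have "\<dots> = (\<Sum>j\<le>card U. measure_pmf.prob q {A. card A = j \<and> Q A})"
      unfolding sum by (intro sum.cong) auto
    finally show ?thesis .
  qed
  ultimately show ?thesis by simp
qed

lemma exchangeable_card_event:
  assumes U: "finite U" and q: "exchangeable U q"
  shows "measure_pmf.prob q {A. P (card A)} = (\<Sum>j\<le>card U. measure_pmf.prob q {A. card A = j} * of_bool (P j))"
proof -
  have "k_subset_prob U j (\<lambda>A. P (card A)) = of_bool (P j)" if "j \<le> card U" for j
  proof -
    have "{A \<in> k_subsets U j. P (card A)} = (if P j then k_subsets U j else {})"
      by (auto simp: k_subsets_def)
    then show ?thesis using that U
      by (simp add: k_subset_prob_eq card_k_subsets)
  qed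
  then have "(\<Sum>j\<le>card U. measure_pmf.prob q {A. card A = j} * k_subset_prob U j (\<lambda>A. P (card A)))
      = (\<Sum>j\<le>card U. measure_pmf.prob q {A. card A = j} * of_bool (P j))"
    by (intro sum.cong) auto
  with exchangeable_mixture[OF assms, of "\<lambda>A. P (card A)"] show ?thesis by (rule trans)
qed

text \<open>Used to bound \<open>c\<close> from above: if \<open>Q\<close> is unlikely in the
  mixture while the sizes in \<open>P\<close> have probability bounded below, then \<open>c\<close>
  is small.\<close>

lemma exchangeable_prob_ge:
  assumes U: "finite U" and q: "exchangeable U q"
    and *: "\<And>j. j \<le> card U \<Longrightarrow> P j \<Longrightarrow> c \<le> k_subset_prob U j Q"
  shows "measure_pmf.prob q {A. P (card A)} * c \<le> measure_pmf.prob q {A. Q A}"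
proof -
  let ?w = "\<lambda>j. measure_pmf.prob q {A. card A = j}"
  have "measure_pmf.prob q {A. P (card A)} * c = (\<Sum>j\<le>card U. ?w j * (of_bool (P j) * c))"
    by (subst exchangeable_card_event[OF U q]) (simp only: sum_distrib_right mult.assoc)
  also have "\<dots> \<le> (\<Sum>j\<le>card U. ?w j * k_subset_prob U j Q)"
    using * by (intro sum_mono mult_left_mono) (auto simp: k_subset_prob_def)
  also have "\<dots> = measure_pmf.prob q {A. Q A}" by (rule exchangeable_mixture[OF U q, symmetric])
  finally show ?thesis .
qed

text \<open>Carries a bound valid for all sizes in a window \<open>P\<close> over to the mixture, at
  the price of the probability of leaving the window.\<close>

lemma exchangeable_prob_le:
  assumes U: "finite U" and q: "exchangeable U q"
    and *: "\<And>j. j \<le> card U \<Longrightarrow> P j \<Longrightarrow> k_subset_prob U j Q \<le> c" and c: "c \<ge> 0"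
  shows "measure_pmf.prob q {A. Q A} \<le> c + measure_pmf.prob q {A. \<not> P (card A)}"
proof -
  let ?w = "\<lambda>j. measure_pmf.prob q {A. card A = j}"
  have "measure_pmf.prob q {A. Q A} = (\<Sum>j\<le>card U. ?w j * k_subset_prob U j Q)"
    by (rule exchangeable_mixture[OF U q])
  also have "\<dots> \<le> (\<Sum>j\<le>card U. ?w j * c + ?w j * of_bool (\<not> P j))"
  proof (intro sum_mono)
    fix j assume "j \<in> {..card U}"
    then show "?w j * k_subset_prob U j Q \<le> ?w j * c + ?w j * of_bool (\<not> P j)"
      using mult_left_mono[OF *[of j], of "?w j"] mult_left_le[of "k_subset_prob U j Q" "?w j"] c
      by (cases "P j") (auto simp: k_subset_prob_def add_increasing)
  qed
  also have "\<dots> = (\<Sum>j\<le>card U. ?w j * of_bool True) * c + (\<Sum>j\<le>card U. ?w j * of_bool (\<not> P j))"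
    by (simp add: sum.distrib sum_distrib_right)
  also have "(\<Sum>j\<le>card U. ?w j * of_bool True) = measure_pmf.prob q {A. True}"
    by (rule exchangeable_card_event[OF U q, of "\<lambda>_. True", symmetric])
  also have "(\<Sum>j\<le>card U. ?w j * of_bool (\<not> P j)) = measure_pmf.prob q {A. \<not> P (card A)}"
    by (rule exchangeable_card_event[OF U q, symmetric])
  finally show ?thesis by simp
qed

definition bernoulli_subset :: "'a set \<Rightarrow> real \<Rightarrow> 'a set pmf" where
  "bernoulli_subset U p = map_pmf (\<lambda>h. {e \<in> U. h e}) (Pi_pmf U False (\<lambda>_. bernoulli_pmf p))"

lemma exchangeable_bernoulli_subset:
  assumes U: "finite U" and p: "p \<in> {0..1}"
  shows "exchangeable U (bernoulli_subset U p)"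
proof -
  have "pmf (bernoulli_subset U p) A = p ^ card A * (1 - p) ^ (card U - card A)" if A: "A \<subseteq> U" for A
  proof -
    let ?q = "Pi_pmf U False (\<lambda>_. bernoulli_pmf p)"
    have "pmf (bernoulli_subset U p) A = measure_pmf.prob ?q ((\<lambda>h. {e \<in> U. h e}) -` {A})"
      by (simp add: bernoulli_subset_def pmf_map)
    also have "\<dots> = measure_pmf.prob ?q {\<lambda>e. e \<in> A}"
    proof (intro measure_prob_cong_0)
      fix h assume "h \<in> (\<lambda>h. {e \<in> U. h e}) -` {A} - {\<lambda>e. e \<in> A}"
      then have "h \<notin> {f. \<forall>x. x \<notin> U \<longrightarrow> f x = False}" using A by fastforce
      then show "pmf ?q h = 0" using set_Pi_pmf_subset[OF U, of False "\<lambda>_. bernoulli_pmf p"] by (meson set_pmf_iff subsetD)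
    qed (use A in auto)
    also have "\<dots> = pmf ?q (\<lambda>e. e \<in> A)" by (simp add: measure_pmf_single)
    also have "\<dots> = (\<Prod>x\<in>U. pmf (bernoulli_pmf p) (x \<in> A))"
      using A by (intro pmf_Pi'[OF U]) auto
    also have "\<dots> = (\<Prod>x\<in>U. if x \<in> A then p else 1 - p)" using p by (intro prod.cong) auto
    also have "\<dots> = p ^ card A * (1 - p) ^ card (U - A)"
      using U A by (simp add: prod.If_cases Int_absorb1 Diff_eq)
    finally show ?thesis using A U by (simp add: card_Diff_subset finite_subset)
  qed
  then show ?thesis by (auto simp: exchangeable_def bernoulli_subset_def)
qed

lemma card_bernoulli_subset:
  assumes "finite U" "p \<in> {0..1}"
  shows "measure_pmf.prob (bernoulli_subset U p) {A. P (card A)} = measure_pmf.prob (binomial_pmf (card U) p) {k. P k}"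
  unfolding binomial_pmf_altdef'[OF assms(1) refl assms(2), where dflt = False]
  by (simp add: bernoulli_subset_def vimage_def)

text \<open>Arrivals on pairs of \<open>F\<close> leave no trace, so the added edges may be taken
  from the non-edges of \<open>F\<close>, the ground set of \<open>Gnm\<close>.\<close>

lemma Gtilde_eq:
  assumes "t > 0" "n > 0" "is_graph n F"
  shows "Gtilde n t F = map_pmf (\<lambda>A. F \<union> A) (bernoulli_subset (Kpairs n - F) (edge_prob n t))"
proof -
  let ?b = "\<lambda>_. bernoulli_pmf (edge_prob n t)"
  have "Pi_pmf (Kpairs n - F) False ?b
      = map_pmf (\<lambda>f x. if x \<in> Kpairs n - F then f x else False) (Pi_pmf (Kpairs n) False ?b)"
    by (intro Pi_pmf_subset) auto
  moreover have "F \<union> {e \<in> Kpairs n - F. if e \<in> Kpairs n - F then h e else False} = F \<union> {e \<in> Kpairs n. h e}" for h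
    by auto
  ultimately show ?thesis
    by (simp add: Gtilde_bernoulli[OF assms(1,2)] bernoulli_subset_def pmf.map_comp o_def)
qed

lemma Gnm_eq: "Gnm n m F = map_pmf (\<lambda>A. F \<union> A) (pmf_of_set (k_subsets (Kpairs n - F) m))"
  by (simp add: Gnm_def k_subsets_def)

lemma C1_mono:
  assumes "E \<subseteq> E'"
  shows "C1 n E \<le> C1 n E'"
  unfolding C1_def
proof (rule Max.boundedI)
  fix a assume "a \<in> insert 0 (card ` comps n E)"
  then consider "a = 0" | v where "v \<in> {1..n}" "a = card (comp n E v)" by (auto simp: comps_def)
  then show "a \<le> Max (insert 0 (card ` comps n E'))"
  proof cases
    case 2
    have "card (comp n E v) \<le> card (comp n E' v)" using comp_mono[OF assms] by (intro card_mono) auto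
    also have "\<dots> \<le> Max (insert 0 (card ` comps n E'))"
      using 2 by (intro Max_ge) (auto simp: comps_def)
    finally show ?thesis using 2 by simp
  qed simp
qed auto

lemma card_Kpairs: "real (card (Kpairs n)) = real n * (real n - 1) / 2"
proof -
  have "Kpairs n = {e. e \<subseteq> {1..n} \<and> card e = 2}"
    unfolding card_2_iff Kpairs_def by blast
  then have "card (Kpairs n) = n choose 2" by (simp add: n_subsets)
  then show ?thesis by (simp add: choose_two real_of_nat_div of_nat_diff algebra_simps) 
qed

text \<open>Every edge lies inside a component, and one of size c contains at most c^2 pairs. So
  \<open>F\<close> has O(n) edges among order n^2 pairs.\<close>

lemma card_graph_le:
  assumes "is_graph n F" "n > 0"
  shows "real (card F) \<le> real n * s_pow 2 n F"
proof -
  have "F \<subseteq> (\<Union>C\<in>comps n F. (\<lambda>(a, b). {a, b}) ` (C \<times> C))"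
  proof
    fix e assume e: "e \<in> F"
    then obtain i j where ij: "e = {i, j}" "i \<in> {1..n}" "j \<in> {1..n}"
      using assms by (auto simp: is_graph_def Kpairs_def)
    have "j \<in> comp n F i" using e ij comp_step[OF comp_self[OF ij(2), of F]] by auto
    then show "e \<in> (\<Union>C\<in>comps n F. (\<lambda>(a, b). {a, b}) ` (C \<times> C))"
      using ij comp_self[OF ij(2), of F] by (auto simp: comps_def)
  qed
  then have "card F \<le> card (\<Union>C\<in>comps n F. (\<lambda>(a, b). {a, b}) ` (C \<times> C))"
    by (intro card_mono) (auto simp: finite_in_comps)
  also have "\<dots> \<le> (\<Sum>C\<in>comps n F. card ((\<lambda>(a, b). {a, b}) ` (C \<times> C)))"
    by (intro card_UN_le) auto
  also have "\<dots> \<le> (\<Sum>C\<in>comps n F. card C ^ 2)"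
  proof (intro sum_mono)
    fix C assume "C \<in> comps n F"
    then have "card ((\<lambda>(a, b). {a, b}) ` (C \<times> C)) \<le> card (C \<times> C)"
      by (intro card_image_le) (auto simp: finite_in_comps)
    then show "card ((\<lambda>(a, b). {a, b}) ` (C \<times> C)) \<le> card C ^ 2" by (simp add: power2_eq_square card_cartesian_product)
  qed
  finally have "real (card F) \<le> (\<Sum>C\<in>comps n F. real (card C) ^ 2)"
    by (metis (mono_tags, lifting) of_nat_le_iff of_nat_power of_nat_sum sum.cong)
  then show ?thesis using assms by (simp add: s_pow_def S_pow_def)
qed

section \<open>A fixed number of distinct edges\<close>

lemma edge_prob_le: "edge_prob n t \<le> t / real n"
  using exp_ge_add_one_self[of "- (t / real n)"] by (simp add: edge_prob_def)

lemma edge_prob_ge: "t \<ge> 0 \<Longrightarrow> t / real n - (t / real n)\<^sup>2 / 2 \<le> edge_prob n t"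
  using exp_minus_le_quadratic[of "t / real n"] by (simp add: edge_prob_def)

lemma card_non_edges:
  assumes F: "is_graph n F" and M: "s_pow 2 n F \<le> M" and n: "n > 0"
  shows "real n * (real n - 1 - 2 * M) / 2 \<le> real (card (Kpairs n - F))"
    and "real (card (Kpairs n - F)) \<le> (real n)\<^sup>2 / 2"
proof -
  have sub: "F \<subseteq> Kpairs n" using F by (simp add: is_graph_def)
  then have "finite F" by (rule finite_subset) simp
  then have c: "real (card (Kpairs n - F)) = real n * (real n - 1) / 2 - real (card F)"
    using sub card_mono[OF finite_Kpairs sub] by (simp add: card_Diff_subset of_nat_diff card_Kpairs)
  have "real (card F) \<le> real n * M"
    using card_graph_le[OF F n] mult_left_mono[OF M, of "real n"] by simp
  moreover have "real n * (real n - 1 - 2 * M) / 2 = real n * (real n - 1) / 2 - real n * M"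
    by (simp add: field_simps)
  ultimately show "real n * (real n - 1 - 2 * M) / 2 \<le> real (card (Kpairs n - F))"
    unfolding c by linarith
  show "real (card (Kpairs n - F)) \<le> (real n)\<^sup>2 / 2"
    unfolding c by (simp add: algebra_simps power2_eq_square)
qed

lemma bernoulli_subset_card_tails:
  assumes U: "finite U" "U \<noteq> {}" and p: "p \<in> {0..1}" and x: "x > 0" and N: "real (card U) \<le> b"
  shows "real m \<le> real (card U) * p - x \<Longrightarrow>
      1 - exp (- 2 * x\<^sup>2 / b) \<le> measure_pmf.prob (bernoulli_subset U p) {A. m \<le> card A}"
    and "real (card U) * p + x \<le> real m \<Longrightarrow>
      1 - exp (- 2 * x\<^sup>2 / b) \<le> measure_pmf.prob (bernoulli_subset U p) {A. card A \<le> m}"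
proof -
  interpret binomial_distribution "card U" p by unfold_locales (rule p)
  let ?B = "binomial_pmf (card U) p"
  have pos: "card U > 0" using U by (simp add: card_gt_0_iff)
  have ex: "exp (- 2 * x\<^sup>2 / real (card U)) \<le> exp (- 2 * x\<^sup>2 / b)"
    using N pos by (simp add: frac_le)
  {
    assume m: "real m \<le> real (card U) * p - x"
    have "measure_pmf.prob ?B (- {k. m \<le> k}) \<le> measure_pmf.prob ?B {k. real k \<le> real (card U) * p - x}"
      using m by (intro measure_pmf.finite_measure_mono) auto
    also have "\<dots> \<le> exp (- 2 * x\<^sup>2 / real (card U))" using prob_le[OF pos, of x] x by simp
    finally have "measure_pmf.prob ?B (- {k. m \<le> k}) \<le> exp (- 2 * x\<^sup>2 / b)" using ex by (rule order_trans)
    moreover have "measure_pmf.prob ?B (- {k. m \<le> k}) = 1 - measure_pmf.prob ?B {k. m \<le> k}"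
      using measure_pmf.prob_compl[of "{k. m \<le> k}" ?B] by (simp add: Compl_eq_Diff_UNIV)
    ultimately show "1 - exp (- 2 * x\<^sup>2 / b) \<le> measure_pmf.prob (bernoulli_subset U p) {A. m \<le> card A}"
      using card_bernoulli_subset[OF U(1) p, of "\<lambda>k. m \<le> k"] by simp
  }
  {
    assume m: "real (card U) * p + x \<le> real m"
    have "measure_pmf.prob ?B (- {k. k \<le> m}) \<le> measure_pmf.prob ?B {k. real k \<ge> real (card U) * p + x}"
      using m by (intro measure_pmf.finite_measure_mono) auto
    also have "\<dots> \<le> exp (- 2 * x\<^sup>2 / real (card U))" using prob_ge[OF pos, of x] x by simp
    finally have "measure_pmf.prob ?B (- {k. k \<le> m}) \<le> exp (- 2 * x\<^sup>2 / b)" using ex by (rule order_trans)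
    moreover have "measure_pmf.prob ?B (- {k. k \<le> m}) = 1 - measure_pmf.prob ?B {k. k \<le> m}"
      using measure_pmf.prob_compl[of "{k. k \<le> m}" ?B] by (simp add: Compl_eq_Diff_UNIV)
    ultimately show "1 - exp (- 2 * x\<^sup>2 / b) \<le> measure_pmf.prob (bernoulli_subset U p) {A. card A \<le> m}"
      using card_bernoulli_subset[OF U(1) p, of "\<lambda>k. k \<le> m"] by simp
  }
qed

lemma prob_Gtilde:
  assumes "t > 0" "n > 0" "is_graph n F"
  shows "measure_pmf.prob (Gtilde n t F) X
    = measure_pmf.prob (bernoulli_subset (Kpairs n - F) (edge_prob n t)) {A. F \<union> A \<in> X}"
  by (simp add: Gtilde_eq[OF assms] vimage_def)

lemma prob_Gnm: "measure_pmf.prob (Gnm n m F) X = k_subset_prob (Kpairs n - F) m (\<lambda>A. F \<union> A \<in> X)"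
  by (simp add: Gnm_eq k_subset_prob_def vimage_def)

text \<open>The events \<open>C1 / n > \<rho> + \<epsilon>\<close> and \<open>C1 / n < \<rho> - \<epsilon>\<close> are monotone, so they are controlled by
  the Bernoulli model at slightly larger, respectively smaller, time: there the number of edges
  exceeds, respectively stays below, \<open>m\<close> with probability bounded away from zero, which suffices.\<close>

lemma Gnm_uniform:
  assumes t: "t > 0" and M: "M > 0" and \<epsilon>: "\<epsilon> > 0"
  shows "\<exists>\<tau>>0. \<forall>\<eta>>0. \<exists>N>0. \<forall>n\<ge>N. \<forall>F m \<rho>. is_graph n F \<longrightarrow> s_pow 2 n F \<le> M \<longrightarrow>
    surv_prob n F t \<rho> \<longrightarrow> \<bar>real m - real n * t / 2\<bar> \<le> \<tau> * real n \<longrightarrow>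
    measure_pmf.prob (Gnm n m F) (C1_deviates n \<rho> \<epsilon>) \<le> \<eta>"
proof -
  obtain \<tau> where \<tau>: "\<tau> > 0" "\<tau> < t" and unif: "\<And>\<eta>. \<eta> > 0 \<Longrightarrow> \<exists>N>0. \<forall>n\<ge>N. \<forall>F t' \<rho>. is_graph n F \<longrightarrow> s_pow 2 n F \<le> M \<longrightarrow>
    surv_prob n F t \<rho> \<longrightarrow> \<bar>t' - t\<bar> \<le> \<tau> \<longrightarrow>
    measure_pmf.prob (Gtilde n t' F) (C1_deviates n \<rho> \<epsilon>) \<le> \<eta>"
    using Gtilde_uniform[OF t M \<epsilon>] by blast
  \<comment> \<open>With deviation x = n \<tau> / 4 and |U| \<le> n^2 / 2, Hoeffding's exponent
    becomes \<tau>^2 / 4, free of n. This gives a constant probability only, which is all that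
    monotonicity asks for.\<close>
  define \<pi> where "\<pi> = 1 - exp (- (\<tau>\<^sup>2 / 4))"
  have \<pi>: "\<pi> > 0" using \<tau> by (simp add: \<pi>_def)
  \<comment> \<open>Shifting time by \<tau> moves the mean number of edges by about n \<tau> / 2. Of
    this, n \<tau> / 8 covers the range of \<open>m\<close>, n \<tau> / 8 the lower-order terms, and
    n \<tau> / 4 remains as the deviation.\<close>
  have "\<exists>N>0. \<forall>n\<ge>N. \<forall>F m \<rho>. is_graph n F \<longrightarrow> s_pow 2 n F \<le> M \<longrightarrow>
      surv_prob n F t \<rho> \<longrightarrow> \<bar>real m - real n * t / 2\<bar> \<le> \<tau> / 8 * real n \<longrightarrow>
      measure_pmf.prob (Gnm n m F) (C1_deviates n \<rho> \<epsilon>) \<le> \<eta>" if \<eta>: "\<eta> > 0" for \<eta>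
  proof -
    define t1 where "t1 = t + \<tau>"
    define t0 where "t0 = t - \<tau>"
    have t01: "t1 > 0" "t0 > 0" "\<bar>t1 - t\<bar> \<le> \<tau>" "\<bar>t0 - t\<bar> \<le> \<tau>" using \<tau> t by (auto simp: t1_def t0_def)
    have "\<pi> * \<eta> / 2 > 0" using \<pi> \<eta> by simp
    from unif[OF this] obtain N1 where N1: "N1 > 0" and Gt: "\<And>n F t' \<rho>. n \<ge> N1 \<Longrightarrow> is_graph n F \<Longrightarrow> s_pow 2 n F \<le> M \<Longrightarrow>
      surv_prob n F t \<rho> \<Longrightarrow> \<bar>t' - t\<bar> \<le> \<tau> \<Longrightarrow>
      measure_pmf.prob (Gtilde n t' F) (C1_deviates n \<rho> \<epsilon>) \<le> \<pi> * \<eta> / 2" by blast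
    \<comment> \<open>Loss in the mean number of edges at time \<open>t1\<close>: the first summand
      comes from the lower bound on |U|, the second from the quadratic term of
      \<open>edge_prob\<close>.\<close>
    define K0 where "K0 = (1 + 2 * M) * t1 / 2 + t1\<^sup>2 / 4"
    obtain N2 :: nat where "K0 / (\<tau> / 8) \<le> real N2"
      using real_arch_simple by blast
    then have N2: "K0 \<le> real n * (\<tau> / 8)" if "n \<ge> N2" for n
      using \<tau> that by (smt (verit) divide_pos_pos of_nat_le_iff pos_divide_le_eq)
    obtain N3 :: nat where N3: "t1 \<le> real N3"
      using real_arch_simple by blast
    show ?thesis
    proof (intro exI[of _ "max N1 (max N2 N3)"] conjI[of "_ > 0"] allI impI)
      fix n F m \<rho>
      assume n: "max N1 (max N2 N3) \<le> n" and F: "is_graph n F" "s_pow 2 n F \<le> M" "surv_prob n F t \<rho>"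
        and m: "\<bar>real m - real n * t / 2\<bar> \<le> \<tau> / 8 * real n"
      define U where "U = Kpairs n - F"
      have n0: "n > 0" using n N1 by simp
      have finU: "finite U" by (simp add: U_def)
      note cU = card_non_edges[OF F(1,2) n0, folded U_def]
      have p: "edge_prob n t1 \<in> {0..1}" "edge_prob n t0 \<in> {0..1}" using t01 by (simp_all only: edge_prob_bounds less_imp_le)
      have x: "real n * \<tau> / 4 > 0" using n0 \<tau> by simp
      have mean1: "real m \<le> real (card U) * edge_prob n t1 - real n * \<tau> / 4"
      proof -
        have nn: "real n \<ge> t1" using N3 n by linarith
        have "real n * t1 / 2 - K0
            \<le> (real n * (real n - 1 - 2 * M) / 2) * (t1 / real n - (t1 / real n)\<^sup>2 / 2)"
        proof -
          have "(real n * (real n - 1 - 2 * M) / 2) * (t1 / real n - (t1 / real n)\<^sup>2 / 2)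
             = (real n - 1 - 2 * M) * t1 / 2 - (1 - (1 + 2 * M) / real n) * (t1\<^sup>2 / 4)"
            using n0 by (simp add: field_simps power2_eq_square)
          moreover have "(1 - (1 + 2 * M) / real n) * (t1\<^sup>2 / 4) \<le> 1 * (t1\<^sup>2 / 4)"
            using M by (intro mult_right_mono) auto
          moreover have "(real n - 1 - 2 * M) * t1 / 2 = real n * t1 / 2 - (1 + 2 * M) * t1 / 2"
            by (simp add: field_simps)
          ultimately show ?thesis unfolding K0_def by linarith
        qed
        also have "\<dots> \<le> real (card U) * edge_prob n t1"
        proof (rule mult_mono[OF cU(1) edge_prob_ge])
          have "0 \<le> u - u\<^sup>2 / 2" if "0 \<le> u" "u \<le> 1" for u :: real
            using mult_right_mono[of u 1 u] that by (simp add: power2_eq_square)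
          moreover have "0 \<le> t1 / real n" "t1 / real n \<le> 1" using nn n0 t01 by auto
          ultimately show "0 \<le> t1 / real n - (t1 / real n)\<^sup>2 / 2" by blast
        qed (use t01 in auto)
        finally have "real n * t1 / 2 - real n * (\<tau> / 8) \<le> real (card U) * edge_prob n t1"
          using N2[of n] n by linarith
        moreover have "real m \<le> real n * t / 2 + \<tau> / 8 * real n" using m by linarith
        moreover have "real n * t1 / 2 = real n * t / 2 + real n * \<tau> / 2" by (simp add: t1_def field_simps)
        moreover have "real n * (\<tau> / 8) = real n * \<tau> / 8" "\<tau> / 8 * real n = real n * \<tau> / 8" by auto
        ultimately show ?thesis by linarith
      qed
      have mean0: "real (card U) * edge_prob n t0 + real n * \<tau> / 4 \<le> real m"
      proof -
        have "real (card U) * edge_prob n t0 \<le> ((real n)\<^sup>2 / 2) * (t0 / real n)"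
          using p by (intro mult_mono cU edge_prob_le) auto
        also have "\<dots> = real n * t0 / 2" using n0 by (simp add: power2_eq_square)
        also have "\<dots> = real n * t / 2 - real n * \<tau> / 2" by (simp add: t0_def field_simps)
        finally have "real (card U) * edge_prob n t0 \<le> real n * t / 2 - real n * \<tau> / 2" .
        moreover have "real n * t / 2 - \<tau> / 8 * real n \<le> real m" using m by linarith
        moreover have "\<tau> / 8 * real n = real n * \<tau> / 8" by simp
        ultimately show ?thesis using x by linarith
      qed
      \<comment> \<open>The mean cannot exceed |U|, so \<open>m\<close> is an attainable size and
        there are \<open>m\<close>-subsets to choose from.\<close>
      have "real (card U) * edge_prob n t1 \<le> real (card U)" using p by (intro mult_left_le) auto
      then have "real m < real (card U)" using mean1 x by linarith
      then have mU: "m \<le> card U" and neU: "U \<noteq> {}" by auto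
      have e: "1 - exp (- 2 * (real n * \<tau> / 4)\<^sup>2 / ((real n)\<^sup>2 / 2)) = \<pi>"
        using n0 by (simp add: \<pi>_def field_simps power2_eq_square)
      note tails = bernoulli_subset_card_tails[OF finU neU _ x cU(2), unfolded e]
      define up where "up A \<longleftrightarrow> real (C1 n (F \<union> A)) / real n > \<rho> + \<epsilon>" for A
      define lo where "lo A \<longleftrightarrow> real (C1 n (F \<union> A)) / real n < \<rho> - \<epsilon>" for A
      have C1F: "real (C1 n (F \<union> A)) / real n \<le> real (C1 n (F \<union> B)) / real n" if "A \<subseteq> B" for A B
        using C1_mono[of "F \<union> A" "F \<union> B" n] that by (intro divide_right_mono) auto
      have up_mono: "up A \<Longrightarrow> up B" and lo_mono: "\<not> lo A \<Longrightarrow> \<not> lo B" if "A \<subseteq> B" for A B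
        using C1F[OF that] by (auto simp: up_def lo_def)
      have dev: "F \<union> A \<in> C1_deviates n \<rho> \<epsilon> \<longleftrightarrow> up A \<or> lo A" for A
        by (auto simp: C1_deviates_def up_def lo_def)
      have upb: "k_subset_prob U m up \<le> \<eta> / 2"
      proof -
        let ?q = "bernoulli_subset U (edge_prob n t1)"
        have "\<pi> * k_subset_prob U m up \<le> measure_pmf.prob ?q {A. m \<le> card A} * k_subset_prob U m up"
          using tails(1)[OF p(1) mean1] by (intro mult_right_mono) (auto simp: k_subset_prob_def)
        also have "\<dots> \<le> measure_pmf.prob ?q {A. up A}"
        proof (rule exchangeable_prob_ge[OF finU exchangeable_bernoulli_subset[OF finU p(1)]])
          show "k_subset_prob U m up \<le> k_subset_prob U j up" if "j \<le> card U" "m \<le> j" for j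
            using that up_mono by (intro k_subset_prob_mono[OF finU]) auto
        qed
        also have "\<dots> \<le> measure_pmf.prob (Gtilde n t1 F) (C1_deviates n \<rho> \<epsilon>)"
          unfolding prob_Gtilde[OF t01(1) n0 F(1)] U_def[symmetric] dev
          by (intro measure_pmf.finite_measure_mono) auto
        also have "\<dots> \<le> \<pi> * \<eta> / 2" using n t01 F by (intro Gt) auto
        finally show ?thesis using \<pi> by simp
      qed
      have lob: "k_subset_prob U m lo \<le> \<eta> / 2"
      proof -
        let ?q = "bernoulli_subset U (edge_prob n t0)"
        \<comment> \<open>\<open>lo\<close> is decreasing in the edge set, so monotonicity is
          applied to its complement.\<close>
        have compl: "k_subset_prob U j lo = 1 - k_subset_prob U j (\<lambda>A. \<not> lo A)" for j
          unfolding k_subset_prob_def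
          using measure_pmf.prob_compl[of "{A. \<not> lo A}" "pmf_of_set (k_subsets U j)"]
          by (simp add: set_diff_eq)
        have "\<pi> * k_subset_prob U m lo \<le> measure_pmf.prob ?q {A. card A \<le> m} * k_subset_prob U m lo"
          using tails(2)[OF p(2) mean0] by (intro mult_right_mono) (auto simp: k_subset_prob_def)
        also have "\<dots> \<le> measure_pmf.prob ?q {A. lo A}"
        proof (rule exchangeable_prob_ge[OF finU exchangeable_bernoulli_subset[OF finU p(2)]])
          show "k_subset_prob U m lo \<le> k_subset_prob U j lo" if "j \<le> card U" "j \<le> m" for j
          proof -
            have "k_subset_prob U j (\<lambda>A. \<not> lo A) \<le> k_subset_prob U m (\<lambda>A. \<not> lo A)"
              using that lo_mono mU by (intro k_subset_prob_mono[OF finU]) auto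
            then show ?thesis by (simp add: compl)
          qed
        qed
        also have "\<dots> \<le> measure_pmf.prob (Gtilde n t0 F) (C1_deviates n \<rho> \<epsilon>)"
          unfolding prob_Gtilde[OF t01(2) n0 F(1)] U_def[symmetric] dev
          by (intro measure_pmf.finite_measure_mono) auto
        also have "\<dots> \<le> \<pi> * \<eta> / 2" using n t01 F by (intro Gt) auto
        finally show ?thesis using \<pi> by simp
      qed
      have "measure_pmf.prob (Gnm n m F) (C1_deviates n \<rho> \<epsilon>) = k_subset_prob U m (\<lambda>A. up A \<or> lo A)"
        by (simp add: prob_Gnm U_def dev)
      also have "\<dots> \<le> k_subset_prob U m up + k_subset_prob U m lo"
        unfolding k_subset_prob_def Collect_disj_eq by (rule measure_Un_le) auto
      also have "\<dots> \<le> \<eta>" using upb lob by simp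
      finally show "measure_pmf.prob (Gnm n m F) (C1_deviates n \<rho> \<epsilon>) \<le> \<eta>" .
    qed (use N1 in auto)
  qed
  then show ?thesis using \<tau> by (intro exI[of _ "\<tau> / 8"]) auto
qed

section \<open>Edges drawn with replacement\<close>

text \<open>Pairs of \<open>F\<close> are dropped, which puts the law on the ground set of
  \<open>Gnm\<close>; repetitions and hits of \<open>F\<close> make the number of new edges
  random.\<close>

definition drawn_edges :: "nat \<Rightarrow> nat \<Rightarrow> nat set set \<Rightarrow> nat set set pmf" where
  "drawn_edges n m F = map_pmf (\<lambda>f. f ` {..<m} - F) (Pi_pmf {..<m} {} (\<lambda>_. pmf_of_set (Kpairs n)))"

lemma prob_Gstar:
  "measure_pmf.prob (Gstar n m F) X = measure_pmf.prob (drawn_edges n m F) {A. F \<union> A \<in> X}"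
  by (simp add: Gstar_def drawn_edges_def vimage_def)

text \<open>The bijection is one of the whole type, so that taking images commutes with set
  difference and is injective on sets.\<close>

lemma exists_bij_moving_subset:
  assumes U: "finite U" and AB: "A \<subseteq> U" "B \<subseteq> U" "card A = card B"
  shows "\<exists>\<pi>. bij \<pi> \<and> (\<forall>x. x \<notin> U \<longrightarrow> \<pi> x = x) \<and> \<pi> ` A = B \<and> \<pi> ` U = U"
proof -
  have fin: "finite A" "finite B" using U AB finite_subset by auto
  then obtain f where f: "bij_betw f A B" using AB(3) finite_same_card_bij[of A B] by auto
  have "card (U - A) = card (U - B)" using AB fin by (simp add: card_Diff_subset)
  then obtain g where g: "bij_betw g (U - A) (U - B)" using finite_same_card_bij[of "U - A" "U - B"] U by auto
  define \<pi> where "\<pi> x = (if x \<in> A then f x else if x \<in> U then g x else x)" for x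
  have 1: "bij_betw \<pi> A B" using f by (rule bij_betw_cong[THEN iffD1, rotated]) (simp add: \<pi>_def)
  have 2: "bij_betw \<pi> (U - A) (U - B)" using g by (rule bij_betw_cong[THEN iffD1, rotated]) (simp add: \<pi>_def)
  have 3: "bij_betw \<pi> (- U) (- U)"
    using bij_betw_id[of "- U"] by (rule bij_betw_cong[THEN iffD1, rotated]) (use AB in \<open>auto simp: \<pi>_def\<close>)
  have "bij_betw \<pi> (A \<union> (U - A)) (B \<union> (U - B))" by (rule bij_betw_combine[OF 1 2]) auto
  then have 4: "bij_betw \<pi> U U" using AB by (simp add: Un_absorb1)
  have "bij_betw \<pi> (U \<union> - U) (U \<union> - U)" by (rule bij_betw_combine[OF 4 3]) auto
  then have "bij \<pi>" by simp
  moreover have "\<pi> ` A = B" "\<pi> ` U = U" using 1 4 by (auto simp: bij_betw_def)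
  moreover have "\<forall>x. x \<notin> U \<longrightarrow> \<pi> x = x" using AB by (auto simp: \<pi>_def)
  ultimately show ?thesis by blast
qed

text \<open>A permutation of the non-edges that fixes every pair of \<open>F\<close> preserves the
  uniform draws, and one such permutation takes \<open>A\<close> to \<open>B\<close>.\<close>

lemma exchangeable_drawn_edges:
  assumes F: "is_graph n F" and K: "Kpairs n \<noteq> {}"
  shows "exchangeable (Kpairs n - F) (drawn_edges n m F)"
proof -
  let ?U = "Kpairs n - F" and ?q = "Pi_pmf {..<m} {} (\<lambda>_. pmf_of_set (Kpairs n))"
  have "set_pmf (drawn_edges n m F) \<subseteq> Pow ?U"
    using K by (auto simp: drawn_edges_def set_Pi_pmf PiE_dflt_def)
  moreover have "pmf (drawn_edges n m F) A = pmf (drawn_edges n m F) B"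
    if AB: "A \<subseteq> ?U" "B \<subseteq> ?U" "card A = card B" for A B
  proof -
    obtain \<pi> where \<pi>: "bij \<pi>" "\<And>x. x \<notin> ?U \<Longrightarrow> \<pi> x = x" "\<pi> ` A = B" "\<pi> ` ?U = ?U"
      using exists_bij_moving_subset[OF _ AB] by auto
    have inj: "inj \<pi>" using \<pi>(1) by (rule bij_is_inj)
    have F_fix: "\<pi> ` F = F" using \<pi>(2) by force
    have "Kpairs n = ?U \<union> F" using F by (auto simp: is_graph_def)
    moreover have "\<pi> ` (?U \<union> F) = ?U \<union> F" by (simp only: image_Un \<pi>(4) F_fix)
    ultimately have "\<pi> ` Kpairs n = Kpairs n" by simp
    then have "bij_betw \<pi> (Kpairs n) (Kpairs n)" using inj by (auto simp: bij_betw_def inj_on_def inj_def)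
    then have uni: "map_pmf \<pi> (pmf_of_set (Kpairs n)) = pmf_of_set (Kpairs n)"
      using K by (intro map_pmf_of_set_bij_betw) auto
    \<comment> \<open>The default value \<open>{}\<close> of \<open>Pi_pmf\<close> is not a pair,
      hence is fixed by \<pi>, and \<pi> can be applied draw by draw.\<close>
    have "{} \<notin> Kpairs n" by (auto simp: Kpairs_def)
    then have "\<pi> {} = {}" using \<pi>(2) by auto
    then have "Pi_pmf {..<m} {} (\<lambda>_. map_pmf \<pi> (pmf_of_set (Kpairs n))) = map_pmf (\<lambda>h. \<pi> \<circ> h) ?q"
      by (intro Pi_pmf_map) auto
    then have q: "?q = map_pmf (\<lambda>h. \<pi> \<circ> h) ?q" by (simp only: uni)
    have "drawn_edges n m F = map_pmf (\<lambda>f. f ` {..<m} - F) (map_pmf (\<lambda>h. \<pi> \<circ> h) ?q)"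
      unfolding drawn_edges_def using q by simp
    also have "\<dots> = map_pmf (image \<pi>) (drawn_edges n m F)"
      by (simp add: drawn_edges_def pmf.map_comp o_def image_set_diff[OF inj] F_fix image_image)
    finally have "pmf (drawn_edges n m F) (\<pi> ` A) = pmf (map_pmf (image \<pi>) (drawn_edges n m F)) (\<pi> ` A)" by simp
    also have "\<dots> = pmf (drawn_edges n m F) A"
      by (rule pmf_map_inj') (rule injI, simp add: inj inj_image_eq_iff)
    finally show ?thesis using \<pi>(3) by simp
  qed
  ultimately show ?thesis unfolding exchangeable_def by blast
qed

text \<open>Markov's inequality for the shortfall of new edges below \<open>m\<close>. Its mean is
  at most m |F| / k, for draws landing in \<open>F\<close>, plus m^2 / (2 k), for
  repetitions.\<close>

lemma drawn_edges_card_deficit: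
  assumes F: "is_graph n F" and K: "Kpairs n \<noteq> {}" and x: "x > 0"
  defines "k \<equiv> real (card (Kpairs n))"
  shows "measure_pmf.prob (drawn_edges n m F) {A. x \<le> real m - real (card A)} * x
    \<le> real m * real (card F) / k + (real m)\<^sup>2 / (2 * k)"
proof -
  let ?q = "Pi_pmf {..<m} {} (\<lambda>_. pmf_of_set (Kpairs n))"
  let ?U = "Kpairs n - F"
  define X where "X = {f. x \<le> real m - real (card (f ` {..<m} - F))}"
  define H where "H e = {f :: nat \<Rightarrow> nat set. e \<in> f ` {..<m}}" for e
  have k: "k > 0" using K by (simp add: k_def card_gt_0_iff)
  have int: "integrable (measure_pmf ?q) (indicat_real Y)" for Y
    by (intro measure_pmf.integrable_const_bound[where B = 1]) auto
  have hit: "measure_pmf.prob ?q (H e) = 1 - (1 - 1 / k) ^ m" if e: "e \<in> Kpairs n" for e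
  proof -
    have "measure_pmf.prob ?q (- H e) = measure_pmf.prob ?q (PiE_dflt {..<m} {} (\<lambda>_. - {e}))"
    proof (rule measure_prob_cong_0)
      fix f assume "f \<in> - H e - PiE_dflt {..<m} {} (\<lambda>_. - {e})"
      then have "f \<notin> {f. \<forall>x. x \<notin> {..<m} \<longrightarrow> f x = {}}" by (auto simp: H_def PiE_dflt_def)
      then show "pmf ?q f = 0"
        using set_Pi_pmf_subset[of "{..<m}" "{}" "\<lambda>_. pmf_of_set (Kpairs n)"] by (meson finite_lessThan set_pmf_iff subsetD)
    qed (auto simp: H_def PiE_dflt_def)
    also have "\<dots> = (\<Prod>i\<in>{..<m}. measure_pmf.prob (pmf_of_set (Kpairs n)) (- {e}))"
      by (rule measure_Pi_pmf_PiE_dflt) simp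
    also have "measure_pmf.prob (pmf_of_set (Kpairs n)) (- {e}) = 1 - 1 / k"
    proof -
      have "Kpairs n \<inter> - {e} = Kpairs n - {e}" by auto
      then have "measure_pmf.prob (pmf_of_set (Kpairs n)) (- {e}) = (k - 1) / k"
        using K e k by (simp add: measure_pmf_of_set k_def of_nat_diff Suc_le_eq card_gt_0_iff)
      then show ?thesis using k by (simp add: diff_divide_distrib)
    qed
    finally have "measure_pmf.prob ?q (- H e) = (1 - 1 / k) ^ m" by simp
    then show ?thesis using measure_pmf.prob_compl[of "H e" ?q] by (simp add: Compl_eq_Diff_UNIV)
  qed
  have "measure_pmf.prob (drawn_edges n m F) {A. x \<le> real m - real (card A)} * x = measure_pmf.prob ?q X * x"
    by (simp add: drawn_edges_def X_def vimage_def)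
  also have "\<dots> = measure_pmf.expectation ?q (\<lambda>f. indicat_real X f * x)" by simp
  also have "\<dots> \<le> measure_pmf.expectation ?q (\<lambda>f. real m - (\<Sum>e\<in>?U. indicat_real (H e) f))"
  proof (rule integral_mono)
    fix f
    have "(\<Sum>e\<in>?U. indicat_real (H e) f) = real (card {e \<in> ?U. f \<in> H e})"
      by (simp add: indicator_def sum.If_cases Int_def)
    also have "\<dots> \<le> real (card (f ` {..<m} - F))"
      by (intro of_nat_mono card_mono) (auto simp: H_def)
    finally have *: "(\<Sum>e\<in>?U. indicat_real (H e) f) \<le> real (card (f ` {..<m} - F))" .
    have "card (f ` {..<m} - F) \<le> card (f ` {..<m})" by (intro card_mono) auto
    also have "\<dots> \<le> m" using card_image_le[of "{..<m}" f] by simp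
    finally show "indicat_real X f * x \<le> real m - (\<Sum>e\<in>?U. indicat_real (H e) f)"
      using * by (auto simp: X_def indicator_def)
  qed (auto intro!: int Bochner_Integration.integrable_diff Bochner_Integration.integrable_sum)
  also have "\<dots> = real m - (\<Sum>e\<in>?U. measure_pmf.prob ?q (H e))"
    using int by (simp add: Bochner_Integration.integral_diff Bochner_Integration.integral_sum)
  also have "\<dots> = real m - real (card ?U) * (1 - (1 - 1 / k) ^ m)" using hit by simp
  also have "\<dots> \<le> real m - real (card ?U) * (real m / k - (real m / k)\<^sup>2 / 2)"
  proof -
    have "1 \<le> k" using k unfolding k_def by simp
    then have "(1 - 1 / k) ^ m \<le> exp (- (1 / k)) ^ m"
      using exp_ge_add_one_self[of "- (1 / k)"] by (intro power_mono) auto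
    also have "\<dots> = exp (- (real m / k))" by (simp add: exp_of_nat_mult[symmetric])
    also have "\<dots> \<le> 1 - real m / k + (real m / k)\<^sup>2 / 2" using k by (intro exp_minus_le_quadratic) auto
    finally have "real m / k - (real m / k)\<^sup>2 / 2 \<le> 1 - (1 - 1 / k) ^ m" by linarith
    then have "real (card ?U) * (real m / k - (real m / k)\<^sup>2 / 2) \<le> real (card ?U) * (1 - (1 - 1 / k) ^ m)"
      by (intro mult_left_mono) auto
    then show ?thesis by linarith
  qed
  also have "\<dots> = real m * real (card F) / k + real (card ?U) / k * ((real m)\<^sup>2 / (2 * k))"
  proof -
    have sub: "F \<subseteq> Kpairs n" using F by (simp add: is_graph_def)
    have "finite F" by (rule finite_subset[OF sub]) simp
    then have "real (card F) = k - real (card ?U)"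
      using sub card_mono[OF finite_Kpairs sub] by (simp add: card_Diff_subset of_nat_diff k_def)
    moreover have "real m - u * (real m / k - (real m / k)\<^sup>2 / 2)
        = real m * (k - u) / k + u / k * ((real m)\<^sup>2 / (2 * k))" for u
      using k by (simp add: field_simps power2_eq_square)
    ultimately show ?thesis by simp
  qed
  also have "\<dots> \<le> real m * real (card F) / k + 1 * ((real m)\<^sup>2 / (2 * k))"
  proof -
    have "real (card ?U) \<le> k" unfolding k_def by (intro of_nat_mono card_mono) auto
    then have "real (card ?U) / k \<le> 1" using k by simp
    then show ?thesis using k by (intro add_left_mono mult_right_mono) auto
  qed
  finally show ?thesis by simp
qed

text \<open>The one property of the three models on which the theorem rests. \<open>N\<close> does
  not depend on the graph, so graph sequences along a subsequence and hypotheses varying with n are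
  covered.\<close>

definition C1_concentrates :: "real \<Rightarrow> (nat \<Rightarrow> nat set set \<Rightarrow> nat set set pmf) \<Rightarrow> bool" where
  "C1_concentrates t G \<longleftrightarrow> (\<forall>M>0. \<forall>\<epsilon>>0. \<forall>\<eta>>0. \<exists>N>0. \<forall>n\<ge>N. \<forall>F \<rho>. is_graph n F \<longrightarrow>
     s_pow 2 n F \<le> M \<longrightarrow> surv_prob n F t \<rho> \<longrightarrow>
     measure_pmf.prob (G n F) (C1_deviates n \<rho> \<epsilon>) \<le> \<eta>)"

lemma C1_concentrates_Gtilde:
  assumes "t > 0"
  shows "C1_concentrates t (\<lambda>n F. Gtilde n t F)"
  unfolding C1_concentrates_def
proof (intro allI impI)
  fix M \<epsilon> \<eta> :: real assume M: "M > 0" and \<epsilon>: "\<epsilon> > 0" and \<eta>: "\<eta> > 0"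
  obtain \<tau> where \<tau>: "\<tau> > 0" "\<forall>\<eta>>0. \<exists>N>0. \<forall>n\<ge>N. \<forall>F t' \<rho>. is_graph n F \<longrightarrow> s_pow 2 n F \<le> M \<longrightarrow>
    surv_prob n F t \<rho> \<longrightarrow> \<bar>t' - t\<bar> \<le> \<tau> \<longrightarrow>
    measure_pmf.prob (Gtilde n t' F) (C1_deviates n \<rho> \<epsilon>) \<le> \<eta>"
    using Gtilde_uniform[OF assms M \<epsilon>] by blast
  obtain N where "\<tau> > 0" "N > 0" "\<forall>n\<ge>N. \<forall>F t' \<rho>. is_graph n F \<longrightarrow> s_pow 2 n F \<le> M \<longrightarrow>
    surv_prob n F t \<rho> \<longrightarrow> \<bar>t' - t\<bar> \<le> \<tau> \<longrightarrow>
    measure_pmf.prob (Gtilde n t' F) (C1_deviates n \<rho> \<epsilon>) \<le> \<eta>"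
    using \<tau>(1) \<tau>(2)[rule_format, OF \<eta>] by blast
  then show "\<exists>N>0. \<forall>n\<ge>N. \<forall>F \<rho>. is_graph n F \<longrightarrow> s_pow 2 n F \<le> M \<longrightarrow> surv_prob n F t \<rho> \<longrightarrow>
     measure_pmf.prob (Gtilde n t F) (C1_deviates n \<rho> \<epsilon>) \<le> \<eta>"
    by (intro exI[of _ N]) auto
qed

lemma floor_half_close:
  assumes "t > 0"
  shows "\<bar>real (nat \<lfloor>real n * t / 2\<rfloor>) - real n * t / 2\<bar> \<le> 1"
    and "real (nat \<lfloor>real n * t / 2\<rfloor>) \<le> real n * t / 2"
proof -
  have "0 \<le> real n * t / 2" using assms by simp
  then show "real (nat \<lfloor>real n * t / 2\<rfloor>) \<le> real n * t / 2"
    and "\<bar>real (nat \<lfloor>real n * t / 2\<rfloor>) - real n * t / 2\<bar> \<le> 1"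
    by linarith+
qed

lemma C1_concentrates_Gnm:
  assumes t: "t > 0"
  shows "C1_concentrates t (\<lambda>n F. Gnm n (nat \<lfloor>real n * t / 2\<rfloor>) F)"
  unfolding C1_concentrates_def
proof (intro allI impI)
  fix M \<epsilon> \<eta> :: real assume M: "M > 0" and \<epsilon>: "\<epsilon> > 0" and \<eta>: "\<eta> > 0"
  obtain \<tau> where \<tau>: "\<tau> > 0" "\<forall>\<eta>>0. \<exists>N>0. \<forall>n\<ge>N. \<forall>F m \<rho>. is_graph n F \<longrightarrow> s_pow 2 n F \<le> M \<longrightarrow>
    surv_prob n F t \<rho> \<longrightarrow> \<bar>real m - real n * t / 2\<bar> \<le> \<tau> * real n \<longrightarrow>
    measure_pmf.prob (Gnm n m F) (C1_deviates n \<rho> \<epsilon>) \<le> \<eta>"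
    using Gnm_uniform[OF t M \<epsilon>] by blast
  obtain N where N: "\<tau> > 0" "N > 0" "\<forall>n\<ge>N. \<forall>F m \<rho>. is_graph n F \<longrightarrow> s_pow 2 n F \<le> M \<longrightarrow>
    surv_prob n F t \<rho> \<longrightarrow> \<bar>real m - real n * t / 2\<bar> \<le> \<tau> * real n \<longrightarrow>
    measure_pmf.prob (Gnm n m F) (C1_deviates n \<rho> \<epsilon>) \<le> \<eta>"
    using \<tau>(1) \<tau>(2)[rule_format, OF \<eta>] by blast
  obtain N' :: nat where N': "1 / \<tau> \<le> real N'" using real_arch_simple by blast
  show "\<exists>N>0. \<forall>n\<ge>N. \<forall>F \<rho>. is_graph n F \<longrightarrow> s_pow 2 n F \<le> M \<longrightarrow> surv_prob n F t \<rho> \<longrightarrow>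
     measure_pmf.prob (Gnm n (nat \<lfloor>real n * t / 2\<rfloor>) F) (C1_deviates n \<rho> \<epsilon>) \<le> \<eta>"
  proof (intro exI[of _ "max N N'"] conjI allI impI)
    fix n F \<rho> assume n: "max N N' \<le> n" and F: "is_graph n F" "s_pow 2 n F \<le> M" "surv_prob n F t \<rho>"
    have "1 / \<tau> \<le> real n" using N' n by linarith
    then have "1 \<le> \<tau> * real n" using N(1) by (simp add: field_simps)
    then have "\<bar>real (nat \<lfloor>real n * t / 2\<rfloor>) - real n * t / 2\<bar> \<le> \<tau> * real n"
      using floor_half_close(1)[OF t, of n] by linarith
    then show "measure_pmf.prob (Gnm n (nat \<lfloor>real n * t / 2\<rfloor>) F) (C1_deviates n \<rho> \<epsilon>) \<le> \<eta>"
      using N(3) n F by auto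
  qed (use N in auto)
qed

lemma C1_concentrates_Gstar:
  assumes t: "t > 0"
  shows "C1_concentrates t (\<lambda>n F. Gstar n (nat \<lfloor>real n * t / 2\<rfloor>) F)"
  unfolding C1_concentrates_def
proof (intro allI impI)
  fix M \<epsilon> \<eta> :: real assume M: "M > 0" and \<epsilon>: "\<epsilon> > 0" and \<eta>: "\<eta> > 0"
  then have \<eta>2: "\<eta> / 2 > 0" by simp
  obtain \<tau> where \<tau>: "\<tau> > 0" "\<forall>\<eta>>0. \<exists>N>0. \<forall>n\<ge>N. \<forall>F m \<rho>. is_graph n F \<longrightarrow> s_pow 2 n F \<le> M \<longrightarrow>
    surv_prob n F t \<rho> \<longrightarrow> \<bar>real m - real n * t / 2\<bar> \<le> \<tau> * real n \<longrightarrow>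
    measure_pmf.prob (Gnm n m F) (C1_deviates n \<rho> \<epsilon>) \<le> \<eta>"
    using Gnm_uniform[OF t M \<epsilon>] by blast
  obtain N where N: "\<tau> > 0" "N > 0" "\<forall>n\<ge>N. \<forall>F m \<rho>. is_graph n F \<longrightarrow> s_pow 2 n F \<le> M \<longrightarrow>
    surv_prob n F t \<rho> \<longrightarrow> \<bar>real m - real n * t / 2\<bar> \<le> \<tau> * real n \<longrightarrow>
    measure_pmf.prob (Gnm n m F) (C1_deviates n \<rho> \<epsilon>) \<le> \<eta> / 2"
    using \<tau>(1) \<tau>(2)[rule_format, OF \<eta>2] by blast
  \<comment> \<open>Bounds the mean shortfall: 2 t M for draws landing in \<open>F\<close> and t^2 /
    2 for repetitions, using m \<le> n t / 2, |F| \<le> n M and k \<ge> n^2 / 4.\<close>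
  define D where "D = 2 * t * M + t\<^sup>2 / 2"
  \<comment> \<open>By the first bound the rounding of n t / 2 costs at most \<tau> n / 2, which
    leaves a shortfall of \<tau> n / 2 to exclude; by the second its probability D / (\<tau> n / 2)
    is at most \<eta> / 2.\<close>
  obtain N' :: nat where N': "max (2 / \<tau>) (4 * D / (\<tau> * \<eta>)) \<le> real N'" using real_arch_simple by blast
  show "\<exists>N>0. \<forall>n\<ge>N. \<forall>F \<rho>. is_graph n F \<longrightarrow> s_pow 2 n F \<le> M \<longrightarrow> surv_prob n F t \<rho> \<longrightarrow>
     measure_pmf.prob (Gstar n (nat \<lfloor>real n * t / 2\<rfloor>) F) (C1_deviates n \<rho> \<epsilon>) \<le> \<eta>"
  proof (intro exI[of _ "max 2 (max N N')"] conjI allI impI)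
    fix n F \<rho> assume n: "max 2 (max N N') \<le> n" and F: "is_graph n F" "s_pow 2 n F \<le> M" "surv_prob n F t \<rho>"
    define m where "m = nat \<lfloor>real n * t / 2\<rfloor>"
    define U where "U = Kpairs n - F"
    define k where "k = real (card (Kpairs n))"
    define P where "P j \<longleftrightarrow> \<bar>real j - real n * t / 2\<bar> \<le> \<tau> * real n" for j
    have n2: "real n \<ge> 2" "n > 0" using n by auto
    have nN': "real N' \<le> real n" using n by simp
    have "2 / \<tau> \<le> real n" "4 * D / (\<tau> * \<eta>) \<le> real n" using N' nN' by linarith+
    then have nb: "2 \<le> \<tau> * real n" "4 * D \<le> \<tau> * \<eta> * real n" using N(1) \<eta> by (simp_all add: field_simps)
    have kn: "k \<ge> (real n)\<^sup>2 / 4"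
    proof -
      have "real n * 1 \<le> real n * (real n - 1)" using n2 by (intro mult_left_mono) auto
      then show ?thesis by (simp add: k_def card_Kpairs power2_eq_square algebra_simps)
    qed
    then have kpos: "k > 0" using n2 by (smt (verit) divide_pos_pos zero_less_power)
    then have K: "Kpairs n \<noteq> {}" by (auto simp: k_def)
    have exch: "exchangeable U (drawn_edges n m F)" unfolding U_def by (rule exchangeable_drawn_edges[OF F(1) K])
    have finU: "finite U" by (simp add: U_def)
    have mle: "real m \<le> real n * t / 2" "\<bar>real m - real n * t / 2\<bar> \<le> 1"
      using floor_half_close[OF t, of n] by (auto simp: m_def)
    have "measure_pmf.prob (Gstar n m F) (C1_deviates n \<rho> \<epsilon>)
        = measure_pmf.prob (drawn_edges n m F) {A. F \<union> A \<in> C1_deviates n \<rho> \<epsilon>}"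
      by (rule prob_Gstar)
    also have "\<dots> \<le> \<eta> / 2 + measure_pmf.prob (drawn_edges n m F) {A. \<not> P (card A)}"
    proof (rule exchangeable_prob_le[OF finU exch])
      fix j assume "P j"
      then have "measure_pmf.prob (Gnm n j F) (C1_deviates n \<rho> \<epsilon>) \<le> \<eta> / 2"
        using N(3) n F by (auto simp: P_def)
      then show "k_subset_prob U j (\<lambda>A. F \<union> A \<in> C1_deviates n \<rho> \<epsilon>) \<le> \<eta> / 2"
        by (simp add: prob_Gnm U_def)
    qed (use \<eta> in simp)
    also have "measure_pmf.prob (drawn_edges n m F) {A. \<not> P (card A)}
        \<le> measure_pmf.prob (drawn_edges n m F) {A. \<tau> * real n / 2 \<le> real m - real (card A)}"
    proof -
      have "card A \<le> m" if A: "A \<in> set_pmf (drawn_edges n m F)" for A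
      proof -
        obtain f where "A = f ` {..<m} - F" using A by (auto simp: drawn_edges_def)
        then have "card A \<le> card (f ` {..<m})" by (intro card_mono) auto
        then show ?thesis using card_image_le[of "{..<m}" f] by simp
      qed
      then have "measure_pmf.prob (drawn_edges n m F) {A. \<not> P (card A)}
        = measure_pmf.prob (drawn_edges n m F) {A. card A \<le> m \<and> \<not> P (card A)}"
        by (intro measure_prob_cong_0) (auto simp: set_pmf_iff)
      also have "\<dots> \<le> measure_pmf.prob (drawn_edges n m F) {A. \<tau> * real n / 2 \<le> real m - real (card A)}"
      proof (intro measure_pmf.finite_measure_mono subsetI CollectI)
        fix A assume "A \<in> {A. card A \<le> m \<and> \<not> P (card A)}"
        then have "real (card A) \<le> real m" "\<bar>real (card A) - real n * t / 2\<bar> > \<tau> * real n"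
          by (auto simp: P_def)
        then show "\<tau> * real n / 2 \<le> real m - real (card A)" using mle nb by linarith
      qed auto
      finally show ?thesis .
    qed
    also have "\<dots> \<le> \<eta> / 2"
    proof -
      let ?p = "measure_pmf.prob (drawn_edges n m F) {A. \<tau> * real n / 2 \<le> real m - real (card A)}"
      have x: "\<tau> * real n / 2 > 0" using N(1) n2 by simp
      have "?p * (\<tau> * real n / 2) \<le> real m * real (card F) / k + (real m)\<^sup>2 / (2 * k)"
        unfolding k_def by (rule drawn_edges_card_deficit[OF F(1) K x])
      also have "\<dots> \<le> D"
      proof -
        have cF: "real (card F) \<le> real n * M"
          using card_graph_le[OF F(1) n2(2)] mult_left_mono[OF F(2), of "real n"] by simp
        have "real m * real (card F) \<le> (real n * t / 2) * (real n * M)"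
          using mle cF t by (intro mult_mono) auto
        also have "\<dots> = (2 * t * M) * ((real n)\<^sup>2 / 4)" by (simp add: power2_eq_square)
        also have "\<dots> \<le> (2 * t * M) * k" using kn t M by (intro mult_left_mono) auto
        finally have a: "real m * real (card F) / k \<le> 2 * t * M" using kpos by (simp add: pos_divide_le_eq)
        have "(real m)\<^sup>2 \<le> (real n * t / 2)\<^sup>2" using mle by (intro power_mono) auto
        also have "\<dots> = t\<^sup>2 / 2 * (2 * ((real n)\<^sup>2 / 4))" by (simp add: power2_eq_square)
        also have "\<dots> \<le> t\<^sup>2 / 2 * (2 * k)" using kn by (intro mult_left_mono) auto
        finally have b: "(real m)\<^sup>2 / (2 * k) \<le> t\<^sup>2 / 2" using kpos by (simp add: pos_divide_le_eq)
        show ?thesis using a b by (simp add: D_def)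
      qed
      also have "D \<le> \<eta> / 2 * (\<tau> * real n / 2)" using nb by (simp add: mult_ac)
      finally show ?thesis using x by (rule mult_right_le_imp_le)
    qed
    finally show "measure_pmf.prob (Gstar n (nat \<lfloor>real n * t / 2\<rfloor>) F) (C1_deviates n \<rho> \<epsilon>) \<le> \<eta>"
      by (simp add: m_def)
  qed auto
qed

section \<open>Bounds on the survival probability and the main theorem\<close>

lemma tendsto_zero_if_eventually_le:
  fixes f :: "nat \<Rightarrow> real"
  assumes "\<And>k. f k \<ge> 0" and "\<And>\<eta>. \<eta> > 0 \<Longrightarrow> eventually (\<lambda>k. f k \<le> \<eta>) sequentially"
  shows "f \<longlonglongrightarrow> 0"
proof (rule tendstoI)
  fix e :: real assume "e > 0"
  then have "eventually (\<lambda>k. f k \<le> e / 2) sequentially" using assms(2)[of "e / 2"] by simp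
  then show "eventually (\<lambda>k. dist (f k) 0 < e) sequentially"
    by eventually_elim (use assms(1) \<open>e > 0\<close> in \<open>auto simp: dist_real_def\<close>)
qed

lemma tendsto_one_if_complement:
  fixes f :: "nat \<Rightarrow> real"
  assumes "\<And>k. f k \<le> 1" and "\<And>\<eta>. \<eta> > 0 \<Longrightarrow> eventually (\<lambda>k. 1 - f k \<le> \<eta>) sequentially"
  shows "f \<longlonglongrightarrow> 1"
proof -
  have "(\<lambda>k. 1 - f k) \<longlonglongrightarrow> 0" by (rule tendsto_zero_if_eventually_le) (use assms in auto)
  then have "(\<lambda>k. 1 - (1 - f k)) \<longlonglongrightarrow> 1 - 0" by (intro tendsto_diff tendsto_const)
  then show ?thesis by simp
qed

text \<open>\<open>c\<close> = 0 serves (iii), while a positive lower bound \<open>c\<close> on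
  \<delta> gives a margin independent of \<open>k\<close> for (iv). With x = \<delta> s_2 the margin
  comes from 1 / (1 + x)^2 - (1 - 2 x) = (3 x^2 + 2 x^3) / (1 + x)^2 and c \<le> x \<le> t M; the
  prefactor is at least 2 c / M since s_2 \<ge> 1 and s_3 \<le> M.\<close>

lemma lowerB_gap:
  assumes n: "\<nu> k > 0" and t: "t > 0" and M: "s_pow 3 (\<nu> k) (F k) \<le> M"
    and \<rho>: "surv_prob (\<nu> k) (F k) t \<rho>" "\<rho> > 0" and \<delta>: "delta \<nu> F t k \<ge> c" "delta \<nu> F t k > 0" and c: "c \<ge> 0"
  shows "lowerB \<nu> F t k + 2 * c / M * (3 * c\<^sup>2 / (1 + t * M)\<^sup>2) \<le> \<rho>"
proof -
  define s2 where "s2 = s_pow 2 (\<nu> k) (F k)"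
  define s3 where "s3 = s_pow 3 (\<nu> k) (F k)"
  define d where "d = delta \<nu> F t k"
  define B where "B = 2 * d * s2 ^ 3 / s3"
  define x where "x = d * s2"
  have s: "s2 \<ge> 1" "s3 \<ge> 1" using s_pow_ge_1[OF _ n] by (auto simp: s2_def s3_def)
  have s23: "s2 \<le> s3" unfolding s2_def s3_def by (rule s_pow_mono) auto
  have d: "d \<ge> c" "d > 0" "d \<le> t" using \<delta> s by (auto simp: d_def delta_def s2_def)
  have M1: "M \<ge> 1" "s2 \<le> M" using s M s23 by (auto simp: s3_def)
  have x: "c \<le> x" "x \<le> t * M" "x > 0"
  proof -
    have "c * 1 \<le> d * s2" using d s c by (intro mult_mono) auto
    then show "c \<le> x" by (simp add: x_def)
    show "x \<le> t * M" unfolding x_def using d s M1 by (intro mult_mono) auto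
    show "x > 0" using d s by (simp add: x_def)
  qed
  have "s2 ^ 3 \<ge> 1" using s by (simp add: one_le_power)
  then have B: "2 * c / M \<le> B"
    unfolding B_def using d c s M M1 mult_mono[of "2 * c" "2 * d" 1 "s2 ^ 3"]
    by (intro frac_le) (auto simp: s3_def)
  have id: "1 / (1 + x)\<^sup>2 - (1 - 2 * x) = (3 * x\<^sup>2 + 2 * x ^ 3) / (1 + x)\<^sup>2"
  proof -
    have "1 - (1 - 2 * x) * (1 + x)\<^sup>2 = 3 * x\<^sup>2 + 2 * x ^ 3"
      by (simp add: algebra_simps power2_eq_square power3_eq_cube)
    moreover have "(1 + x)\<^sup>2 \<noteq> 0" using x by simp
    ultimately show ?thesis by (metis diff_divide_distrib nonzero_mult_div_cancel_right)
  qed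
  have "3 * c\<^sup>2 / (1 + t * M)\<^sup>2 \<le> (3 * x\<^sup>2 + 2 * x ^ 3) / (1 + x)\<^sup>2"
  proof (rule frac_le)
    have "c\<^sup>2 \<le> x\<^sup>2" using x c by (intro power_mono) auto
    then show "3 * c\<^sup>2 \<le> 3 * x\<^sup>2 + 2 * x ^ 3" using x by (simp add: add_increasing2)
    show "(1 + x)\<^sup>2 \<le> (1 + t * M)\<^sup>2" using x by (intro power_mono) auto
  qed (use x in auto)
  then have "3 * c\<^sup>2 / (1 + t * M)\<^sup>2 \<le> 1 / (1 + x)\<^sup>2 - (1 - 2 * x)" by (simp only: id)
  then have "2 * c / M * (3 * c\<^sup>2 / (1 + t * M)\<^sup>2) \<le> B * (1 / (1 + x)\<^sup>2 - (1 - 2 * x))"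
    using B c M1 order_trans[OF _ B, of 0] by (intro mult_mono) auto
  also have "\<dots> = B / (1 + x)\<^sup>2 - lowerB \<nu> F t k"
    by (simp add: lowerB_def Let_def B_def x_def s2_def s3_def d_def right_diff_distrib mult.assoc)
  also have "B / (1 + x)\<^sup>2 \<le> \<rho>"
    using surv_prob_lower_bound[OF n t \<rho>, of d] \<delta>
    by (simp add: B_def x_def s2_def s3_def d_def delta_def)
  finally show ?thesis by simp
qed

text \<open>Here the margin is B x / (1 + x), from the factor 1 / (1 + x) that
  \<open>surv_prob_upper_bound\<close> has beyond the bound of the theorem.\<close>

lemma upperB_gap:
  assumes n: "\<nu> k > 0" and t: "t > 0" and M: "s_pow 3 (\<nu> k) (F k) \<le> M"
    and \<rho>: "surv_prob (\<nu> k) (F k) t \<rho>" "\<rho> > 0" and \<delta>: "delta \<nu> F t k \<ge> c" "delta \<nu> F t k > 0" and c: "c \<ge> 0"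
    and u: "upper_cond \<nu> F t k"
  shows "\<rho> + 2 * c / M * (c / (1 + t * M)) \<le> upperB \<nu> F t k"
proof -
  define s2 where "s2 = s_pow 2 (\<nu> k) (F k)"
  define s3 where "s3 = s_pow 3 (\<nu> k) (F k)"
  define s4 where "s4 = s_pow 4 (\<nu> k) (F k)"
  define d where "d = delta \<nu> F t k"
  define a where "a = 8 / 3 * d * s2 ^ 2 * s4 / s3 ^ 2"
  define B where "B = 2 * d * s2 ^ 3 / s3 * (1 + a)"
  define x where "x = d * s2"
  have s: "s2 \<ge> 1" "s3 \<ge> 1" "s4 \<ge> 1" using s_pow_ge_1[OF _ n] by (auto simp: s2_def s3_def s4_def)
  have s23: "s2 \<le> s3" unfolding s2_def s3_def by (rule s_pow_mono) auto
  have d: "d \<ge> c" "d > 0" "d \<le> t" using \<delta> s by (auto simp: d_def delta_def s2_def)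
  have M1: "M \<ge> 1" "s2 \<le> M" using s M s23 by (auto simp: s3_def)
  have x: "c \<le> x" "x \<le> t * M" "x > 0"
  proof -
    have "c * 1 \<le> d * s2" using d s c by (intro mult_mono) auto
    then show "c \<le> x" by (simp add: x_def)
    show "x \<le> t * M" unfolding x_def using d s M1 by (intro mult_mono) auto
    show "x > 0" using d s by (simp add: x_def)
  qed
  have a0: "a \<ge> 0" using d s by (simp add: a_def)
  have a1: "a \<le> 1"
  proof -
    have "d * s2 ^ 2 * s4 / s3 ^ 2 \<le> 3 / 8"
      using u by (simp add: upper_cond_def Let_def d_def s2_def s3_def s4_def)
    then have "8 / 3 * (d * s2 ^ 2 * s4 / s3 ^ 2) \<le> 8 / 3 * (3 / 8)" by (intro mult_left_mono) auto
    then show ?thesis by (simp add: a_def)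
  qed
  have "s2 ^ 3 \<ge> 1" using s by (simp add: one_le_power)
  then have "2 * c / M \<le> 2 * d * s2 ^ 3 / s3"
    using d c s M M1 mult_mono[of "2 * c" "2 * d" 1 "s2 ^ 3"]
    by (intro frac_le) (auto simp: s3_def)
  also have "\<dots> \<le> B" unfolding B_def 
    using mult_left_mono[of 1 "1 + a" "2 * d * s2 ^ 3 / s3"] d s a0 by simp
  finally have B: "2 * c / M \<le> B" .
  have "c / (1 + t * M) \<le> x / (1 + x)"
  proof -
    have "c / (1 + t * M) \<le> x / (1 + t * M)" using x t M1 by (intro divide_right_mono) auto
    also have "\<dots> \<le> x / (1 + x)" using x by (intro divide_left_mono) auto
    finally show ?thesis .
  qed
  then have "2 * c / M * (c / (1 + t * M)) \<le> B * (x / (1 + x))"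
    using B c M1 t order_trans[OF _ B, of 0] by (intro mult_mono) auto
  also have "\<dots> = B - B / (1 + x)" using x by (simp add: field_simps)
  also have "B = upperB \<nu> F t k"
    by (simp add: upperB_def Let_def B_def a_def s2_def s3_def s4_def d_def)
  finally have "2 * c / M * (c / (1 + t * M)) \<le> upperB \<nu> F t k - B / (1 + x)"
    by (simp add: \<open>B = upperB \<nu> F t k\<close>)
  moreover have "\<rho> \<le> B / (1 + x)"
    using surv_prob_upper_bound[OF n t \<rho>, of d a] \<delta> a1
    by (simp add: B_def x_def a_def s2_def s3_def s4_def d_def delta_def)
  ultimately show ?thesis by simp
qed

text \<open>Each \<open>k\<close> has its own root, 0 or the positive one according to its regime.
  \<open>conc\<close> covers both from one index on, so the conditional statements require no
  passage to subsequences.\<close>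

lemma giant_results_if_C1_concentrates:
  assumes \<nu>: "strict_mono \<nu>" "\<forall>k. \<nu> k > 0" and F: "\<forall>k. is_graph (\<nu> k) (F k)"
    and bdd: "bdd_above (range (\<lambda>k. s_pow 3 (\<nu> k) (F k)))" and t: "t > 0"
    and G: "C1_concentrates t G"
  shows "giant_results \<nu> F t (\<lambda>k. G (\<nu> k) (F k))"
proof -
  have n: "\<nu> k > 0" for k using \<nu> by simp
  obtain M where M: "\<And>k. s_pow 3 (\<nu> k) (F k) \<le> M" using bdd by (auto simp: bdd_above_def)
  have "1 \<le> s_pow 3 (\<nu> 0) (F 0)" by (rule s_pow_ge_1[OF _ n]) simp
  then have M1: "M \<ge> 1" using M[of 0] by linarith
  have s2M: "s_pow 2 (\<nu> k) (F k) \<le> M" for k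
    using s_pow_mono[of 2 3 "\<nu> k" "F k"] M[of k] by simp
  have s2: "s_pow 2 (\<nu> k) (F k) \<ge> 1" for k using s_pow_ge_1[OF _ n] by simp
  let ?P = "\<lambda>k. measure_pmf.prob (G (\<nu> k) (F k))"
  have conc: "eventually (\<lambda>k. \<forall>\<rho>. surv_prob (\<nu> k) (F k) t \<rho> \<longrightarrow> ?P k (C1_deviates (\<nu> k) \<rho> \<epsilon>) \<le> \<eta>) sequentially"
    if "\<epsilon> > 0" "\<eta> > 0" for \<epsilon> \<eta>
  proof -
    have "M > 0" using M1 by simp
    then obtain N where N: "\<forall>n\<ge>N. \<forall>F \<rho>. is_graph n F \<longrightarrow> s_pow 2 n F \<le> M \<longrightarrow> surv_prob n F t \<rho> \<longrightarrow>
        measure_pmf.prob (G n F) (C1_deviates n \<rho> \<epsilon>) \<le> \<eta>"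
      using G \<open>\<epsilon> > 0\<close> \<open>\<eta> > 0\<close> unfolding C1_concentrates_def by blast
    show ?thesis
    proof (rule eventually_sequentiallyI[of N], intro allI impI)
      fix k \<rho> assume k: "N \<le> k" and "surv_prob (\<nu> k) (F k) t \<rho>"
      then show "?P k (C1_deviates (\<nu> k) \<rho> \<epsilon>) \<le> \<eta>"
        \<comment> \<open>A strictly increasing \<nu> satisfies \<nu> k \<ge> k, so the threshold
          \<open>N\<close> for sizes also works for indices.\<close>
        using N F s2M le_trans[OF k strict_mono_imp_increasing[OF \<nu>(1)]] by blast
    qed
  qed
  have le_dev: "?P k {E. R E} \<le> ?P k (C1_deviates (\<nu> k) \<rho> \<epsilon>)"
    if "\<And>E. R E \<Longrightarrow> \<bar>X1 \<nu> k E - \<rho>\<bar> > \<epsilon>" for k R \<rho> \<epsilon>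
    using that by (intro measure_pmf.finite_measure_mono) (auto simp: C1_deviates_def X1_def)
  have sup_iff: "t > 1 / s_pow 2 (\<nu> k) (F k) \<longleftrightarrow> t * s_pow 2 (\<nu> k) (F k) > 1" for k
    using s2[of k] by (simp add: field_simps)
  have delta_iff: "delta \<nu> F t k > 0 \<longleftrightarrow> t > 1 / s_pow 2 (\<nu> k) (F k)" for k
    by (simp add: delta_def)
  have ex1: "\<exists>!\<rho>. \<rho> > 0 \<and> \<rho> = 1 - Zexp (\<nu> k) (F k) t \<rho>" if "t > 1 / s_pow 2 (\<nu> k) (F k)" for k
    using surv_prob_ex1[OF n t] that by (simp add: sup_iff)
  have ex: "\<exists>\<rho>. surv_prob (\<nu> k) (F k) t \<rho> \<and> \<rho> > 0" if "delta \<nu> F t k > 0" for k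
    using ex1[of k] that surv_prob_pos_iff[OF n] unfolding delta_iff by blast
  have i: "part_i \<nu> F t (\<lambda>k. G (\<nu> k) (F k))"
    unfolding part_i_def
  proof (intro allI impI tendsto_zero_if_eventually_le)
    fix \<epsilon> \<eta> :: real assume e: "\<epsilon> > 0" "\<eta> > 0"
    show "eventually (\<lambda>k. (if t \<le> 1 / s_pow 2 (\<nu> k) (F k) then ?P k {E. X1 \<nu> k E > \<epsilon>} else 0) \<le> \<eta>) sequentially"
      using conc[OF e]
    proof eventually_elim
      case (elim k)
      show ?case
      proof (cases "t \<le> 1 / s_pow 2 (\<nu> k) (F k)")
        case True
        then have "surv_prob (\<nu> k) (F k) t 0"
          using sup_iff[of k] by (intro surv_prob_subcritical[OF n]) linarith
        moreover have "?P k {E. X1 \<nu> k E > \<epsilon>} \<le> ?P k (C1_deviates (\<nu> k) 0 \<epsilon>)"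
          by (rule le_dev) auto
        ultimately show ?thesis using elim e by fastforce
      qed (use e in auto)
    qed
  qed auto
  have ii: "part_ii \<nu> F t (\<lambda>k. G (\<nu> k) (F k))"
    unfolding part_ii_def
  proof (intro conjI allI impI tendsto_zero_if_eventually_le)
    fix k assume "t > 1 / s_pow 2 (\<nu> k) (F k)"
    then show "\<exists>!\<rho>. \<rho> > 0 \<and> \<rho> = 1 - Zexp (\<nu> k) (F k) t \<rho>" by (rule ex1)
  next
    fix \<rho> :: "nat \<Rightarrow> real" and \<epsilon> \<eta> :: real
    assume \<rho>: "\<forall>k. t > 1 / s_pow 2 (\<nu> k) (F k) \<longrightarrow> \<rho> k > 0 \<and> \<rho> k = 1 - Zexp (\<nu> k) (F k) t (\<rho> k)"
      and e: "\<epsilon> > 0" "\<eta> > 0"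
    show "eventually (\<lambda>k. (if t > 1 / s_pow 2 (\<nu> k) (F k) then ?P k {E. \<bar>X1 \<nu> k E - \<rho> k\<bar> > \<epsilon>} else 0) \<le> \<eta>) sequentially"
      using conc[OF e]
    proof eventually_elim
      case (elim k)
      show ?case
      proof (cases "t > 1 / s_pow 2 (\<nu> k) (F k)")
        case True
        then have "surv_prob (\<nu> k) (F k) t (\<rho> k)" using \<rho> surv_prob_pos_iff[OF n] by blast
        moreover have "?P k {E. \<bar>X1 \<nu> k E - \<rho> k\<bar> > \<epsilon>} \<le> ?P k (C1_deviates (\<nu> k) (\<rho> k) \<epsilon>)"
          by (rule le_dev) auto
        ultimately show ?thesis using elim True by fastforce
      qed (use e in auto)
    qed
  qed auto
  have iii: "part_iii \<nu> F t (\<lambda>k. G (\<nu> k) (F k))"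
    unfolding part_iii_def
  proof (intro conjI allI impI tendsto_zero_if_eventually_le)
    fix \<epsilon> \<eta> :: real assume e: "\<epsilon> > 0" "\<eta> > 0"
    show "eventually (\<lambda>k. (if delta \<nu> F t k > 0 then ?P k {E. X1 \<nu> k E < lowerB \<nu> F t k - \<epsilon>} else 0) \<le> \<eta>) sequentially"
      using conc[OF e]
    proof eventually_elim
      case (elim k)
      show ?case
      proof (cases "delta \<nu> F t k > 0")
        case True
        then obtain \<rho> where \<rho>: "surv_prob (\<nu> k) (F k) t \<rho>" "\<rho> > 0" using ex by blast
        have "lowerB \<nu> F t k \<le> \<rho>" using lowerB_gap[where \<nu> = \<nu> and F = F and k = k and c = 0, OF n t M \<rho>] True by simp
        then have "?P k {E. X1 \<nu> k E < lowerB \<nu> F t k - \<epsilon>} \<le> ?P k (C1_deviates (\<nu> k) \<rho> \<epsilon>)"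
          by (intro le_dev) linarith
        then show ?thesis using elim \<rho> True by fastforce
      qed (use e in auto)
    qed
    show "eventually (\<lambda>k. (if delta \<nu> F t k > 0 \<and> upper_cond \<nu> F t k
        then ?P k {E. X1 \<nu> k E > upperB \<nu> F t k + \<epsilon>} else 0) \<le> \<eta>) sequentially"
      using conc[OF e]
    proof eventually_elim
      case (elim k)
      show ?case
      proof (cases "delta \<nu> F t k > 0 \<and> upper_cond \<nu> F t k")
        case True
        then obtain \<rho> where \<rho>: "surv_prob (\<nu> k) (F k) t \<rho>" "\<rho> > 0" using ex by blast
        have "\<rho> \<le> upperB \<nu> F t k" using upperB_gap[where \<nu> = \<nu> and F = F and k = k and c = 0, OF n t M \<rho>] True by simp
        then have "?P k {E. X1 \<nu> k E > upperB \<nu> F t k + \<epsilon>} \<le> ?P k (C1_deviates (\<nu> k) \<rho> \<epsilon>)"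
          by (intro le_dev) linarith
        then show ?thesis using elim \<rho> True by fastforce
      qed (use e in auto)
    qed
  qed auto
  have iv: "part_iv \<nu> F t (\<lambda>k. G (\<nu> k) (F k))"
    unfolding part_iv_def
  proof (intro impI)
    assume "liminf (\<lambda>k. ereal (delta \<nu> F t k)) > 0"
    then obtain c where c: "0 < ereal c" "ereal c < liminf (\<lambda>k. ereal (delta \<nu> F t k))"
      using ereal_dense2 by blast
    then have c0: "c > 0" by simp
    have ev: "eventually (\<lambda>k. c < delta \<nu> F t k) sequentially"
      using less_LiminfD[OF c(2)] by simp
    define \<gamma> where "\<gamma> = 2 * c / M * (3 * c\<^sup>2 / (1 + t * M)\<^sup>2)"
    define \<gamma>' where "\<gamma>' = 2 * c / M * (c / (1 + t * M))"
    have "1 + t * M > 0" using t M1 by (simp add: add_pos_pos)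
    then have \<gamma>: "\<gamma> > 0" "\<gamma>' > 0" using c0 M1 unfolding \<gamma>_def \<gamma>'_def
      by (auto intro!: mult_pos_pos divide_pos_pos)
    have compl: "1 - ?P k {E. R E} = ?P k {E. \<not> R E}" for k R
      using measure_pmf.prob_compl[of "{E. R E}" "G (\<nu> k) (F k)"] by (simp add: set_diff_eq)
    have "(\<lambda>k. ?P k {E. X1 \<nu> k E \<ge> lowerB \<nu> F t k}) \<longlonglongrightarrow> 1"
    proof (rule tendsto_one_if_complement)
      fix \<eta> :: real assume "\<eta> > 0"
      show "eventually (\<lambda>k. 1 - ?P k {E. X1 \<nu> k E \<ge> lowerB \<nu> F t k} \<le> \<eta>) sequentially"
        using ev conc[OF half_gt_zero[OF \<gamma>(1)] \<open>\<eta> > 0\<close>]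
      proof eventually_elim
        case (elim k)
        have pos: "delta \<nu> F t k > 0" using elim c0 by simp
        then obtain \<rho> where \<rho>: "surv_prob (\<nu> k) (F k) t \<rho>" "\<rho> > 0" using ex by blast
        have "lowerB \<nu> F t k + \<gamma> \<le> \<rho>"
          using lowerB_gap[where \<nu> = \<nu> and F = F and k = k and c = c, OF n t M \<rho>] elim c0 pos by (simp add: \<gamma>_def)
        then have "?P k {E. \<not> X1 \<nu> k E \<ge> lowerB \<nu> F t k} \<le> ?P k (C1_deviates (\<nu> k) \<rho> (\<gamma> / 2))"
          using \<gamma> by (intro le_dev) linarith
        also have "\<dots> \<le> \<eta>" using elim \<rho> by blast
        finally show ?case by (simp only: compl)
      qed
    qed simp
    moreover have "(\<lambda>k. if upper_cond \<nu> F t k then ?P k {E. X1 \<nu> k E \<le> upperB \<nu> F t k} else 1) \<longlonglongrightarrow> 1"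
    proof (rule tendsto_one_if_complement)
      fix \<eta> :: real assume "\<eta> > 0"
      show "eventually (\<lambda>k. 1 - (if upper_cond \<nu> F t k then ?P k {E. X1 \<nu> k E \<le> upperB \<nu> F t k} else 1) \<le> \<eta>) sequentially"
        using ev conc[OF half_gt_zero[OF \<gamma>(2)] \<open>\<eta> > 0\<close>]
      proof eventually_elim
        case (elim k)
        have pos: "delta \<nu> F t k > 0" using elim c0 by simp
        then obtain \<rho> where \<rho>: "surv_prob (\<nu> k) (F k) t \<rho>" "\<rho> > 0" using ex by blast
        show ?case
        proof (cases "upper_cond \<nu> F t k")
          case True
          have "\<rho> + \<gamma>' \<le> upperB \<nu> F t k"
            using upperB_gap[where \<nu> = \<nu> and F = F and k = k and c = c, OF n t M \<rho>] True elim c0 pos by (simp add: \<gamma>'_def)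
          then have "?P k {E. \<not> X1 \<nu> k E \<le> upperB \<nu> F t k} \<le> ?P k (C1_deviates (\<nu> k) \<rho> (\<gamma>' / 2))"
            using \<gamma> by (intro le_dev) linarith
          also have "\<dots> \<le> \<eta>" using elim \<rho> by blast
          finally have "1 - ?P k {E. X1 \<nu> k E \<le> upperB \<nu> F t k} \<le> \<eta>" by (simp only: compl)
          then show ?thesis using True by simp
        qed (use \<open>\<eta> > 0\<close> in simp)
      qed
    qed simp
    ultimately show "((\<lambda>k. ?P k {E. X1 \<nu> k E \<ge> lowerB \<nu> F t k}) \<longlonglongrightarrow> 1) \<and>
       ((\<lambda>k. if upper_cond \<nu> F t k then ?P k {E. X1 \<nu> k E \<le> upperB \<nu> F t k} else 1) \<longlonglongrightarrow> 1)"
      by (rule conjI)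
  qed
  show ?thesis unfolding giant_results_def using i ii iii iv by blast
qed

theorem theorem2p1:
  fixes \<nu> :: "nat \<Rightarrow> nat" and F :: "nat \<Rightarrow> nat set set" and t :: real
  assumes "strict_mono \<nu>"
    and "\<forall>k. \<nu> k > 0"
    and "\<forall>k. is_graph (\<nu> k) (F k)"
    and "bdd_above (range (\<lambda>k. s_pow 3 (\<nu> k) (F k)))"
    and "t > 0"
  shows "giant_results \<nu> F t (\<lambda>k. Gtilde (\<nu> k) t (F k)) \<and>
         giant_results \<nu> F t (\<lambda>k. Gnm (\<nu> k) (nat \<lfloor>real (\<nu> k) * t / 2\<rfloor>) (F k)) \<and>
         giant_results \<nu> F t (\<lambda>k. Gstar (\<nu> k) (nat \<lfloor>real (\<nu> k) * t / 2\<rfloor>) (F k))"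
  using giant_results_if_C1_concentrates[OF assms C1_concentrates_Gtilde[OF assms(5)]]
    giant_results_if_C1_concentrates[OF assms C1_concentrates_Gnm[OF assms(5)]]
    giant_results_if_C1_concentrates[OF assms C1_concentrates_Gstar[OF assms(5)]]
  by blast

end
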